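(* Let $r:\mathbb{X}\to\mathbb{R}^d$ be a reaction coordinate. Then: (1) $\min_{v_0^{\mathrm{RC}},v_1^{\mathrm{RC}}}\mathcal{L}^{\mathrm{FMRC}}[v_0^{\mathrm{RC}},v_1^{\mathrm{RC}},r]\ \ge\ \min_{v_0,v_1}\mathcal{L}[v_0,v_1]$, where the first minimum is over vector fields $v_0^{\mathrm{RC}},v_1^{\mathrm{RC}}:\mathbb{R}\times\mathbb{R}^D\times\mathbb{R}^d\to\mathbb{R}^D$ and the second over vector fields $v_0,v_1:\mathbb{R}\times\mathbb{R}^D\times\mathbb{R}^D\to\mathbb{R}^D$. (2) Equality holds in (1) if and only if the system is both lumpable and decomposable with respect to $r$.
   Context: Setting. $\mathbb{X}\subset\mathbb{R}^D$ is a measurable set with Lebesgue measure, $\{X_t\}_{t\ge 0}$ is a Markov process on $\mathbb{X}$, $\tau>0$ is a fixed lag time, and the transition probability function has a density $p_\tau:\mathbb{X}\times\mathbb{X}\to\mathbb{R}^+$, i.e. $\mathrm{Prob}[X_{t+\tau}\in B\mid X_t=x]=\int_B p_\tau(x,y)\,dy$ for all $x\in\mathbb{X}$ and Borel $B$. $\rho_0$ is a probability density on $\mathbb{X}$ (the marginal density of $X_t$ in the data), $\rho(x,y)=\rho_0(x)p_\tau(x,y)$ is the joint density of $(X_t,X_{t+\tau})$, and $\rho_1(y)=\int_{\mathbb{X}}\rho_0(x)p_\tau(x,y)\,dx$ is the marginal density of $X_{t+\tau}$. Stationarity ($\rho_0=\rho_1$) is not assumed. A reaction coordinate (RC) is a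 continuously differentiable function $r:\mathbb{X}\to\mathbb{R}^d$ with $d\ll D$ such that for every $z\in\mathbb{Z}:=r(\mathbb{X})$ the level set $\{x\in\mathbb{X}: r(x)=z\}$ is a $(D-d)$-dimensional topological submanifold of $\mathbb{X}$. Lumpability: the system is lumpable with respect to $r$ if there is a function $p_\tau^L:\mathbb{Z}\times\mathbb{X}\to\mathbb{R}^+$ with $p_\tau(x,y)=p_\tau^L(r(x),y)$ for all $x,y\in\mathbb{X}$. Decomposability: the system is decomposable with respect to $r$ if there are functions $p_\tau^D:\mathbb{X}\times\mathbb{Z}\to\mathbb{R}^+$ and $p_{\mathrm{local}}:\mathbb{Z}\times\mathbb{X}\to\mathbb{R}^+$ with $p_\tau(x,y)=p_\tau^D(x,r(y))\,p_{\mathrm{local}}(r(y),y)$ for all $x,y\in\mathbb{X}$. Loss functions. For $s\in[0,1]$ let $I(s;a,b)=(1-s)a+sb$. Let $(X_t,X_{t+\tau})\sim\rho$, let $X_t'$ and $X_{t+\tau}'$ be standard Gaussian $\mathcal{N}(\mathbf 0,\mathbf I)$ in $\mathbb{R}^D$ independent of $(X_t,X_{t+\tau})$, let $s\sim\mathcal{U}(0,1)$ be independent of everything else, and put $X_{t+\tau}^s=I(s;X_{t+\tau}',X_{t+\tau})$, $X_t^s=I(s;X_t',X_t)$. For (measurable) $v:\mathbb{R}\times\mathbb{R}^D\times\mathbb{R}^D\to\mathbb{R}^D$ define $$\mathcal{L}_0[v]=\mathbb{E}\big[\|v(s,X_{t+\tau}^s,X_t)-(X_{t+\tau}-X_{t+\tau}')\|^2\big],\qquad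 \mathcal{L}_1[v]=\mathbb{E}\big[\|v(s,X_t^s,X_{t+\tau})-(X_t-X_t')\|^2\big],$$ $$\mathcal{L}[v_0,v_1]=\mathcal{L}_0[v_0]+\mathcal{L}_1[v_1].$$ For (measurable) $v_0^{\mathrm{RC}},v_1^{\mathrm{RC}}:\mathbb{R}\times\mathbb{R}^D\times\mathbb{R}^d\to\mathbb{R}^D$ define $$\mathcal{L}^{\mathrm{FMRC}}[v_0^{\mathrm{RC}},v_1^{\mathrm{RC}},r]=\mathcal{L}_0\big[(s,y,x)\mapsto v_0^{\mathrm{RC}}(s,y,r(x))\big]+\mathcal{L}_1\big[(s,x,y)\mapsto v_1^{\mathrm{RC}}(s,x,r(y))\big].$$
   Formalization: Lumpability and decomposability are required for almost every (x,y) with respect to ρ₀(x)dx⊗dy, with measurable factors, since the losses ignore null sets; in (2) the minimum of L is assumed finite, since otherwise both minima can be infinite and equality is automatic. *)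

theory Defs
  imports "HOL-Probability.Probability"
begin

text \<open>
  The state space is a Lebesgue measurable \<open>X \<subseteq> \<real>\<^sup>D\<close> (index type \<open>'n\<close>, so \<open>D = CARD('n)\<close>), carrying the
  measure \<open>lebesgue_on X\<close>; reaction coordinates take values in \<open>\<real>\<^sup>d\<close> (index type \<open>'d\<close>).  Functions
  on \<open>X\<close> are total functions whose values off \<open>X\<close> are irrelevant.
\<close>

definition prob_density_on :: "(real^'n) set \<Rightarrow> (real^'n \<Rightarrow> real) \<Rightarrow> bool" where
  "prob_density_on X \<rho>0 \<longleftrightarrow>
     \<rho>0 \<in> borel_measurable (lebesgue_on X) \<and>
     (\<forall>x\<in>X. 0 \<le> \<rho>0 x) \<and>
     (\<integral>\<^sup>+x. ennreal (\<rho>0 x) \<partial>lebesgue_on X) = 1"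

text \<open>\<open>p x y\<close> is the density at \<open>y\<close> of the law of the process one lag time after it was at \<open>x\<close>.\<close>

definition transition_density_on :: "(real^'n) set \<Rightarrow> (real^'n \<Rightarrow> real^'n \<Rightarrow> real) \<Rightarrow> bool" where
  "transition_density_on X p \<longleftrightarrow>
     (\<lambda>(x, y). p x y) \<in> borel_measurable (lebesgue_on X \<Otimes>\<^sub>M lebesgue_on X) \<and>
     (\<forall>x\<in>X. \<forall>y\<in>X. 0 \<le> p x y) \<and>
     (\<forall>x\<in>X. (\<integral>\<^sup>+y. ennreal (p x y) \<partial>lebesgue_on X) = 1)"

text \<open>
  Topological manifold of dimension \<open>k\<close>, in the subspace topology; Hausdorff and second countable
  hold automatically for subsets of a Euclidean space.
\<close>

definition topological_manifold :: "nat \<Rightarrow> 'a::euclidean_space set \<Rightarrow> bool" where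
  "topological_manifold k S \<longleftrightarrow>
     (\<forall>x\<in>S. \<exists>U V. openin (top_of_set S) U \<and> x \<in> U \<and> openin (Euclidean_space k) V \<and>
        top_of_set U homeomorphic_space subtopology (Euclidean_space k) V)"

text \<open>
  \<open>X\<close> need not be open, so \<open>C\<^sup>1\<close> is expressed by a continuous choice of derivatives within \<open>X\<close>.
  The informal \<open>d \<lless> D\<close> is read as \<open>d < D\<close>.
\<close>

definition reaction_coordinate :: "(real^'n) set \<Rightarrow> (real^'n \<Rightarrow> real^'d) \<Rightarrow> bool" where
  "reaction_coordinate X r \<longleftrightarrow>
     CARD('d) < CARD('n) \<and>
     (\<exists>r' :: real^'n \<Rightarrow> ((real^'n) \<Rightarrow>\<^sub>L (real^'d)).
        (\<forall>x\<in>X. (r has_derivative blinfun_apply (r' x)) (at x within X)) \<and> continuous_on X r') \<and>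
     (\<forall>z\<in>r ` X. topological_manifold (CARD('n) - CARD('d)) {x\<in>X. r x = z})"

text \<open>
  Densities are determined only almost everywhere, and the data distribution says nothing about
  \<open>p x\<close> where \<open>\<rho>0\<close> vanishes.  Hence the two identities below are required for almost every
  \<open>x\<close> with respect to the law \<open>\<rho>0 dx\<close> and Lebesgue almost every \<open>y\<close>, with measurable factors.
\<close>

definition initial_law :: "(real^'n) set \<Rightarrow> (real^'n \<Rightarrow> real) \<Rightarrow> (real^'n) measure" where
  "initial_law X \<rho>0 = density (lebesgue_on X) (\<lambda>x. ennreal (\<rho>0 x))"

definition lumpable ::
  "(real^'n) set \<Rightarrow> (real^'n \<Rightarrow> real) \<Rightarrow> (real^'n \<Rightarrow> real^'n \<Rightarrow> real) \<Rightarrow> (real^'n \<Rightarrow> real^'d) \<Rightarrow> bool" where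
  "lumpable X \<rho>0 p r \<longleftrightarrow>
     (\<exists>pL :: real^'d \<Rightarrow> real^'n \<Rightarrow> real.
        (\<lambda>(z, y). pL z y) \<in> borel_measurable (restrict_space borel (r ` X) \<Otimes>\<^sub>M lebesgue_on X) \<and>
        (\<forall>z\<in>r ` X. \<forall>y\<in>X. 0 \<le> pL z y) \<and>
        (AE (x, y) in initial_law X \<rho>0 \<Otimes>\<^sub>M lebesgue_on X. p x y = pL (r x) y))"

definition decomposable ::
  "(real^'n) set \<Rightarrow> (real^'n \<Rightarrow> real) \<Rightarrow> (real^'n \<Rightarrow> real^'n \<Rightarrow> real) \<Rightarrow> (real^'n \<Rightarrow> real^'d) \<Rightarrow> bool" where
  "decomposable X \<rho>0 p r \<longleftrightarrow>
     (\<exists>(pD :: real^'n \<Rightarrow> real^'d \<Rightarrow> real) (plocal :: real^'d \<Rightarrow> real^'n \<Rightarrow> real).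
        (\<lambda>(x, z). pD x z) \<in> borel_measurable (lebesgue_on X \<Otimes>\<^sub>M restrict_space borel (r ` X)) \<and>
        (\<lambda>(z, y). plocal z y) \<in> borel_measurable (restrict_space borel (r ` X) \<Otimes>\<^sub>M lebesgue_on X) \<and>
        (\<forall>x\<in>X. \<forall>z\<in>r ` X. 0 \<le> pD x z) \<and>
        (\<forall>z\<in>r ` X. \<forall>y\<in>X. 0 \<le> plocal z y) \<and>
        (AE (x, y) in initial_law X \<rho>0 \<Otimes>\<^sub>M lebesgue_on X. p x y = pD x (r y) * plocal (r y) y))"

definition std_gaussian :: "(real^'n) measure" where
  "std_gaussian = density lborel (\<lambda>x. ennreal (\<Prod>i\<in>UNIV. std_normal_density (x $ i)))"

definition joint_law ::
  "(real^'n) set \<Rightarrow> (real^'n \<Rightarrow> real) \<Rightarrow> (real^'n \<Rightarrow> real^'n \<Rightarrow> real) \<Rightarrow> ((real^'n) \<times> (real^'n)) measure" where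
  "joint_law X \<rho>0 p =
     density (lebesgue_on X \<Otimes>\<^sub>M lebesgue_on X) (\<lambda>(x, y). ennreal (\<rho>0 x * p x y))"

text \<open>Joint law of the data pair \<open>(x, y)\<close>, of the Gaussian noises \<open>(x', y')\<close>, and of \<open>s\<close>.\<close>

definition sample_law ::
  "(real^'n) set \<Rightarrow> (real^'n \<Rightarrow> real) \<Rightarrow> (real^'n \<Rightarrow> real^'n \<Rightarrow> real) \<Rightarrow>
   (((real^'n) \<times> (real^'n)) \<times> ((real^'n) \<times> (real^'n)) \<times> real) measure" where
  "sample_law X \<rho>0 p =
     joint_law X \<rho>0 p \<Otimes>\<^sub>M (std_gaussian \<Otimes>\<^sub>M std_gaussian) \<Otimes>\<^sub>M uniform_measure lborel {0<..<1}"

definition interp :: "real \<Rightarrow> real^'n \<Rightarrow> real^'n \<Rightarrow> real^'n" where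
  "interp s a b = (1 - s) *\<^sub>R a + s *\<^sub>R b"

definition loss0 ::
  "(real^'n) set \<Rightarrow> (real^'n \<Rightarrow> real) \<Rightarrow> (real^'n \<Rightarrow> real^'n \<Rightarrow> real) \<Rightarrow>
   (real \<Rightarrow> real^'n \<Rightarrow> real^'n \<Rightarrow> real^'n) \<Rightarrow> ennreal" where
  "loss0 X \<rho>0 p v =
     (\<integral>\<^sup>+((x, y), (x', y'), s). ennreal ((norm (v s (interp s y' y) x - (y - y')))\<^sup>2) \<partial>sample_law X \<rho>0 p)"

definition loss1 ::
  "(real^'n) set \<Rightarrow> (real^'n \<Rightarrow> real) \<Rightarrow> (real^'n \<Rightarrow> real^'n \<Rightarrow> real) \<Rightarrow>
   (real \<Rightarrow> real^'n \<Rightarrow> real^'n \<Rightarrow> real^'n) \<Rightarrow> ennreal" where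
  "loss1 X \<rho>0 p v =
     (\<integral>\<^sup>+((x, y), (x', y'), s). ennreal ((norm (v s (interp s x' x) y - (x - x')))\<^sup>2) \<partial>sample_law X \<rho>0 p)"

definition loss ::
  "(real^'n) set \<Rightarrow> (real^'n \<Rightarrow> real) \<Rightarrow> (real^'n \<Rightarrow> real^'n \<Rightarrow> real) \<Rightarrow>
   (real \<Rightarrow> real^'n \<Rightarrow> real^'n \<Rightarrow> real^'n) \<times> (real \<Rightarrow> real^'n \<Rightarrow> real^'n \<Rightarrow> real^'n) \<Rightarrow> ennreal" where
  "loss X \<rho>0 p = (\<lambda>(v0, v1). loss0 X \<rho>0 p v0 + loss1 X \<rho>0 p v1)"

definition loss_FMRC ::
  "(real^'n) set \<Rightarrow> (real^'n \<Rightarrow> real) \<Rightarrow> (real^'n \<Rightarrow> real^'n \<Rightarrow> real) \<Rightarrow> (real^'n \<Rightarrow> real^'d) \<Rightarrow>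
   (real \<Rightarrow> real^'n \<Rightarrow> real^'d \<Rightarrow> real^'n) \<times> (real \<Rightarrow> real^'n \<Rightarrow> real^'d \<Rightarrow> real^'n) \<Rightarrow> ennreal" where
  "loss_FMRC X \<rho>0 p r = (\<lambda>(v0, v1).
     loss0 X \<rho>0 p (\<lambda>s y x. v0 s y (r x)) + loss1 X \<rho>0 p (\<lambda>s x y. v1 s x (r y)))"

definition vector_fields :: "(real \<Rightarrow> real^'n \<Rightarrow> real^'c \<Rightarrow> real^'n) set" where
  "vector_fields = {v. (\<lambda>(s, y, c). v s y c) \<in> borel_measurable borel}"

definition min_loss ::
  "(real^'n) set \<Rightarrow> (real^'n \<Rightarrow> real) \<Rightarrow> (real^'n \<Rightarrow> real^'n \<Rightarrow> real) \<Rightarrow> ennreal" where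
  "min_loss X \<rho>0 p = (INF v\<in>vector_fields \<times> vector_fields. loss X \<rho>0 p v)"

definition min_loss_FMRC ::
  "(real^'n) set \<Rightarrow> (real^'n \<Rightarrow> real) \<Rightarrow> (real^'n \<Rightarrow> real^'n \<Rightarrow> real) \<Rightarrow> (real^'n \<Rightarrow> real^'d) \<Rightarrow> ennreal" where
  "min_loss_FMRC X \<rho>0 p r = (INF w\<in>vector_fields \<times> vector_fields. loss_FMRC X \<rho>0 p r w)"

end

theory Submission
  imports Defs
begin

text \<open>
  Each loss is a regression problem: a field \<open>v\<close> predicts the displacement \<open>y - u\<close> from \<open>Z = (s, w, c)\<close>,
  where \<open>c\<close> is the conditioning variable and \<open>w = (1 - s) u + s y\<close> is the noised endpoint.  If \<open>(c, y)\<close>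
  has joint density \<open>j\<close>, then given \<open>Z\<close> the endpoint \<open>y\<close> has weight \<open>gauss u * j c y\<close>, where
  \<open>u = (w - s y) / (1 - s)\<close>, and the displacement is \<open>(w - u) / s\<close>.  So the conditional mean of the
  displacement is an explicit function of \<open>Z\<close> (\<open>opt_velocity\<close>).  As \<open>gauss u * (norm u)\<^sup>2\<close> is bounded,
  the conditional second moment is finite at almost every \<open>Z\<close>; hence Pythagoras holds pointwise, and the loss
  of \<open>v\<close> is the loss of the conditional mean plus a weighted squared distance to it, also when
  these numbers are infinite (\<open>fm_loss_pythagoras\<close>).  This gives the existence of minimizers.

  A field that sees only \<open>r c\<close> has the same loss for \<open>(c, y)\<close> as for the law of \<open>(r c, y)\<close>, which
  has a density \<open>k\<close> by Radon and Nikodym; its best choice is the conditional mean for \<open>k\<close>.  Such fields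
  are special cases of fields that see \<open>c\<close>, whence the inequality.  If the minima are finite and agree,
  the conditional means for \<open>k\<close> and for \<open>j\<close> agree almost everywhere.

  The heart of the proof is that the conditional mean determines the law of \<open>y\<close>.  The density of the
  noised endpoint, \<open>F w = \<integral> gauss u * j c y dy\<close> up to a constant, is smooth and satisfies
  \<open>\<nabla>F = - (\<integral> gauss u * j c y * u dy) / (1 - s)\<close>, so the conditional mean is an affine function of
  the gradient of \<open>ln F\<close>.  Two laws with the same conditional means thus have proportional noised
  densities; letting \<open>s \<rightarrow> 1\<close> the noise disappears and the laws themselves are proportional
  (\<open>densities_proportional_of_opt_velocity_eq\<close>).

  Therefore a finite minimum is reached by fields that see only \<open>r c\<close> exactly if \<open>j c y = a c * k (r c) y\<close>
  for some \<open>a\<close> and \<open>k\<close>.  Here \<open>j\<close> is \<open>\<rho>0 x * p x y\<close>.  In the first loss \<open>c = x\<close>, so \<open>a = \<rho>0\<close> and \<open>k\<close> is the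
  density in the definition of lumpability.  In the second loss \<open>c = y\<close> and \<open>x\<close> is the endpoint; the
  factorization \<open>a y * k (r y) x\<close> is decomposability with \<open>plocal (r y) y = a y\<close> and \<open>pD x z = k z x / \<rho>0 x\<close>.  Both minima are sums over the
  two losses, and they are ordered term by term, so if they are finite they agree exactly if both terms do.
\<close>

section \<open>The Gaussian kernel and the posterior of the noise\<close>

definition gauss :: "real^'n \<Rightarrow> real" where
  "gauss u = (\<Prod>i\<in>UNIV. std_normal_density (u $ i))"

lemma gauss_eq: "gauss (u::real^'n) = (1 / sqrt (2 * pi)) ^ CARD('n) * exp (- (norm u)\<^sup>2 / 2)"
proof -
  have "(\<Sum>i\<in>UNIV. (u $ i)\<^sup>2) = (norm u)\<^sup>2"
    by (subst power2_norm_eq_inner) (simp add: inner_vec_def power2_eq_square)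
  then have "(\<Prod>i\<in>UNIV. exp (- (u $ i)\<^sup>2 / 2)) = exp (- (norm u)\<^sup>2 / 2)"
    by (simp add: exp_sum[symmetric] sum_negf sum_divide_distrib[symmetric])
  then show ?thesis
    by (simp add: gauss_def std_normal_density_def prod.distrib power_divide prod_dividef)
qed

lemma gauss_pos: "0 < gauss (u::real^'n)"
  by (simp add: gauss_eq)

lemma gauss_nonneg [simp]: "0 \<le> gauss (u::real^'n)"
  by (rule less_imp_le) (rule gauss_pos)

lemma gauss_le: "gauss (u::real^'n) \<le> gauss (0::real^'n)"
  by (simp add: gauss_eq mult_le_cancel_left2)

text \<open>From \<open>t \<le> exp t\<close> at \<open>t = (norm u)\<^sup>2 / 2\<close>.  Together with the next bound this dominates every integrand
  below by a multiple of the density, uniformly in the noise.\<close>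

lemma gauss_second_moment_le: "gauss (u::real^'n) * (norm u)\<^sup>2 \<le> 2 * gauss (0::real^'n)"
proof -
  have "(norm u)\<^sup>2 / 2 \<le> exp ((norm u)\<^sup>2 / 2)"
    using exp_ge_add_one_self[of "(norm u)\<^sup>2 / 2"] by linarith
  then have "exp (- (norm u)\<^sup>2 / 2) * (norm u)\<^sup>2 \<le> 2"
    by (simp add: exp_minus field_simps)
  then show ?thesis
    using mult_left_mono[of _ 2 "(1 / sqrt (2 * pi)) ^ CARD('n)"] by (simp add: gauss_eq mult_ac)
qed

lemma gauss_first_moment_le: "gauss (u::real^'n) * norm u \<le> 3 * gauss (0::real^'n)"
proof -
  have "norm u \<le> 1 + (norm u)\<^sup>2"
    using sum_squares_bound[of "norm u" 1] norm_ge_zero[of u] unfolding one_power2 mult_1_right by linarith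
  then have "gauss u * norm u \<le> gauss u * (1 + (norm u)\<^sup>2)"
    by (rule mult_left_mono) simp
  also have "\<dots> \<le> 3 * gauss (0::real^'n)"
    using gauss_le[of u] gauss_second_moment_le[of u] by (simp add: algebra_simps)
  finally show ?thesis .
qed

lemma continuous_on_gauss [continuous_intros]:
  "continuous_on A f \<Longrightarrow> continuous_on A (\<lambda>x. gauss (f x :: real^'n))"
  unfolding gauss_eq by (intro continuous_intros) auto

lemma borel_measurable_gauss [measurable]: "gauss \<in> borel_measurable borel"
  by (intro borel_measurable_continuous_onI continuous_intros)

lemma nn_integral_gauss: "(\<integral>\<^sup>+(u::real^'n). ennreal (gauss u) \<partial>lborel) = 1"
proof -
  have one: "(\<integral>\<^sup>+x. ennreal (std_normal_density x) \<partial>lborel) = 1"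
    by (simp add: nn_integral_eq_integral)
  have ax: "(\<Prod>b\<in>Basis. ennreal (std_normal_density (u \<bullet> b))) = ennreal (gauss u)" for u :: "real^'n"
  proof -
    have "(\<Prod>b\<in>(\<lambda>i. axis i (1::real)) ` UNIV. ennreal (std_normal_density (u \<bullet> b))) = ennreal (gauss u)"
      by (subst prod.reindex) (auto simp: inj_on_def axis_eq_axis inner_axis gauss_def prod_ennreal)
    moreover have "(\<lambda>i. axis i (1::real)) ` UNIV = (Basis :: (real^'n) set)"
      by (auto simp: Basis_vec_def)
    ultimately show ?thesis by simp
  qed
  have "(\<integral>\<^sup>+(u::real^'n). (\<Prod>b\<in>Basis. ennreal (std_normal_density (u \<bullet> b))) \<partial>lborel) =
      (\<Prod>b\<in>(Basis::(real^'n) set). (\<integral>\<^sup>+x. ennreal (std_normal_density x) \<partial>lborel))"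
    by (rule nn_integral_lborel_prod) auto
  then show ?thesis by (simp add: ax one)
qed

lemma gauss_line_derivative:
  "((\<lambda>t. gauss (a + t *\<^sub>R b :: real^'n)) has_real_derivative
      - ((b \<bullet> (a + t *\<^sub>R b)) * gauss (a + t *\<^sub>R b))) (at t)"
proof -
  have *: "(norm (a + t *\<^sub>R b))\<^sup>2 = a \<bullet> a + 2 * t * (a \<bullet> b) + t\<^sup>2 * (b \<bullet> b)" for t
    unfolding power2_norm_eq_inner
    by (simp add: inner_add_left inner_add_right inner_commute[of b a] power2_eq_square algebra_simps)
  show ?thesis
    unfolding gauss_eq *
    by (auto intro!: derivative_eq_intros simp: inner_add_left inner_add_right inner_commute[of b a] field_simps)
qed

text \<open>The noise \<open>u\<close> for which \<open>interp s u y = w\<close>.\<close>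

definition noise :: "real \<Rightarrow> real^'n \<Rightarrow> real^'n \<Rightarrow> real^'n" where
  "noise s w y = (1 / (1 - s)) *\<^sub>R (w - s *\<^sub>R y)"

text \<open>Up to the factor \<open>(1 - s) ^ CARD('n)\<close>, the density at \<open>w\<close> of \<open>interp s u y\<close> when \<open>u\<close> is standard Gaussian and
  \<open>y\<close> has density \<open>q\<close>: the normalizing constant of the posterior of \<open>y\<close>.\<close>

definition evidence :: "(real^'n) measure \<Rightarrow> (real^'n \<Rightarrow> real) \<Rightarrow> real \<Rightarrow> real^'n \<Rightarrow> real" where
  "evidence N q s w = (\<integral>y. gauss (noise s w y) * q y \<partial>N)"

definition noise_moment :: "(real^'n) measure \<Rightarrow> (real^'n \<Rightarrow> real) \<Rightarrow> real \<Rightarrow> real^'n \<Rightarrow> real^'n" where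
  "noise_moment N q s w = (\<integral>y. (gauss (noise s w y) * q y) *\<^sub>R noise s w y \<partial>N)"

text \<open>The conditional mean of the displacement \<open>y - u = (w - u) / s\<close> given that \<open>interp s u y = w\<close>.\<close>

definition opt_velocity :: "(real^'n) measure \<Rightarrow> (real^'n \<Rightarrow> real) \<Rightarrow> real \<Rightarrow> real^'n \<Rightarrow> real^'n" where
  "opt_velocity N q s w = (1 / s) *\<^sub>R (w - (1 / evidence N q s w) *\<^sub>R noise_moment N q s w)"

lemma borel_measurable_noise [measurable (raw)]:
  assumes [measurable]: "s \<in> borel_measurable M" "w \<in> borel_measurable M" "y \<in> borel_measurable M"
  shows "(\<lambda>x. noise (s x) (w x) (y x)) \<in> borel_measurable M"
  unfolding noise_def by measurable

text \<open>The measures that carry the observed points.  Lebesgue measure on a Lebesgue measurable set has more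
  measurable sets than the Borel sets, but only up to null sets; the second assumption records this, and
  with it Borel tests suffice to identify a density.\<close>

locale observation = sigma_finite_measure N for N :: "(real^'n) measure" +
  assumes point: "(\<lambda>y. y) \<in> borel_measurable N"
    and borel_up_to_null: "A \<in> sets N \<Longrightarrow> \<exists>B\<in>sets borel. AE y in N. y \<in> A \<longleftrightarrow> y \<in> B"
begin

context
  fixes q :: "real^'n \<Rightarrow> real"
  assumes q: "integrable N q"
begin

lemma q_measurable [measurable]: "q \<in> borel_measurable N"
  using q by simp

lemma integrable_evidence: "integrable N (\<lambda>y. gauss (noise s w y) * q y)"
  supply point [measurable]
proof (rule Bochner_Integration.integrable_bound)
  show "integrable N (\<lambda>y. gauss (0::real^'n) * q y)" using q by simp
  show "AE y in N. norm (gauss (noise s w y) * q y) \<le> norm (gauss (0::real^'n) * q y)"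
    by (auto simp: abs_mult intro!: mult_right_mono gauss_le)
qed measurable

lemma integrable_noise_moment: "integrable N (\<lambda>y. (gauss (noise s w y) * q y) *\<^sub>R noise s w y)"
  supply point [measurable]
proof (rule Bochner_Integration.integrable_bound)
  show "integrable N (\<lambda>y. 3 * gauss (0::real^'n) * q y)" using q by simp
  show "AE y in N. norm ((gauss (noise s w y) * q y) *\<^sub>R noise s w y) \<le> norm (3 * gauss (0::real^'n) * q y)"
  proof (intro AE_I2)
    fix y
    have "gauss (noise s w y) * norm (noise s w y) * \<bar>q y\<bar> \<le> 3 * gauss (0::real^'n) * \<bar>q y\<bar>"
      by (intro mult_right_mono gauss_first_moment_le) auto
    then show "norm ((gauss (noise s w y) * q y) *\<^sub>R noise s w y) \<le> norm (3 * gauss (0::real^'n) * q y)"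
      by (simp add: abs_mult mult_ac)
  qed
qed measurable

lemma continuous_evidence: "continuous_on UNIV (evidence N q s)"
  supply point [measurable]
proof (rule continuous_on_sequentiallyI)
  fix u a assume u: "u \<longlonglongrightarrow> (a :: real^'n)"
  show "(\<lambda>n. evidence N q s (u n)) \<longlonglongrightarrow> evidence N q s a"
    unfolding evidence_def
  proof (rule integral_dominated_convergence[where w="\<lambda>y. \<bar>gauss (0::real^'n) * q y\<bar>"])
    show "integrable N (\<lambda>y. \<bar>gauss (0::real^'n) * q y\<bar>)" using q by auto
    show "AE y in N. norm (gauss (noise s (u n) y) * q y) \<le> \<bar>gauss (0::real^'n) * q y\<bar>" for n
      by (auto simp: abs_mult intro!: mult_right_mono gauss_le)
    have cont: "continuous_on UNIV (\<lambda>w. gauss (noise s w y) * q y)" for y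
      unfolding noise_def by (intro continuous_intros)
    show "AE y in N. (\<lambda>n. gauss (noise s (u n) y) * q y) \<longlonglongrightarrow> gauss (noise s a y) * q y"
      by (rule AE_I2, rule continuous_on_tendsto_compose[OF cont u]) auto
  qed measurable
qed

lemma continuous_noise_moment: "continuous_on UNIV (noise_moment N q s)"
  supply point [measurable]
proof (rule continuous_on_sequentiallyI)
  fix u a assume u: "u \<longlonglongrightarrow> (a :: real^'n)"
  show "(\<lambda>n. noise_moment N q s (u n)) \<longlonglongrightarrow> noise_moment N q s a"
    unfolding noise_moment_def
  proof (rule integral_dominated_convergence[where w="\<lambda>y. 3 * gauss (0::real^'n) * \<bar>q y\<bar>"])
    show "integrable N (\<lambda>y. 3 * gauss (0::real^'n) * \<bar>q y\<bar>)" using q by auto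
    show "AE y in N. norm ((gauss (noise s (u n) y) * q y) *\<^sub>R noise s (u n) y) \<le> 3 * gauss (0::real^'n) * \<bar>q y\<bar>" for n
    proof (intro AE_I2)
      fix y
      have "gauss (noise s (u n) y) * norm (noise s (u n) y) * \<bar>q y\<bar> \<le> 3 * gauss (0::real^'n) * \<bar>q y\<bar>"
        by (intro mult_right_mono gauss_first_moment_le) auto
      then show "norm ((gauss (noise s (u n) y) * q y) *\<^sub>R noise s (u n) y) \<le> 3 * gauss (0::real^'n) * \<bar>q y\<bar>"
        by (simp add: abs_mult mult_ac)
    qed
    have cont: "continuous_on UNIV (\<lambda>w. (gauss (noise s w y) * q y) *\<^sub>R noise s w y)" for y
      unfolding noise_def by (intro continuous_intros)
    show "AE y in N. (\<lambda>n. (gauss (noise s (u n) y) * q y) *\<^sub>R noise s (u n) y) \<longlonglongrightarrow>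
        (gauss (noise s a y) * q y) *\<^sub>R noise s a y"
      by (rule AE_I2, rule continuous_on_tendsto_compose[OF cont u]) auto
  qed measurable
qed

text \<open>The gradient of the evidence is \<open>- noise_moment / (1 - s)\<close>, by differentiation under the integral:
  the bound on \<open>gauss u * norm u\<close> makes the difference quotients bounded by a multiple of \<open>q\<close>.  Derivatives
  along lines through the origin are all that is used, so the statement stays one-dimensional.\<close>

lemma evidence_line_derivative:
  "((\<lambda>t. evidence N q s (t *\<^sub>R w)) has_real_derivative
      - (w \<bullet> noise_moment N q s (t *\<^sub>R w)) / (1 - s)) (at t)"
  supply point [measurable]
proof -
  define \<phi> where "\<phi> y t = gauss (noise s (t *\<^sub>R w) y)" for y t
  define \<phi>' where "\<phi>' y t = - (((1 / (1 - s)) *\<^sub>R w) \<bullet> noise s (t *\<^sub>R w) y) * gauss (noise s (t *\<^sub>R w) y)" for y t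
  define C where "C = norm ((1 / (1 - s)) *\<^sub>R w) * (3 * gauss (0::real^'n))"
  have [measurable]: "(\<lambda>y. \<phi> y t) \<in> borel_measurable N" "(\<lambda>y. \<phi>' y t) \<in> borel_measurable N" for t
    unfolding \<phi>_def \<phi>'_def by measurable
  have line: "noise s (t *\<^sub>R w) y = noise s 0 y + t *\<^sub>R ((1 / (1 - s)) *\<^sub>R w)" for t y
    by (simp add: noise_def algebra_simps)
  have d: "(\<phi> y has_real_derivative \<phi>' y t) (at t)" for y t
    using gauss_line_derivative[of "noise s 0 y" "(1 / (1 - s)) *\<^sub>R w" t]
    unfolding \<phi>_def \<phi>'_def line by simp
  have bound: "\<bar>\<phi>' y t\<bar> \<le> C" for y t
  proof -
    let ?u = "noise s (t *\<^sub>R w) y"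
    have "\<bar>\<phi>' y t\<bar> = \<bar>((1 / (1 - s)) *\<^sub>R w) \<bullet> ?u\<bar> * gauss ?u"
      by (simp add: \<phi>'_def abs_mult)
    also have "\<dots> \<le> (norm ((1 / (1 - s)) *\<^sub>R w) * norm ?u) * gauss ?u"
      by (intro mult_right_mono Cauchy_Schwarz_ineq2) auto
    also have "\<dots> \<le> C"
      unfolding C_def using gauss_first_moment_le[of ?u]
      by (simp only: mult.assoc mult.commute[of "norm ?u"]) (intro mult_left_mono, auto)
    finally show ?thesis .
  qed
  have lip: "\<bar>\<phi> y a - \<phi> y b\<bar> \<le> C * \<bar>a - b\<bar>" for y a b
    using field_differentiable_bound[of UNIV "\<phi> y" "\<phi>' y" C b a] d bound
    by (auto simp: abs_minus_commute intro: has_field_derivative_at_within)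
  have "((\<lambda>t. \<integral>y. \<phi> y t * q y \<partial>N) has_real_derivative (\<integral>y. \<phi>' y t * q y \<partial>N)) (at t)"
    unfolding has_field_derivative_iff tendsto_at_iff_sequentially comp_def
  proof (intro allI impI)
    fix X :: "nat \<Rightarrow> real"
    assume X: "\<forall>i. X i \<in> UNIV - {t}" and lim: "X \<longlonglongrightarrow> t"
    have int: "integrable N (\<lambda>y. \<phi> y t * q y)" for t
      unfolding \<phi>_def by (rule integrable_evidence)
    have "(\<lambda>n. \<integral>y. (\<phi> y (X n) - \<phi> y t) / (X n - t) * q y \<partial>N) \<longlonglongrightarrow> (\<integral>y. \<phi>' y t * q y \<partial>N)"
    proof (rule integral_dominated_convergence[where w="\<lambda>y. C * \<bar>q y\<bar>"])
      show "integrable N (\<lambda>y. C * \<bar>q y\<bar>)" using q by auto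
      show "AE y in N. norm ((\<phi> y (X n) - \<phi> y t) / (X n - t) * q y) \<le> C * \<bar>q y\<bar>" for n
      proof (intro AE_I2)
        fix y
        have "\<bar>\<phi> y (X n) - \<phi> y t\<bar> / \<bar>X n - t\<bar> * \<bar>q y\<bar> \<le> C * \<bar>q y\<bar>"
          using lip[of y "X n" t] X by (intro mult_right_mono) (auto simp: divide_le_eq)
        then show "norm ((\<phi> y (X n) - \<phi> y t) / (X n - t) * q y) \<le> C * \<bar>q y\<bar>"
          by (simp add: abs_mult)
      qed
      show "AE y in N. (\<lambda>n. (\<phi> y (X n) - \<phi> y t) / (X n - t) * q y) \<longlonglongrightarrow> \<phi>' y t * q y"
      proof (intro AE_I2 tendsto_mult tendsto_const)
        fix y show "(\<lambda>n. (\<phi> y (X n) - \<phi> y t) / (X n - t)) \<longlonglongrightarrow> \<phi>' y t"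
          using d[of y t] X lim unfolding has_field_derivative_iff tendsto_at_iff_sequentially comp_def by auto
      qed
    qed measurable
    moreover have dq: "(\<lambda>n. \<integral>y. (\<phi> y (X n) - \<phi> y t) / (X n - t) * q y \<partial>N) =
        (\<lambda>n. ((\<integral>y. \<phi> y (X n) * q y \<partial>N) - (\<integral>y. \<phi> y t * q y \<partial>N)) / (X n - t))"
      using int by (simp add: left_diff_distrib diff_divide_distrib)
    ultimately show "(\<lambda>n. ((\<integral>y. \<phi> y (X n) * q y \<partial>N) - (\<integral>y. \<phi> y t * q y \<partial>N)) / (X n - t)) \<longlonglongrightarrow>
        (\<integral>y. \<phi>' y t * q y \<partial>N)" by (simp only: dq)
  qed
  moreover have "(\<integral>y. \<phi>' y t * q y \<partial>N) = - (w \<bullet> noise_moment N q s (t *\<^sub>R w)) / (1 - s)"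
  proof -
    have "w \<bullet> noise_moment N q s (t *\<^sub>R w) =
        (\<integral>y. w \<bullet> ((gauss (noise s (t *\<^sub>R w) y) * q y) *\<^sub>R noise s (t *\<^sub>R w) y) \<partial>N)"
      unfolding noise_moment_def by (rule integral_inner_right[symmetric]) (rule integrable_noise_moment)
    then have "- (w \<bullet> noise_moment N q s (t *\<^sub>R w)) / (1 - s) =
        (\<integral>y. - (w \<bullet> ((gauss (noise s (t *\<^sub>R w) y) * q y) *\<^sub>R noise s (t *\<^sub>R w) y)) / (1 - s) \<partial>N)"
      by simp
    also have "\<dots> = (\<integral>y. \<phi>' y t * q y \<partial>N)"
      by (intro Bochner_Integration.integral_cong) (auto simp: \<phi>'_def)
    finally show ?thesis by simp
  qed
  ultimately show ?thesis by (simp add: evidence_def \<phi>_def)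
qed

end

end

section \<open>The optimal field determines the noised density up to a factor\<close>

lemma noise_interp: "s \<noteq> 1 \<Longrightarrow> noise s (interp s u y) y = u"
  by (simp add: noise_def interp_def)

lemma borel_measurable_interp [measurable (raw)]:
  assumes [measurable]: "s \<in> borel_measurable M" "w \<in> borel_measurable M" "y \<in> borel_measurable M"
  shows "(\<lambda>x. interp (s x) (w x) (y x)) \<in> borel_measurable M"
  unfolding interp_def by measurable

text \<open>The change of variables \<open>w = interp s u y\<close> from the noise to the noised point, for a fixed endpoint.\<close>

lemma noise_substitution:
  fixes y :: "real^'n"
  assumes s: "s < 1" and [measurable]: "g \<in> borel_measurable borel"
  shows "(\<integral>\<^sup>+w. ennreal (gauss (noise s w y)) * g w \<partial>lborel) =
    ennreal ((1 - s) ^ CARD('n)) * (\<integral>\<^sup>+u. ennreal (gauss u) * g (interp s u y) \<partial>lborel)"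
proof -
  have aff: "s *\<^sub>R y + (1 - s) *\<^sub>R u = interp s u y" for u
    by (simp add: interp_def)
  have "lborel = density (distr lborel borel (\<lambda>u. interp s u y)) (\<lambda>_. ennreal (\<bar>1 - s\<bar> ^ DIM(real^'n)))"
    using lborel_affine[of "1 - s" "s *\<^sub>R y"] s unfolding aff by simp
  then have "(\<integral>\<^sup>+w. ennreal (gauss (noise s w y)) * g w \<partial>lborel) =
      (\<integral>\<^sup>+w. ennreal (gauss (noise s w y)) * g w \<partial>density (distr lborel borel (\<lambda>u. interp s u y)) (\<lambda>_. ennreal (\<bar>1 - s\<bar> ^ DIM(real^'n))))"
    by simp
  also have "\<dots> = (\<integral>\<^sup>+u. ennreal ((1 - s) ^ CARD('n)) * (ennreal (gauss u) * g (interp s u y)) \<partial>lborel)"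
    using s by (simp add: nn_integral_density nn_integral_distr noise_interp)
  also have "\<dots> = ennreal ((1 - s) ^ CARD('n)) * (\<integral>\<^sup>+u. ennreal (gauss u) * g (interp s u y) \<partial>lborel)"
    by (rule nn_integral_cmult) measurable
  finally show ?thesis .
qed

text \<open>Nonempty open sets have positive measure.\<close>

lemma AE_lborel_continuous_eq:
  fixes f g :: "real^'n \<Rightarrow> 'b::metric_space"
  assumes "continuous_on UNIV f" "continuous_on UNIV g" "AE x in lborel. f x = g x"
  shows "f x = g x"
proof (rule ccontr)
  assume "f x \<noteq> g x"
  have "open {x. f x \<noteq> g x}"
    using assms(1,2) by (rule open_Collect_neq)
  moreover have "negligible {x. f x \<noteq> g x}"
    using AE_completion[OF assms(3)] negligible_subset
    by (auto simp: eventually_ae_filter negligible_iff_null_sets[symmetric])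
  ultimately show False
    using open_not_negligible \<open>f x \<noteq> g x\<close> by blast
qed

text \<open>The base of the powers is continuous in \<open>y\<close>, equal to \<open>1\<close> on \<open>C\<close> and smaller elsewhere.\<close>

lemma closed_indicator_limit:
  fixes C :: "'a::metric_space set"
  assumes "closed C" "C \<noteq> {}"
  shows "(\<lambda>k. (1 / (1 + infdist y C)) ^ k) \<longlonglongrightarrow> indicator C y"
proof (cases "y \<in> C")
  case False
  then have "infdist y C > 0"
    using assms in_closed_iff_infdist_zero infdist_nonneg by (metis order_le_less)
  then have "(\<lambda>k. (1 / (1 + infdist y C)) ^ k) \<longlonglongrightarrow> 0"
    by (intro LIMSEQ_realpow_zero) auto
  with False show ?thesis by simp
qed simp

context observation
begin

lemma measurable_point: "f \<in> measurable M N \<Longrightarrow> f \<in> borel_measurable M"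
  using measurable_compose[OF _ point] .

lemma evidence_nonneg: "(\<And>y. 0 \<le> q y) \<Longrightarrow> 0 \<le> evidence N q s w"
  by (simp add: evidence_def)

lemma evidence_pos:
  assumes q: "integrable N q" "\<And>y. 0 \<le> q y" and pos: "0 < integral\<^sup>L N q"
  shows "0 < evidence N q s w"
proof (rule ccontr)
  assume "\<not> 0 < evidence N q s w"
  then have "evidence N q s w = 0"
    using evidence_nonneg[of q s w] q(2) by simp
  then have "AE y in N. gauss (noise s w y) * q y = 0"
    unfolding evidence_def using integral_nonneg_eq_0_iff_AE[OF integrable_evidence[OF q(1)], of s w] q(2) by simp
  then have "AE y in N. q y = 0"
    by eventually_elim (simp add: less_imp_neq[OF gauss_pos, symmetric])
  then have "integral\<^sup>L N q = 0"
    using integral_eq_zero_AE by blast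
  with pos show False by simp
qed

lemma nn_integral_evidence:
  assumes q: "integrable N q" "\<And>y. 0 \<le> q y" and s: "s < 1" and [measurable]: "h \<in> borel_measurable borel"
  shows "(\<integral>\<^sup>+w. ennreal (evidence N q s w) * h w \<partial>lborel) =
    ennreal ((1 - s) ^ CARD('n)) * (\<integral>\<^sup>+y. ennreal (q y) * (\<integral>\<^sup>+u. ennreal (gauss u) * h (interp s u y) \<partial>lborel) \<partial>N)"
proof -
  interpret pair_sigma_finite N lborel ..
  have [measurable]: "q \<in> borel_measurable N" using q by simp
  have "(\<lambda>y. \<integral>\<^sup>+u. ennreal (gauss u) * h (interp s u y) \<partial>lborel) \<in> borel_measurable borel"
    by measurable
  from measurable_compose[OF point this]
  have [measurable]: "(\<lambda>y. \<integral>\<^sup>+u. ennreal (gauss u) * h (interp s u y) \<partial>lborel) \<in> borel_measurable N" .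
  have "(\<integral>\<^sup>+w. ennreal (evidence N q s w) * h w \<partial>lborel) =
      (\<integral>\<^sup>+w. (\<integral>\<^sup>+y. ennreal (gauss (noise s w y)) * ennreal (q y) * h w \<partial>N) \<partial>lborel)"
  proof (rule nn_integral_cong)
    fix w
    have [measurable]: "(\<lambda>y. gauss (noise s w y)) \<in> borel_measurable N"
      supply point [measurable] by measurable
    have "ennreal (evidence N q s w) = (\<integral>\<^sup>+y. ennreal (gauss (noise s w y) * q y) \<partial>N)"
      unfolding evidence_def using q integrable_evidence[OF q(1)] by (intro nn_integral_eq_integral[symmetric]) auto
    then show "ennreal (evidence N q s w) * h w = (\<integral>\<^sup>+y. ennreal (gauss (noise s w y)) * ennreal (q y) * h w \<partial>N)"
      by (simp add: nn_integral_multc ennreal_mult q(2))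
  qed
  also have "\<dots> = (\<integral>\<^sup>+y. (\<integral>\<^sup>+w. ennreal (gauss (noise s w y)) * ennreal (q y) * h w \<partial>lborel) \<partial>N)"
  proof (rule Fubini')
    have [measurable]: "fst \<in> borel_measurable (N \<Otimes>\<^sub>M (lborel :: (real^'n) measure))"
      by (rule measurable_point) measurable
    show "(\<lambda>(y, w). ennreal (gauss (noise s w y)) * ennreal (q y) * h w) \<in> borel_measurable (N \<Otimes>\<^sub>M lborel)"
      by measurable
  qed
  also have "\<dots> = (\<integral>\<^sup>+y. ennreal ((1 - s) ^ CARD('n)) * (ennreal (q y) * (\<integral>\<^sup>+u. ennreal (gauss u) * h (interp s u y) \<partial>lborel)) \<partial>N)"
  proof (rule nn_integral_cong)
    fix y
    have "(\<integral>\<^sup>+w. ennreal (gauss (noise s w y)) * ennreal (q y) * h w \<partial>lborel) =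
        (\<integral>\<^sup>+w. ennreal (q y) * (ennreal (gauss (noise s w y)) * h w) \<partial>lborel)"
      by (simp add: mult_ac)
    also have "\<dots> = ennreal (q y) * (\<integral>\<^sup>+w. (ennreal (gauss (noise s w y)) * h w) \<partial>lborel)"
      by (rule nn_integral_cmult) measurable
    finally show "(\<integral>\<^sup>+w. ennreal (gauss (noise s w y)) * ennreal (q y) * h w \<partial>lborel) =
      ennreal ((1 - s) ^ CARD('n)) * (ennreal (q y) * (\<integral>\<^sup>+u. ennreal (gauss u) * h (interp s u y) \<partial>lborel))"
      unfolding noise_substitution[OF s assms(4)] by (simp only: mult.left_commute)
  qed
  also have "\<dots> = ennreal ((1 - s) ^ CARD('n)) * (\<integral>\<^sup>+y. ennreal (q y) * (\<integral>\<^sup>+u. ennreal (gauss u) * h (interp s u y) \<partial>lborel) \<partial>N)"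
    by (rule nn_integral_cmult) measurable
  finally show ?thesis .
qed

text \<open>By the formula for the gradient of the evidence, equal optimal fields have equal gradients of the
  logarithm of the evidence, first almost everywhere and then by continuity everywhere.  So the quotient of
  the evidences is constant.\<close>

lemma evidence_proportional:
  assumes q1: "integrable N q1" "\<And>y. 0 \<le> q1 y" "0 < integral\<^sup>L N q1"
    and q2: "integrable N q2" "\<And>y. 0 \<le> q2 y" "0 < integral\<^sup>L N q2"
    and s: "0 < s" "s < 1"
    and eq: "AE w in lborel. opt_velocity N q1 s w = opt_velocity N q2 s w"
  shows "evidence N q1 s w * evidence N q2 s 0 = evidence N q1 s 0 * evidence N q2 s w"
proof -
  let ?F1 = "evidence N q1 s" and ?F2 = "evidence N q2 s"
  let ?m1 = "noise_moment N q1 s" and ?m2 = "noise_moment N q2 s"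
  have pos: "0 < ?F1 w" "0 < ?F2 w" for w
    using evidence_pos q1 q2 by auto
  have "(1 / ?F1 w) *\<^sub>R ?m1 w = (1 / ?F2 w) *\<^sub>R ?m2 w" for w
  proof (rule AE_lborel_continuous_eq[where f="\<lambda>w. (1 / ?F1 w) *\<^sub>R ?m1 w" and g="\<lambda>w. (1 / ?F2 w) *\<^sub>R ?m2 w"])
    show "continuous_on UNIV (\<lambda>w. (1 / ?F1 w) *\<^sub>R ?m1 w)"
      using pos by (intro continuous_intros continuous_evidence continuous_noise_moment q1) (auto simp: less_imp_neq[symmetric])
    show "continuous_on UNIV (\<lambda>w. (1 / ?F2 w) *\<^sub>R ?m2 w)"
      using pos by (intro continuous_intros continuous_evidence continuous_noise_moment q2) (auto simp: less_imp_neq[symmetric])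
    show "AE w in lborel. (1 / ?F1 w) *\<^sub>R ?m1 w = (1 / ?F2 w) *\<^sub>R ?m2 w"
      using eq by eventually_elim (use s in \<open>simp add: opt_velocity_def\<close>)
  qed
  then have *: "(?F1 w) *\<^sub>R ((1 / ?F1 w) *\<^sub>R ?m1 w) = (?F1 w) *\<^sub>R ((1 / ?F2 w) *\<^sub>R ?m2 w)" for w
    by simp
  then have m: "?m1 w = (?F1 w / ?F2 w) *\<^sub>R ?m2 w" for w
    using *[of w] pos(1)[of w] by simp
  \<comment> \<open>The quotient of the evidences on the line from the origin to \<open>w\<close>.\<close>
  define R where "R t = ?F1 (t *\<^sub>R w) / ?F2 (t *\<^sub>R w)" for t
  have cross: "(w \<bullet> ?m1 (t *\<^sub>R w)) * ?F2 (t *\<^sub>R w) = ?F1 (t *\<^sub>R w) * (w \<bullet> ?m2 (t *\<^sub>R w))" for t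
    using pos(2)[of "t *\<^sub>R w"] by (simp add: m[of "t *\<^sub>R w"])
  have "(R has_real_derivative 0) (at t)" for t
    unfolding R_def
    by (rule DERIV_cong[OF DERIV_divide[OF evidence_line_derivative[OF q1(1)] evidence_line_derivative[OF q2(1)]]])
      (use pos(2)[of "t *\<^sub>R w"] in \<open>simp_all add: cross\<close>)
  then have "R 1 = R 0"
    using DERIV_isconst_all by blast
  then show ?thesis
    using pos(2)[of w] pos(2)[of 0] by (simp add: R_def field_simps)
qed

text \<open>The evidences are proportional, and the factor is found from the test function \<open>1\<close>: it is the ratio
  of the total masses, so it is the same for every \<open>s\<close>.\<close>

lemma smoothed_density_proportional:
  assumes q1: "integrable N q1" "\<And>y. 0 \<le> q1 y" "0 < integral\<^sup>L N q1"
    and q2: "integrable N q2" "\<And>y. 0 \<le> q2 y" "0 < integral\<^sup>L N q2"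
    and s: "0 < s" "s < 1"
    and eq: "AE w in lborel. opt_velocity N q1 s w = opt_velocity N q2 s w"
    and [measurable]: "h \<in> borel_measurable borel"
  shows "ennreal (integral\<^sup>L N q2) * (\<integral>\<^sup>+y. ennreal (q1 y) * (\<integral>\<^sup>+u. ennreal (gauss u) * h (interp s u y) \<partial>lborel) \<partial>N) =
    ennreal (integral\<^sup>L N q1) * (\<integral>\<^sup>+y. ennreal (q2 y) * (\<integral>\<^sup>+u. ennreal (gauss u) * h (interp s u y) \<partial>lborel) \<partial>N)"
proof -
  \<comment> \<open>The factor of proportionality, as it comes out of the previous lemma, is \<open>F1 / F2\<close>.\<close>
  define F1 where "F1 = evidence N q1 s 0"
  define F2 where "F2 = evidence N q2 s 0"
  define k where "k = ennreal ((1 - s) ^ CARD('n))"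
  define G where "G q h = (\<integral>\<^sup>+y. ennreal (q y) * (\<integral>\<^sup>+u. ennreal (gauss u) * h (interp s u y) \<partial>lborel) \<partial>N)"
    for q and h :: "real^'n \<Rightarrow> ennreal"
  have F: "0 < F1" "0 < F2"
    unfolding F1_def F2_def using evidence_pos q1 q2 by auto
  have k: "k \<noteq> 0" "k \<noteq> \<top>"
    using s by (auto simp: k_def)
  have cross: "ennreal F2 * G q1 h = ennreal F1 * G q2 h" if [measurable]: "h \<in> borel_measurable borel" for h
  proof -
    have [measurable]: "evidence N q1 s \<in> borel_measurable borel" "evidence N q2 s \<in> borel_measurable borel"
      by (intro borel_measurable_continuous_onI continuous_evidence q1 q2)+
    have "ennreal F2 * (k * G q1 h) = (\<integral>\<^sup>+w. ennreal F2 * (ennreal (evidence N q1 s w) * h w) \<partial>lborel)"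
      unfolding G_def k_def using nn_integral_evidence[OF q1(1,2) s(2) that]
      by (subst nn_integral_cmult) auto
    also have "\<dots> = (\<integral>\<^sup>+w. ennreal F1 * (ennreal (evidence N q2 s w) * h w) \<partial>lborel)"
    proof (rule nn_integral_cong)
      fix w
      have "F2 * evidence N q1 s w = F1 * evidence N q2 s w"
        using evidence_proportional[OF q1 q2 s eq, of w] by (simp add: F1_def F2_def mult_ac)
      then have "ennreal F2 * ennreal (evidence N q1 s w) = ennreal F1 * ennreal (evidence N q2 s w)"
        using F by (simp add: ennreal_mult[symmetric] evidence_nonneg q1 q2)
      then show "ennreal F2 * (ennreal (evidence N q1 s w) * h w) = ennreal F1 * (ennreal (evidence N q2 s w) * h w)"
        by (simp add: mult.assoc[symmetric])
    qed
    also have "\<dots> = ennreal F1 * (k * G q2 h)"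
      unfolding G_def k_def using nn_integral_evidence[OF q2(1,2) s(2) that]
      by (subst nn_integral_cmult) auto
    finally have "k * (ennreal F2 * G q1 h) = k * (ennreal F1 * G q2 h)"
      by (simp add: mult_ac)
    then show ?thesis
      using k by (simp add: ennreal_mult_cancel_left)
  qed
  have G1: "G q (\<lambda>_. 1) = ennreal (integral\<^sup>L N q)" if "integrable N q" "\<And>y. 0 \<le> q y" for q
    unfolding G_def using that by (simp add: nn_integral_gauss nn_integral_eq_integral)
  have "ennreal F2 * ennreal (integral\<^sup>L N q1) = ennreal F1 * ennreal (integral\<^sup>L N q2)"
    using cross[of "\<lambda>_. 1"] by (simp add: G1 q1 q2)
  then have I: "ennreal (integral\<^sup>L N q2) * ennreal F1 = ennreal F2 * ennreal (integral\<^sup>L N q1)"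
    by (simp only: mult.commute)
  have "ennreal F2 * (ennreal (integral\<^sup>L N q2) * G q1 h) = ennreal (integral\<^sup>L N q2) * (ennreal F2 * G q1 h)"
    by (rule mult.left_commute)
  also have "\<dots> = (ennreal (integral\<^sup>L N q2) * ennreal F1) * G q2 h"
    by (subst cross) (simp_all only: assms mult.assoc)
  also have "\<dots> = ennreal F2 * (ennreal (integral\<^sup>L N q1) * G q2 h)"
    by (simp only: I mult.assoc)
  finally have "ennreal F2 * (ennreal (integral\<^sup>L N q2) * G q1 h) = ennreal F2 * (ennreal (integral\<^sup>L N q1) * G q2 h)" .
  then show ?thesis
    using F unfolding G_def by (simp add: ennreal_mult_cancel_left)
qed

end

section \<open>Removing the noise\<close>

lemma closed_eq_finite_borel_measures:
  fixes M1 M2 :: "('a::metric_space) measure"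
  assumes sets [measurable_cong]: "sets M1 = sets borel" "sets M2 = sets borel" and fin: "emeasure M1 UNIV \<noteq> \<infinity>"
    and eq: "\<And>C. closed C \<Longrightarrow> emeasure M1 C = emeasure M2 C"
  shows "M1 = M2"
proof (rule measure_eqI_generator_eq[where E="Collect closed" and \<Omega>=UNIV and A="\<lambda>_. UNIV"])
  show "Int_stable (Collect closed :: 'a set set)"
    by (auto simp: Int_stable_def)
  show "sets M1 = sigma_sets UNIV (Collect closed)" "sets M2 = sigma_sets UNIV (Collect closed)"
    using sets by (simp_all add: borel_eq_closed)
qed (use fin eq in auto)

text \<open>Used to choose good noise levels arbitrarily close to \<open>1\<close>.\<close>

lemma AE_unit_interval_witness:
  assumes "AE s in lborel. 0 < s \<and> s < 1 \<longrightarrow> P s" and "0 \<le> a" "a < (1::real)"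
  shows "\<exists>s. a < s \<and> s < 1 \<and> P s"
proof (rule ccontr)
  assume no: "\<not> ?thesis"
  from assms(1) have "AE s in lborel. s \<notin> {a<..<1}"
    by (rule eventually_mono) (use no assms(2) in force)
  then have "emeasure lborel {a<..<1} = 0"
    by (subst (asm) AE_iff_measurable[where N="{a<..<1}"]) auto
  then show False
    using assms by simp
qed

context observation
begin

text \<open>As the noise level tends to \<open>1\<close> the noised point tends to the endpoint; two applications of
  dominated convergence.\<close>

lemma smoothed_limit:
  assumes q: "integrable N q" "\<And>y. 0 \<le> q y"
    and h: "continuous_on UNIV h" "\<And>y. 0 \<le> h y" "\<And>y. h y \<le> (1::real)" and S: "S \<longlonglongrightarrow> 1"
  shows "(\<lambda>k. \<integral>\<^sup>+y. ennreal (q y) * (\<integral>\<^sup>+u. ennreal (gauss u) * ennreal (h (interp (S k) u y)) \<partial>lborel) \<partial>N)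
    \<longlonglongrightarrow> (\<integral>\<^sup>+y. ennreal (q y) * ennreal (h y) \<partial>N)"
proof -
  have [measurable]: "q \<in> borel_measurable N" using q by simp
  have hb [measurable]: "h \<in> borel_measurable borel" using h(1) by (rule borel_measurable_continuous_onI)
  have inner: "(\<lambda>k. \<integral>\<^sup>+u. ennreal (gauss u) * ennreal (h (interp (S k) u y)) \<partial>lborel) \<longlonglongrightarrow> ennreal (h y)" for y
  proof -
    have "(\<lambda>k. \<integral>\<^sup>+u. ennreal (gauss u) * ennreal (h (interp (S k) u y)) \<partial>lborel)
        \<longlonglongrightarrow> (\<integral>\<^sup>+(u::real^'n). ennreal (gauss u) * ennreal (h y) \<partial>lborel)"
    proof (rule nn_integral_dominated_convergence[where w="\<lambda>u::real^'n. ennreal (gauss u)"])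
      show "AE u in lborel. ennreal (gauss u) * ennreal (h (interp (S k) u y)) \<le> ennreal (gauss u)" for k
        using h by (auto simp: ennreal_mult[symmetric] mult_left_le intro!: ennreal_leI)
      show "(\<integral>\<^sup>+u. ennreal (gauss (u::real^'n)) \<partial>lborel) < \<infinity>"
        by (simp add: nn_integral_gauss)
      show "AE u in lborel. (\<lambda>k. ennreal (gauss u) * ennreal (h (interp (S k) u y))) \<longlonglongrightarrow> ennreal (gauss u) * ennreal (h y)"
      proof (rule AE_I2)
        fix u
        have "(\<lambda>k. (1 - S k) *\<^sub>R u + S k *\<^sub>R y) \<longlonglongrightarrow> (1 - 1) *\<^sub>R u + 1 *\<^sub>R y"
          by (intro tendsto_intros S)
        then have "(\<lambda>k. interp (S k) u y) \<longlonglongrightarrow> y"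
          by (simp add: interp_def)
        then have "(\<lambda>k. h (interp (S k) u y)) \<longlonglongrightarrow> h y"
          by (rule continuous_on_tendsto_compose[OF h(1)]) auto
        then have "(\<lambda>k. ennreal (gauss u * h (interp (S k) u y))) \<longlonglongrightarrow> ennreal (gauss u * h y)"
          by (intro tendsto_ennrealI tendsto_intros)
        then show "(\<lambda>k. ennreal (gauss u) * ennreal (h (interp (S k) u y))) \<longlonglongrightarrow> ennreal (gauss u) * ennreal (h y)"
          by (simp add: ennreal_mult h(2))
      qed
    qed measurable
    then show ?thesis
      by (simp add: nn_integral_multc nn_integral_gauss)
  qed
  have le1: "(\<integral>\<^sup>+u. ennreal (gauss u) * ennreal (h (interp (S k) u y)) \<partial>lborel) \<le> 1" for k y
  proof -
    have "(\<integral>\<^sup>+u. ennreal (gauss u) * ennreal (h (interp (S k) u y)) \<partial>lborel) \<le> (\<integral>\<^sup>+u. ennreal (gauss (u::real^'n)) \<partial>lborel)"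
      using h by (intro nn_integral_mono) (auto simp: ennreal_mult[symmetric] mult_left_le intro!: ennreal_leI)
    then show ?thesis by (simp add: nn_integral_gauss)
  qed
  have [measurable]: "(\<lambda>y. \<integral>\<^sup>+u. ennreal (gauss u) * ennreal (h (interp (S k) u y)) \<partial>lborel) \<in> borel_measurable N" for k
  proof -
    have "(\<lambda>y. \<integral>\<^sup>+u. ennreal (gauss u) * ennreal (h (interp (S k) u y)) \<partial>lborel) \<in> borel_measurable borel"
      by measurable
    then show ?thesis by (rule measurable_compose[OF point])
  qed
  have [measurable]: "h \<in> borel_measurable N"
    using measurable_compose[OF point hb] .
  show ?thesis
  proof (rule nn_integral_dominated_convergence[where w="\<lambda>y. ennreal (q y)"])
    show "AE y in N. ennreal (q y) * (\<integral>\<^sup>+u. ennreal (gauss u) * ennreal (h (interp (S k) u y)) \<partial>lborel) \<le> ennreal (q y)" for k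
      using mult_left_mono[OF le1, of "ennreal (q _)"] by auto
    show "(\<integral>\<^sup>+y. ennreal (q y) \<partial>N) < \<infinity>"
      using q by (simp add: nn_integral_eq_integral)
    show "AE y in N. (\<lambda>k. ennreal (q y) * (\<integral>\<^sup>+u. ennreal (gauss u) * ennreal (h (interp (S k) u y)) \<partial>lborel)) \<longlonglongrightarrow>
        ennreal (q y) * ennreal (h y)"
      by (rule AE_I2, rule tendsto_mult_ennreal[OF tendsto_const inner]) (auto simp: q)
  qed measurable
qed

text \<open>Continuous tests give equality on closed sets, hence on Borel sets, hence by \<open>borel_up_to_null\<close> on
  all measurable sets.\<close>

lemma densities_eq_of_continuous_tests:
  assumes f: "integrable N f" "\<And>y. 0 \<le> f y" and g: "integrable N g" "\<And>y. 0 \<le> g y"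
    and eq: "\<And>h. continuous_on UNIV h \<Longrightarrow> (\<And>y. 0 \<le> h y) \<Longrightarrow> (\<And>y. h y \<le> 1) \<Longrightarrow>
      (\<integral>\<^sup>+y. ennreal (f y) * ennreal (h y) \<partial>N) = (\<integral>\<^sup>+y. ennreal (g y) * ennreal (h y) \<partial>N)"
  shows "AE y in N. f y = g y"
proof -
  have [measurable]: "f \<in> borel_measurable N" "g \<in> borel_measurable N" using f g by auto
  define D where "D f = distr (density N (\<lambda>y. ennreal (f y))) borel (\<lambda>y. y)" for f
  have point': "(\<lambda>y. y) \<in> measurable (density N F) borel" for F
    using point by simp
  have D: "emeasure (D f) B = (\<integral>\<^sup>+y. ennreal (f y) * indicator B y \<partial>N)"
    if [measurable]: "f \<in> borel_measurable N" "B \<in> sets borel" for f B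
  proof -
    have "emeasure (D f) B = emeasure (density N (\<lambda>y. ennreal (f y))) (B \<inter> space N)"
      unfolding D_def using point' by (subst emeasure_distr) auto
    also have "\<dots> = (\<integral>\<^sup>+y. ennreal (f y) * indicator (B \<inter> space N) y \<partial>N)"
      using measurable_sets[OF point that(2)] by (subst emeasure_density) auto
    also have "\<dots> = (\<integral>\<^sup>+y. ennreal (f y) * indicator B y \<partial>N)"
      by (intro nn_integral_cong) (auto simp: indicator_def)
    finally show ?thesis .
  qed
  have closed: "emeasure (D f) C = emeasure (D g) C" if "closed C" for C
  proof (cases "C = {}")
    case False
    have lim: "(\<lambda>k. \<integral>\<^sup>+y. ennreal (f y) * ennreal ((1 / (1 + infdist y C)) ^ k) \<partial>N) \<longlonglongrightarrow> emeasure (D f) C"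
      if f: "integrable N f" "\<And>y. 0 \<le> f y" for f
    proof -
      have [measurable]: "f \<in> borel_measurable N" using f by simp
      have [measurable]: "(\<lambda>y. infdist y C) \<in> borel_measurable N"
        by (rule borel_measurable_continuous_on[OF _ point]) (intro continuous_intros)
      have ind [measurable]: "(\<lambda>y. indicator C y :: ennreal) \<in> borel_measurable N"
        by (rule measurable_compose[OF point borel_measurable_indicator]) (use \<open>closed C\<close> in auto)
      have "(\<lambda>k. \<integral>\<^sup>+y. ennreal (f y) * ennreal ((1 / (1 + infdist y C)) ^ k) \<partial>N) \<longlonglongrightarrow>
          (\<integral>\<^sup>+y. ennreal (f y) * indicator C y \<partial>N)"
      proof (rule nn_integral_dominated_convergence[where w="\<lambda>y. ennreal (f y)"])
        show "AE y in N. ennreal (f y) * ennreal ((1 / (1 + infdist y C)) ^ k) \<le> ennreal (f y)" for k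
        proof (intro AE_I2)
          fix y
          have "(1 / (1 + infdist y C)) ^ k \<le> 1"
            using infdist_nonneg[of y C] by (intro power_le_one) auto
          then have "f y * (1 / (1 + infdist y C)) ^ k \<le> f y"
            using f(2) by (intro mult_left_le) auto
          then show "ennreal (f y) * ennreal ((1 / (1 + infdist y C)) ^ k) \<le> ennreal (f y)"
            using f(2) infdist_nonneg[of y C] by (subst ennreal_mult[symmetric]) (auto intro!: ennreal_leI)
        qed
        show "(\<integral>\<^sup>+y. ennreal (f y) \<partial>N) < \<infinity>"
          using f by (simp add: nn_integral_eq_integral)
        show "AE y in N. (\<lambda>k. ennreal (f y) * ennreal ((1 / (1 + infdist y C)) ^ k)) \<longlonglongrightarrow> ennreal (f y) * indicator C y"
        proof (rule AE_I2, rule tendsto_mult_ennreal[OF tendsto_const])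
          fix y
          show "(\<lambda>k. ennreal ((1 / (1 + infdist y C)) ^ k)) \<longlonglongrightarrow> indicator C y"
            using tendsto_ennrealI[OF closed_indicator_limit[OF \<open>closed C\<close> False, of y]] by (simp add: ennreal_indicator)
        qed (auto simp: indicator_def)
      qed measurable
      then show ?thesis using \<open>closed C\<close> by (simp add: D)
    qed
    have le1: "1 / (1 + infdist y C) \<le> 1" for y
      using infdist_nonneg[of y C] by simp
    have "(\<integral>\<^sup>+y. ennreal (f y) * ennreal ((1 / (1 + infdist y C)) ^ k) \<partial>N) =
        (\<integral>\<^sup>+y. ennreal (g y) * ennreal ((1 / (1 + infdist y C)) ^ k) \<partial>N)" for k
    proof (rule eq)
      show "continuous_on UNIV (\<lambda>y. (1 / (1 + infdist y C)) ^ k)"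
        by (intro continuous_intros) (auto simp: add_nonneg_eq_0_iff infdist_nonneg)
    qed (auto intro!: power_le_one le1 simp: infdist_nonneg)
    then show ?thesis
      using LIMSEQ_unique[OF lim[OF f] ] lim[OF g] by simp
  qed (simp add: D)
  have "D f = D g"
  proof (rule closed_eq_finite_borel_measures)
    have "emeasure (D f) UNIV = (\<integral>\<^sup>+y. ennreal (f y) \<partial>N)"
      by (subst D) auto
    also have "\<dots> = ennreal (integral\<^sup>L N f)"
      using f by (intro nn_integral_eq_integral) auto
    finally show "emeasure (D f) UNIV \<noteq> \<infinity>" by simp
  qed (use closed in \<open>auto simp: D_def\<close>)
  have "density N f = density N g"
  proof (rule measure_eqI)
    fix A assume "A \<in> sets (density N f)"
    then have A [measurable]: "A \<in> sets N" by simp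
    then obtain B where B: "B \<in> sets borel" "AE y in N. y \<in> A \<longleftrightarrow> y \<in> B"
      using borel_up_to_null by blast
    have "emeasure (density N F) A = emeasure (D F) B" if [measurable]: "F \<in> borel_measurable N" for F
      unfolding D[OF that B(1)] using B(2)
      by (subst emeasure_density) (auto intro!: nn_integral_cong_AE elim!: eventually_mono simp: indicator_def)
    then show "emeasure (density N f) A = emeasure (density N g) A"
      using \<open>D f = D g\<close> by simp
  qed simp
  then have "AE y in N. ennreal (f y) = ennreal (g y)"
    by (intro density_unique) auto
  then show ?thesis
    by eventually_elim (simp add: f g)
qed

text \<open>The uniqueness statement behind the theorem.  The total masses appear as factors, so that the case of
  a vanishing density is covered as well.  Where the evidence vanishes \<open>opt_velocity\<close> is a default value,
  which is why the hypothesis is restricted to the other points.\<close>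

theorem densities_proportional_of_opt_velocity_eq:
  assumes q1: "integrable N q1" "\<And>y. 0 \<le> q1 y" and q2: "integrable N q2" "\<And>y. 0 \<le> q2 y"
    and eq: "AE s in lborel. 0 < s \<and> s < 1 \<longrightarrow>
      (AE w in lborel. evidence N q1 s w \<noteq> 0 \<longrightarrow> opt_velocity N q1 s w = opt_velocity N q2 s w)"
  shows "AE y in N. integral\<^sup>L N q2 * q1 y = integral\<^sup>L N q1 * q2 y"
proof (cases "integral\<^sup>L N q1 = 0 \<or> integral\<^sup>L N q2 = 0")
  case True
  have zero: "AE y in N. q y = 0" if "integrable N q" "\<And>y. 0 \<le> q y" "integral\<^sup>L N q = 0" for q :: "real^'n \<Rightarrow> real"
    using integral_nonneg_eq_0_iff_AE[of N q] that by auto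
  from True show ?thesis
  proof
    assume "integral\<^sup>L N q1 = 0"
    with zero[OF q1] show ?thesis by (auto elim!: eventually_mono)
  next
    assume "integral\<^sup>L N q2 = 0"
    with zero[OF q2] show ?thesis by (auto elim!: eventually_mono)
  qed
next
  case False
  then have pos: "0 < integral\<^sup>L N q1" "0 < integral\<^sup>L N q2"
    using q1(2) q2(2) by (auto simp: order_less_le)
  define good where "good s \<longleftrightarrow> (AE w in lborel. opt_velocity N q1 s w = opt_velocity N q2 s w)" for s
  have "AE s in lborel. 0 < s \<and> s < 1 \<longrightarrow> good s"
    using eq unfolding good_def
    by eventually_elim (use evidence_pos[OF q1 pos(1)] in \<open>auto elim!: eventually_mono simp: less_imp_neq[symmetric]\<close>)
  \<comment> \<open>Almost every noise level is good, so there are good ones that converge to \<open>1\<close>.\<close>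
  then have "\<exists>s. 1 - 1 / (real k + 2) < s \<and> s < 1 \<and> good s" for k
    by (rule AE_unit_interval_witness) (auto simp: field_simps)
  then obtain S where S: "\<And>k. 1 - 1 / (real k + 2) < S k" "\<And>k. S k < 1" "\<And>k. good (S k)"
    by metis
  have S0: "0 < S k" for k
    using S(1)[of k] by (rule le_less_trans[rotated]) (simp add: field_simps)
  have "S \<longlonglongrightarrow> 1"
  proof (rule tendsto_sandwich)
    show "(\<lambda>k. 1 - 1 / (real k + 2)) \<longlonglongrightarrow> 1" by real_asymp
    show "(\<lambda>k. 1::real) \<longlonglongrightarrow> 1" by simp
  qed (use S in \<open>auto intro!: always_eventually less_imp_le\<close>)
  show ?thesis
  proof (rule densities_eq_of_continuous_tests)
    show "integrable N (\<lambda>y. integral\<^sup>L N q2 * q1 y)" "integrable N (\<lambda>y. integral\<^sup>L N q1 * q2 y)"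
      using q1 q2 by auto
    show "0 \<le> integral\<^sup>L N q2 * q1 y" "0 \<le> integral\<^sup>L N q1 * q2 y" for y
      using q1 q2 pos by auto
  next
    fix h :: "real^'n \<Rightarrow> real"
    assume h: "continuous_on UNIV h" "\<And>y. 0 \<le> h y" "\<And>y. h y \<le> 1"
    have hb [measurable]: "h \<in> borel_measurable borel" using h(1) by (rule borel_measurable_continuous_onI)
    have [measurable]: "q1 \<in> borel_measurable N" "q2 \<in> borel_measurable N" "h \<in> borel_measurable N"
      using q1 q2 measurable_compose[OF point hb] by auto
    let ?G = "\<lambda>q k. \<integral>\<^sup>+y. ennreal (q y) * (\<integral>\<^sup>+u. ennreal (gauss u) * ennreal (h (interp (S k) u y)) \<partial>lborel) \<partial>N"
    have l0: "(\<lambda>k. ennreal (integral\<^sup>L N q2) * ?G q1 k) = (\<lambda>k. ennreal (integral\<^sup>L N q1) * ?G q2 k)"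
      using S by (intro ext smoothed_density_proportional q1 q2 pos S0) (auto simp: good_def)
    have l1: "(\<lambda>k. ennreal (integral\<^sup>L N q2) * ?G q1 k) \<longlonglongrightarrow>
        ennreal (integral\<^sup>L N q2) * (\<integral>\<^sup>+y. ennreal (q1 y) * ennreal (h y) \<partial>N)"
      by (intro ennreal_tendsto_cmult smoothed_limit[OF q1 h \<open>S \<longlonglongrightarrow> 1\<close>]) simp
    have l2: "(\<lambda>k. ennreal (integral\<^sup>L N q1) * ?G q2 k) \<longlonglongrightarrow>
        ennreal (integral\<^sup>L N q1) * (\<integral>\<^sup>+y. ennreal (q2 y) * ennreal (h y) \<partial>N)"
      by (intro ennreal_tendsto_cmult smoothed_limit[OF q2 h \<open>S \<longlonglongrightarrow> 1\<close>]) simp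
    have "ennreal (integral\<^sup>L N q2) * (\<integral>\<^sup>+y. ennreal (q1 y) * ennreal (h y) \<partial>N) =
        ennreal (integral\<^sup>L N q1) * (\<integral>\<^sup>+y. ennreal (q2 y) * ennreal (h y) \<partial>N)"
      by (rule LIMSEQ_unique[OF l1 l2[folded l0]])
    moreover have "(\<integral>\<^sup>+y. ennreal (a * q y) * ennreal (h y) \<partial>N) = ennreal a * (\<integral>\<^sup>+y. ennreal (q y) * ennreal (h y) \<partial>N)"
      if "0 < a" "\<And>y. 0 \<le> q y" and [measurable]: "q \<in> borel_measurable N" for a q
      using that by (subst nn_integral_cmult[symmetric]) (auto simp: ennreal_mult mult.assoc)
    ultimately show "(\<integral>\<^sup>+y. ennreal (integral\<^sup>L N q2 * q1 y) * ennreal (h y) \<partial>N) =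
        (\<integral>\<^sup>+y. ennreal (integral\<^sup>L N q1 * q2 y) * ennreal (h y) \<partial>N)"
      using pos q1(2) q2(2) by simp
  qed
qed

end

section \<open>The loss as an integral of local regression risks\<close>

text \<open>The common form of both losses for a conditioning variable \<open>c\<close>, integrated by \<open>\<kappa>\<close>, and an endpoint \<open>y\<close>
  such that \<open>(c, y)\<close> has density \<open>j\<close> with respect to \<open>\<kappa> \<Otimes>\<^sub>M N\<close>.  So \<open>j c\<close> is proportional to the conditional density
  of \<open>y\<close> given \<open>c\<close>, with a factor that depends on \<open>c\<close>; conditional means do not see this factor.\<close>

definition fm_loss ::
  "'c measure \<Rightarrow> (real^'n) measure \<Rightarrow> ('c \<Rightarrow> real^'n \<Rightarrow> real) \<Rightarrow> (real \<Rightarrow> real^'n \<Rightarrow> 'c \<Rightarrow> real^'n) \<Rightarrow> ennreal" where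
  "fm_loss \<kappa> N j v = (\<integral>\<^sup>+c. \<integral>\<^sup>+y. ennreal (j c y) * (\<integral>\<^sup>+u. ennreal (gauss u) *
     (\<integral>\<^sup>+s. indicator {0<..<1} s * ennreal ((norm (v s (interp s u y) c - (y - u)))\<^sup>2) \<partial>lborel) \<partial>lborel) \<partial>N \<partial>\<kappa>)"

text \<open>The risk of predicting the displacement by \<open>a\<close> at noise level \<open>s\<close> and noised point \<open>w\<close>.\<close>

definition local_risk :: "(real^'n) measure \<Rightarrow> (real^'n \<Rightarrow> real) \<Rightarrow> real \<Rightarrow> real^'n \<Rightarrow> real^'n \<Rightarrow> ennreal" where
  "local_risk N q s w a =
     (\<integral>\<^sup>+y. ennreal (gauss (noise s w y) * q y * (norm (a - (1 / s) *\<^sub>R (w - noise s w y)))\<^sup>2) \<partial>N)"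

text \<open>The parallel axis theorem: both sides are expanded as quadratic polynomials in \<open>b\<close>.\<close>

lemma weighted_variance_decomposition:
  fixes U :: "'a \<Rightarrow> 'b::euclidean_space"
  assumes g: "integrable M g" "\<And>y. 0 \<le> g y"
    and U: "integrable M (\<lambda>y. g y *\<^sub>R U y)" "integrable M (\<lambda>y. g y * (norm (U y))\<^sup>2)"
    and mean: "integral\<^sup>L M g *\<^sub>R m = (\<integral>y. g y *\<^sub>R U y \<partial>M)"
  shows "(\<integral>\<^sup>+y. ennreal (g y * (norm (U y - b))\<^sup>2) \<partial>M) =
    (\<integral>\<^sup>+y. ennreal (g y * (norm (U y - m))\<^sup>2) \<partial>M) + ennreal (integral\<^sup>L M g * (norm (b - m))\<^sup>2)"
proof -
  have expand: "g y * (norm (U y - b))\<^sup>2 = g y * (norm (U y))\<^sup>2 - 2 * ((g y *\<^sub>R U y) \<bullet> b) + g y * (norm b)\<^sup>2" for y b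
    by (simp add: power2_norm_eq_inner inner_diff_left inner_diff_right inner_commute algebra_simps)
  have inner: "integrable M (\<lambda>y. 2 * ((g y *\<^sub>R U y) \<bullet> b))" for b
    by (intro integrable_mult_right integrable_inner_left U)
  have sq: "integrable M (\<lambda>y. g y * (norm b)\<^sup>2)" for b :: 'b
    by (intro integrable_mult_left g)
  have int: "integrable M (\<lambda>y. g y * (norm (U y - b))\<^sup>2)" for b
    unfolding expand by (intro Bochner_Integration.integrable_add Bochner_Integration.integrable_diff inner sq U)
  have val: "(\<integral>y. g y * (norm (U y - b))\<^sup>2 \<partial>M) =
      (\<integral>y. g y * (norm (U y))\<^sup>2 \<partial>M) - 2 * integral\<^sup>L M g * (m \<bullet> b) + integral\<^sup>L M g * (norm b)\<^sup>2" for b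
  proof -
    have "(\<integral>y. 2 * ((g y *\<^sub>R U y) \<bullet> b) \<partial>M) = 2 * ((\<integral>y. g y *\<^sub>R U y \<partial>M) \<bullet> b)"
      by (simp only: integral_mult_right_zero integral_inner_left[OF U(1)])
    also have "\<dots> = 2 * integral\<^sup>L M g * (m \<bullet> b)"
      by (simp add: mean[symmetric])
    finally show ?thesis
      unfolding expand
      by (simp only: Bochner_Integration.integral_add[OF Bochner_Integration.integrable_diff[OF U(2) inner] sq]
          Bochner_Integration.integral_diff[OF U(2) inner] integral_mult_left_zero)
  qed
  have "(\<integral>y. g y * (norm (U y - b))\<^sup>2 \<partial>M) =
      (\<integral>y. g y * (norm (U y - m))\<^sup>2 \<partial>M) + integral\<^sup>L M g * (norm (b - m))\<^sup>2"
    unfolding val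
    by (simp add: power2_norm_eq_inner inner_diff_left inner_diff_right inner_commute[of b m] algebra_simps)
  moreover have "(\<integral>\<^sup>+y. ennreal (g y * (norm (U y - b))\<^sup>2) \<partial>M) = ennreal (\<integral>y. g y * (norm (U y - b))\<^sup>2 \<partial>M)" for b
    using int g by (intro nn_integral_eq_integral) auto
  ultimately show ?thesis
    using g by (simp add: ennreal_plus integral_nonneg)
qed

context observation
begin

lemma integrable_noise_second_moment:
  assumes "integrable N q"
  shows "integrable N (\<lambda>y. gauss (noise s w y) * q y * (norm (noise s w y))\<^sup>2)"
  supply point [measurable]
proof (rule Bochner_Integration.integrable_bound)
  have [measurable]: "q \<in> borel_measurable N" using assms by simp
  show "(\<lambda>y. gauss (noise s w y) * q y * (norm (noise s w y))\<^sup>2) \<in> borel_measurable N"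
    by measurable
  show "integrable N (\<lambda>y. 2 * gauss (0::real^'n) * q y)" using assms by simp
  show "AE y in N. norm (gauss (noise s w y) * q y * (norm (noise s w y))\<^sup>2) \<le> norm (2 * gauss (0::real^'n) * q y)"
  proof (intro AE_I2)
    fix y
    have "gauss (noise s w y) * (norm (noise s w y))\<^sup>2 * \<bar>q y\<bar> \<le> 2 * gauss (0::real^'n) * \<bar>q y\<bar>"
      by (intro mult_right_mono gauss_second_moment_le) auto
    then show "norm (gauss (noise s w y) * q y * (norm (noise s w y))\<^sup>2) \<le> norm (2 * gauss (0::real^'n) * q y)"
      by (simp add: abs_mult mult_ac)
  qed
qed

text \<open>Division by a vanishing evidence is harmless, because then the weights vanish almost everywhere.\<close>

lemma evidence_mult_mean_noise:
  assumes q: "integrable N q" "\<And>y. 0 \<le> q y"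
  shows "evidence N q s w *\<^sub>R ((1 / evidence N q s w) *\<^sub>R noise_moment N q s w) = noise_moment N q s w"
proof (cases "evidence N q s w = 0")
  case True
  then have "AE y in N. gauss (noise s w y) * q y = 0"
    unfolding evidence_def using integral_nonneg_eq_0_iff_AE[OF integrable_evidence[OF q(1)], of s w] q(2) by simp
  then have "noise_moment N q s w = 0"
    unfolding noise_moment_def by (intro integral_eq_zero_AE) (auto elim!: eventually_mono)
  then show ?thesis by simp
qed simp

text \<open>The displacement is an affine function of the noise with slope \<open>- 1 / s\<close>, so this is the parallel axis
  theorem for the noise with weights divided by \<open>s\<^sup>2\<close>.\<close>

lemma local_risk_pythagoras:
  assumes q: "integrable N q" "\<And>y. 0 \<le> q y" and s: "0 < s"
  shows "local_risk N q s w a = local_risk N q s w (opt_velocity N q s w) +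
    ennreal (evidence N q s w * (norm (a - opt_velocity N q s w))\<^sup>2)"
proof -
  \<comment> \<open>To predict the displacement \<open>a\<close> is to predict the noise \<open>w - s a\<close>, with an error that is multiplied by \<open>s\<close>.\<close>
  define g where "g y = (1 / s\<^sup>2) * (gauss (noise s w y) * q y)" for y
  define m where "m = (1 / evidence N q s w) *\<^sub>R noise_moment N q s w"
  have opt: "opt_velocity N q s w = (1 / s) *\<^sub>R (w - m)"
    by (simp add: opt_velocity_def m_def)
  have ge: "integral\<^sup>L N g = (1 / s\<^sup>2) * evidence N q s w"
    unfolding g_def evidence_def using integrable_evidence[OF q(1)] by simp
  have risk: "local_risk N q s w a = (\<integral>\<^sup>+y. ennreal (g y * (norm (noise s w y - (w - s *\<^sub>R a)))\<^sup>2) \<partial>N)" for a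
    unfolding local_risk_def
  proof (intro nn_integral_cong arg_cong[where f=ennreal])
    fix y
    have "a - (1 / s) *\<^sub>R (w - noise s w y) = (1 / s) *\<^sub>R (noise s w y - (w - s *\<^sub>R a))"
      using s by (simp add: algebra_simps)
    then have "(norm (a - (1 / s) *\<^sub>R (w - noise s w y)))\<^sup>2 = (1 / s\<^sup>2) * (norm (noise s w y - (w - s *\<^sub>R a)))\<^sup>2"
      by (simp add: power_mult_distrib power_divide)
    then show "gauss (noise s w y) * q y * (norm (a - (1 / s) *\<^sub>R (w - noise s w y)))\<^sup>2 =
        g y * (norm (noise s w y - (w - s *\<^sub>R a)))\<^sup>2"
      by (simp add: g_def)
  qed
  have "(\<integral>\<^sup>+y. ennreal (g y * (norm (noise s w y - (w - s *\<^sub>R a)))\<^sup>2) \<partial>N) =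
    (\<integral>\<^sup>+y. ennreal (g y * (norm (noise s w y - m))\<^sup>2) \<partial>N) + ennreal (integral\<^sup>L N g * (norm ((w - s *\<^sub>R a) - m))\<^sup>2)"
  proof (rule weighted_variance_decomposition)
    show "integrable N g"
      unfolding g_def using integrable_evidence[OF q(1)] by simp
    show "0 \<le> g y" for y
      using q by (simp add: g_def)
    have gU: "(\<lambda>y. g y *\<^sub>R noise s w y) = (\<lambda>y. (1 / s\<^sup>2) *\<^sub>R ((gauss (noise s w y) * q y) *\<^sub>R noise s w y))"
      by (auto simp: g_def)
    show "integrable N (\<lambda>y. g y *\<^sub>R noise s w y)"
      unfolding gU by (intro integrable_scaleR_right integrable_noise_moment q)
    have "integral\<^sup>L N g *\<^sub>R m = (1 / s\<^sup>2) *\<^sub>R (evidence N q s w *\<^sub>R m)"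
      by (simp add: ge)
    also have "\<dots> = (1 / s\<^sup>2) *\<^sub>R noise_moment N q s w"
      unfolding m_def using evidence_mult_mean_noise[OF q] by simp
    also have "\<dots> = (\<integral>y. g y *\<^sub>R noise s w y \<partial>N)"
      unfolding gU noise_moment_def by (rule integral_scaleR_right[symmetric])
    finally show "integral\<^sup>L N g *\<^sub>R m = (\<integral>y. g y *\<^sub>R noise s w y \<partial>N)" .
    have "integrable N (\<lambda>y. (1 / s\<^sup>2) * (gauss (noise s w y) * q y * (norm (noise s w y))\<^sup>2))"
      by (intro integrable_mult_right integrable_noise_second_moment q)
    then show "integrable N (\<lambda>y. g y * (norm (noise s w y))\<^sup>2)"
      by (simp add: g_def mult.assoc)
  qed
  moreover have "w - s *\<^sub>R opt_velocity N q s w = m"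
    using s by (simp add: opt)
  moreover have "integral\<^sup>L N g * (norm ((w - s *\<^sub>R a) - m))\<^sup>2 = evidence N q s w * (norm (a - opt_velocity N q s w))\<^sup>2"
  proof -
    have "(w - s *\<^sub>R a) - m = - s *\<^sub>R (a - opt_velocity N q s w)"
      using s by (simp add: opt algebra_simps)
    then show ?thesis
      using s by (simp add: ge power_mult_distrib)
  qed
  ultimately show ?thesis
    by (simp add: risk)
qed

text \<open>For a fixed conditioning variable the loss is regrouped by what the field can see: the integral over
  the noise \<open>u\<close> becomes an integral over the noised point \<open>w\<close>, which is moved outside the integral over \<open>y\<close>.\<close>

lemma conditional_loss_disintegration:
  assumes [measurable]: "q \<in> borel_measurable N" "(\<lambda>(s, w). v s w) \<in> borel_measurable (borel \<Otimes>\<^sub>M borel)"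
    and q: "\<And>y. 0 \<le> q y"
  shows "(\<integral>\<^sup>+y. ennreal (q y) * (\<integral>\<^sup>+u. ennreal (gauss u) *
      (\<integral>\<^sup>+s. indicator {0<..<1} s * ennreal ((norm (v s (interp s u y) - (y - u)))\<^sup>2) \<partial>lborel) \<partial>lborel) \<partial>N) =
    (\<integral>\<^sup>+s. indicator {0<..<1} s * ennreal (1 / (1 - s) ^ CARD('n)) * (\<integral>\<^sup>+w. local_risk N q s w (v s w) \<partial>lborel) \<partial>lborel)"
proof -
  interpret NL: pair_sigma_finite N "lborel :: real measure" ..
  interpret NV: pair_sigma_finite N "lborel :: (real^'n) measure" ..
  define R where "R s u y = ennreal ((norm (v s (interp s u y) - (y - u)))\<^sup>2)" for s u y
  define J :: "real \<Rightarrow> ennreal" where "J s = indicator {0<..<1} s" for s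
  have [measurable]: "J \<in> borel_measurable borel"
    unfolding J_def by measurable
  have R [measurable]: "(\<lambda>x. R (f x) (g x) (h x)) \<in> borel_measurable M"
    if [measurable]: "f \<in> borel_measurable M" "g \<in> borel_measurable M" "h \<in> borel_measurable M" for f g h and M :: "'z measure"
    unfolding R_def by measurable
  have "(\<integral>\<^sup>+y. ennreal (q y) * (\<integral>\<^sup>+u. ennreal (gauss u) * (\<integral>\<^sup>+s. J s * R s u y \<partial>lborel) \<partial>lborel) \<partial>N) =
      (\<integral>\<^sup>+y. (\<integral>\<^sup>+s. ennreal (q y) * (J s * (\<integral>\<^sup>+u. ennreal (gauss u) * R s u y \<partial>lborel)) \<partial>lborel) \<partial>N)"
  proof (rule nn_integral_cong)
    fix y
    have "(\<integral>\<^sup>+u. ennreal (gauss u) * (\<integral>\<^sup>+s. J s * R s u y \<partial>lborel) \<partial>lborel) =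
        (\<integral>\<^sup>+u. (\<integral>\<^sup>+s. ennreal (gauss u) * (J s * R s u y) \<partial>lborel) \<partial>lborel)"
      by (intro nn_integral_cong nn_integral_cmult[symmetric]) measurable
    also have "\<dots> = (\<integral>\<^sup>+s. (\<integral>\<^sup>+u. ennreal (gauss u) * (J s * R s u y) \<partial>lborel) \<partial>lborel)"
      by (rule lborel_pair.Fubini'[symmetric]) measurable
    also have "\<dots> = (\<integral>\<^sup>+s. J s * (\<integral>\<^sup>+u. ennreal (gauss u) * R s u y \<partial>lborel) \<partial>lborel)"
      by (intro nn_integral_cong) (subst nn_integral_cmult[symmetric], measurable, simp add: mult_ac)
    finally show "ennreal (q y) * (\<integral>\<^sup>+u. ennreal (gauss u) * (\<integral>\<^sup>+s. J s * R s u y \<partial>lborel) \<partial>lborel) =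
        (\<integral>\<^sup>+s. ennreal (q y) * (J s * (\<integral>\<^sup>+u. ennreal (gauss u) * R s u y \<partial>lborel)) \<partial>lborel)"
      by (subst nn_integral_cmult) auto
  qed
  also have "\<dots> = (\<integral>\<^sup>+s. (\<integral>\<^sup>+y. ennreal (q y) * (J s * (\<integral>\<^sup>+u. ennreal (gauss u) * R s u y \<partial>lborel)) \<partial>N) \<partial>lborel)"
  proof (rule NL.Fubini'[symmetric])
    have [measurable]: "fst \<in> borel_measurable (N \<Otimes>\<^sub>M (lborel :: real measure))"
      by (rule measurable_point) measurable
    show "(\<lambda>(y, s). ennreal (q y) * (J s * (\<integral>\<^sup>+u. ennreal (gauss u) * R s u y \<partial>lborel))) \<in> borel_measurable (N \<Otimes>\<^sub>M lborel)"
      by measurable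
  qed
  also have "\<dots> = (\<integral>\<^sup>+s. J s * ennreal (1 / (1 - s) ^ CARD('n)) * (\<integral>\<^sup>+w. local_risk N q s w (v s w) \<partial>lborel) \<partial>lborel)"
  proof (rule nn_integral_cong)
    fix s :: real
    show "(\<integral>\<^sup>+y. ennreal (q y) * (J s * (\<integral>\<^sup>+u. ennreal (gauss u) * R s u y \<partial>lborel)) \<partial>N) =
        J s * ennreal (1 / (1 - s) ^ CARD('n)) * (\<integral>\<^sup>+w. local_risk N q s w (v s w) \<partial>lborel)"
    proof (cases "0 < s \<and> s < 1")
      case True
      \<comment> \<open>For fixed \<open>y\<close> the squared error is a function of the noised point alone.\<close>
      define T where "T w y = ennreal ((norm (v s w - (1 / s) *\<^sub>R (w - noise s w y)))\<^sup>2)" for w y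
      define k where "k = (1 - s) ^ CARD('n)"
      have "k > 0" using True by (simp add: k_def)
      have T [measurable]: "(\<lambda>x. T (f x) (g x)) \<in> borel_measurable M"
        if [measurable]: "f \<in> borel_measurable M" "g \<in> borel_measurable M" for f g and M :: "'z measure"
        unfolding T_def by measurable
      have RT: "R s u y = T (interp s u y) y" for u y
      proof -
        have "(1 / s) *\<^sub>R (interp s u y - u) = y - u"
          using True by (simp add: interp_def algebra_simps)
        then show ?thesis
          using True by (simp add: R_def T_def noise_interp)
      qed
      have sub: "(\<integral>\<^sup>+u. ennreal (gauss u) * R s u y \<partial>lborel) =
          ennreal (1 / k) * (\<integral>\<^sup>+w. ennreal (gauss (noise s w y)) * T w y \<partial>lborel)" for y
      proof -
        have "(\<integral>\<^sup>+w. ennreal (gauss (noise s w y)) * T w y \<partial>lborel) = ennreal k * (\<integral>\<^sup>+u. ennreal (gauss u) * T (interp s u y) y \<partial>lborel)"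
          unfolding k_def using True by (intro noise_substitution) auto
        then show ?thesis
          using \<open>k > 0\<close> by (simp add: RT mult.assoc[symmetric] ennreal_mult[symmetric])
      qed
      have [measurable]: "fst \<in> borel_measurable (N \<Otimes>\<^sub>M (lborel :: (real^'n) measure))"
        by (rule measurable_point) measurable
      have [measurable]: "(\<lambda>y. \<integral>\<^sup>+w. ennreal (gauss (noise s w y)) * T w y \<partial>lborel) \<in> borel_measurable N"
        by measurable
      have "(\<integral>\<^sup>+y. ennreal (q y) * (J s * (\<integral>\<^sup>+u. ennreal (gauss u) * R s u y \<partial>lborel)) \<partial>N) =
          (\<integral>\<^sup>+y. ennreal (1 / k) * (ennreal (q y) * (\<integral>\<^sup>+w. ennreal (gauss (noise s w y)) * T w y \<partial>lborel)) \<partial>N)"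
        using True by (simp add: sub J_def mult_ac)
      also have "\<dots> = ennreal (1 / k) * (\<integral>\<^sup>+y. ennreal (q y) * (\<integral>\<^sup>+w. ennreal (gauss (noise s w y)) * T w y \<partial>lborel) \<partial>N)"
        by (rule nn_integral_cmult) measurable
      also have "(\<integral>\<^sup>+y. ennreal (q y) * (\<integral>\<^sup>+w. ennreal (gauss (noise s w y)) * T w y \<partial>lborel) \<partial>N) =
          (\<integral>\<^sup>+y. (\<integral>\<^sup>+w. ennreal (q y) * (ennreal (gauss (noise s w y)) * T w y) \<partial>lborel) \<partial>N)"
        by (intro nn_integral_cong nn_integral_cmult[symmetric]) measurable
      also have "\<dots> = (\<integral>\<^sup>+w. (\<integral>\<^sup>+y. ennreal (q y) * (ennreal (gauss (noise s w y)) * T w y) \<partial>N) \<partial>lborel)"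
        by (rule NV.Fubini'[symmetric]) measurable
      also have "\<dots> = (\<integral>\<^sup>+w. local_risk N q s w (v s w) \<partial>lborel)"
        unfolding local_risk_def T_def using q
        by (intro nn_integral_cong) (simp add: ennreal_mult[symmetric] mult_ac)
      finally show ?thesis
        using True by (simp add: J_def k_def)
    qed (auto simp: J_def)
  qed
  finally show ?thesis
    by (simp add: R_def J_def)
qed

end

section \<open>Pythagoras for the loss\<close>

definition excess_risk ::
  "'c measure \<Rightarrow> (real^'n) measure \<Rightarrow> ('c \<Rightarrow> real^'n \<Rightarrow> real) \<Rightarrow> (real \<Rightarrow> real^'n \<Rightarrow> 'c \<Rightarrow> real^'n) \<Rightarrow> ennreal" where
  "excess_risk \<kappa> N j v = (\<integral>\<^sup>+c. \<integral>\<^sup>+s. indicator {0<..<1} s * ennreal (1 / (1 - s) ^ CARD('n)) *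
     (\<integral>\<^sup>+w. ennreal (evidence N (j c) s w * (norm (v s w c - opt_velocity N (j c) s w))\<^sup>2) \<partial>lborel) \<partial>lborel \<partial>\<kappa>)"

abbreviation opt_field :: "(real^'n) measure \<Rightarrow> ('c \<Rightarrow> real^'n \<Rightarrow> real) \<Rightarrow> real \<Rightarrow> real^'n \<Rightarrow> 'c \<Rightarrow> real^'n" where
  "opt_field N j \<equiv> \<lambda>s w c. opt_velocity N (j c) s w"

lemma measurable_compose3:
  assumes v: "(\<lambda>(s, w, c). v s w c) \<in> measurable (A \<Otimes>\<^sub>M B \<Otimes>\<^sub>M C) D"
    and "f \<in> measurable M A" "g \<in> measurable M B" "h \<in> measurable M C"
  shows "(\<lambda>x. v (f x) (g x) (h x)) \<in> measurable M D"
  using measurable_compose[OF measurable_Pair[OF assms(2) measurable_Pair[OF assms(3,4)]] v] by simp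

context observation
begin

context
  fixes \<kappa> :: "'c measure" and j :: "'c \<Rightarrow> real^'n \<Rightarrow> real"
  assumes j [measurable]: "(\<lambda>(c, y). j c y) \<in> borel_measurable (\<kappa> \<Otimes>\<^sub>M N)"
begin

lemma measurable_evidence:
  assumes [measurable]: "f \<in> borel_measurable M" "g \<in> borel_measurable M" "h \<in> measurable M \<kappa>"
  shows "(\<lambda>x. evidence N (j (h x)) (f x) (g x)) \<in> borel_measurable M"
proof -
  have [measurable]: "snd \<in> borel_measurable (M \<Otimes>\<^sub>M N)"
    by (rule measurable_point) measurable
  show ?thesis
    unfolding evidence_def by measurable
qed

lemma measurable_noise_moment:
  assumes [measurable]: "f \<in> borel_measurable M" "g \<in> borel_measurable M" "h \<in> measurable M \<kappa>"
  shows "(\<lambda>x. noise_moment N (j (h x)) (f x) (g x)) \<in> borel_measurable M"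
proof -
  have [measurable]: "snd \<in> borel_measurable (M \<Otimes>\<^sub>M N)"
    by (rule measurable_point) measurable
  show ?thesis
    unfolding noise_moment_def by measurable
qed

lemma measurable_opt_velocity:
  assumes [measurable]: "f \<in> borel_measurable M" "g \<in> borel_measurable M" "h \<in> measurable M \<kappa>"
  shows "(\<lambda>x. opt_velocity N (j (h x)) (f x) (g x)) \<in> borel_measurable M"
  unfolding opt_velocity_def using measurable_evidence[OF assms] measurable_noise_moment[OF assms] by measurable

lemma measurable_local_risk:
  assumes [measurable]: "f \<in> borel_measurable M" "g \<in> borel_measurable M" "h \<in> measurable M \<kappa>" "a \<in> borel_measurable M"
  shows "(\<lambda>x. local_risk N (j (h x)) (f x) (g x) (a x)) \<in> borel_measurable M"
proof -
  have [measurable]: "snd \<in> borel_measurable (M \<Otimes>\<^sub>M N)"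
    by (rule measurable_point) measurable
  show ?thesis
    unfolding local_risk_def by measurable
qed

lemma measurable_opt_field:
  "(\<lambda>(s, w, c). opt_field N j s w c) \<in> borel_measurable (borel \<Otimes>\<^sub>M borel \<Otimes>\<^sub>M \<kappa>)"
  unfolding split_beta' by (rule measurable_opt_velocity) measurable

context
  assumes nonneg: "\<And>c y. 0 \<le> j c y"
begin

lemma fm_loss_eq_local_risk:
  assumes [measurable]: "(\<lambda>(s, w, c). v s w c) \<in> borel_measurable (borel \<Otimes>\<^sub>M borel \<Otimes>\<^sub>M \<kappa>)"
  shows "fm_loss \<kappa> N j v = (\<integral>\<^sup>+c. \<integral>\<^sup>+s. indicator {0<..<1} s * ennreal (1 / (1 - s) ^ CARD('n)) *
     (\<integral>\<^sup>+w. local_risk N (j c) s w (v s w c) \<partial>lborel) \<partial>lborel \<partial>\<kappa>)"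
  unfolding fm_loss_def
proof (rule nn_integral_cong)
  fix c assume [measurable]: "c \<in> space \<kappa>"
  show "(\<integral>\<^sup>+y. ennreal (j c y) * (\<integral>\<^sup>+u. ennreal (gauss u) *
      (\<integral>\<^sup>+s. indicator {0<..<1} s * ennreal ((norm (v s (interp s u y) c - (y - u)))\<^sup>2) \<partial>lborel) \<partial>lborel) \<partial>N) =
    (\<integral>\<^sup>+s. indicator {0<..<1} s * ennreal (1 / (1 - s) ^ CARD('n)) * (\<integral>\<^sup>+w. local_risk N (j c) s w (v s w c) \<partial>lborel) \<partial>lborel)"
  proof (rule conditional_loss_disintegration)
    show "j c \<in> borel_measurable N" by measurable
    show "(\<lambda>(s, w). v s w c) \<in> borel_measurable (borel \<Otimes>\<^sub>M borel)"
      unfolding split_beta' by (rule measurable_compose3[OF assms]) measurable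
  qed (rule nonneg)
qed

lemma fm_loss_pythagoras:
  assumes [measurable]: "(\<lambda>(s, w, c). v s w c) \<in> borel_measurable (borel \<Otimes>\<^sub>M borel \<Otimes>\<^sub>M \<kappa>)"
    and int: "AE c in \<kappa>. integrable N (j c)"
  shows "fm_loss \<kappa> N j v = fm_loss \<kappa> N j (opt_field N j) + excess_risk \<kappa> N j v"
proof -
  \<comment> \<open>\<open>A\<close> is the risk of the optimal field and \<open>B\<close> the excess risk.\<close>
  define W where "W s = indicator {0<..<1} s * ennreal (1 / (1 - s) ^ CARD('n))" for s :: real
  define A where "A c s w = local_risk N (j c) s w (opt_velocity N (j c) s w)" for c s w
  define B where "B c s w = ennreal (evidence N (j c) s w * (norm (v s w c - opt_velocity N (j c) s w))\<^sup>2)" for c s w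
  have [measurable]: "W \<in> borel_measurable borel"
    unfolding W_def by measurable
  have [measurable]: "(\<lambda>x. A (h x) (f x) (g x)) \<in> borel_measurable M" "(\<lambda>x. B (h x) (f x) (g x)) \<in> borel_measurable M"
    if [measurable]: "f \<in> borel_measurable M" "g \<in> borel_measurable M" "h \<in> measurable M \<kappa>" for f g h and M :: "'z measure"
  proof -
    note [measurable] = measurable_compose3[OF assms(1) that] measurable_evidence[OF that] measurable_opt_velocity[OF that]
      measurable_local_risk[OF that measurable_opt_velocity[OF that]]
    show "(\<lambda>x. A (h x) (f x) (g x)) \<in> borel_measurable M" "(\<lambda>x. B (h x) (f x) (g x)) \<in> borel_measurable M"
      unfolding A_def B_def by measurable
  qed
  have "fm_loss \<kappa> N j v = (\<integral>\<^sup>+c. (\<integral>\<^sup>+s. W s * (\<integral>\<^sup>+w. A c s w \<partial>lborel) \<partial>lborel) + (\<integral>\<^sup>+s. W s * (\<integral>\<^sup>+w. B c s w \<partial>lborel) \<partial>lborel) \<partial>\<kappa>)"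
    unfolding fm_loss_eq_local_risk[OF assms(1)] W_def[symmetric]
  proof (rule nn_integral_cong_AE)
    show "AE c in \<kappa>. (\<integral>\<^sup>+s. W s * (\<integral>\<^sup>+w. local_risk N (j c) s w (v s w c) \<partial>lborel) \<partial>lborel) =
      (\<integral>\<^sup>+s. W s * (\<integral>\<^sup>+w. A c s w \<partial>lborel) \<partial>lborel) + (\<integral>\<^sup>+s. W s * (\<integral>\<^sup>+w. B c s w \<partial>lborel) \<partial>lborel)"
      using int AE_space
    proof eventually_elim
      case (elim c)
      note [measurable] = elim(2)
      have "(\<integral>\<^sup>+s. W s * (\<integral>\<^sup>+w. local_risk N (j c) s w (v s w c) \<partial>lborel) \<partial>lborel) =
          (\<integral>\<^sup>+s. W s * (\<integral>\<^sup>+w. A c s w \<partial>lborel) + W s * (\<integral>\<^sup>+w. B c s w \<partial>lborel) \<partial>lborel)"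
      proof (rule nn_integral_cong)
        fix s
        show "W s * (\<integral>\<^sup>+w. local_risk N (j c) s w (v s w c) \<partial>lborel) =
            W s * (\<integral>\<^sup>+w. A c s w \<partial>lborel) + W s * (\<integral>\<^sup>+w. B c s w \<partial>lborel)"
        proof (cases "0 < s")
          case True
          have "(\<integral>\<^sup>+w. local_risk N (j c) s w (v s w c) \<partial>lborel) = (\<integral>\<^sup>+w. A c s w + B c s w \<partial>lborel)"
            unfolding A_def B_def by (rule nn_integral_cong) (rule local_risk_pythagoras[OF elim(1) nonneg True])
          also have "\<dots> = (\<integral>\<^sup>+w. A c s w \<partial>lborel) + (\<integral>\<^sup>+w. B c s w \<partial>lborel)"
            by (rule nn_integral_add) measurable
          finally show ?thesis by (simp add: distrib_left)
        qed (simp add: W_def)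
      qed
      also have "\<dots> = (\<integral>\<^sup>+s. W s * (\<integral>\<^sup>+w. A c s w \<partial>lborel) \<partial>lborel) + (\<integral>\<^sup>+s. W s * (\<integral>\<^sup>+w. B c s w \<partial>lborel) \<partial>lborel)"
        by (rule nn_integral_add) measurable
      finally show ?case .
    qed
  qed
  also have "\<dots> = (\<integral>\<^sup>+c. (\<integral>\<^sup>+s. W s * (\<integral>\<^sup>+w. A c s w \<partial>lborel) \<partial>lborel) \<partial>\<kappa>) + (\<integral>\<^sup>+c. (\<integral>\<^sup>+s. W s * (\<integral>\<^sup>+w. B c s w \<partial>lborel) \<partial>lborel) \<partial>\<kappa>)"
    by (rule nn_integral_add) measurable
  finally show ?thesis
    by (simp add: fm_loss_eq_local_risk[OF measurable_opt_field] excess_risk_def W_def A_def B_def)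
qed

lemma opt_field_minimal:
  assumes "(\<lambda>(s, w, c). v s w c) \<in> borel_measurable (borel \<Otimes>\<^sub>M borel \<Otimes>\<^sub>M \<kappa>)" and "AE c in \<kappa>. integrable N (j c)"
  shows "fm_loss \<kappa> N j (opt_field N j) \<le> fm_loss \<kappa> N j v"
  using fm_loss_pythagoras[OF assms] by simp

text \<open>The finite loss can be cancelled in Pythagoras' identity, so the excess risk vanishes.\<close>

lemma opt_field_unique:
  assumes v [measurable]: "(\<lambda>(s, w, c). v s w c) \<in> borel_measurable (borel \<Otimes>\<^sub>M borel \<Otimes>\<^sub>M \<kappa>)"
    and int: "AE c in \<kappa>. integrable N (j c)"
    and eq: "fm_loss \<kappa> N j v = fm_loss \<kappa> N j (opt_field N j)" and fin: "fm_loss \<kappa> N j (opt_field N j) < \<infinity>"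
  shows "AE c in \<kappa>. AE s in lborel. 0 < s \<and> s < 1 \<longrightarrow>
    (AE w in lborel. evidence N (j c) s w \<noteq> 0 \<longrightarrow> v s w c = opt_velocity N (j c) s w)"
proof -
  define W where "W s = indicator {0<..<1} s * ennreal (1 / (1 - s) ^ CARD('n))" for s :: real
  define B where "B c s w = ennreal (evidence N (j c) s w * (norm (v s w c - opt_velocity N (j c) s w))\<^sup>2)" for c s w
  have [measurable]: "W \<in> borel_measurable borel"
    unfolding W_def by measurable
  have [measurable]: "(\<lambda>x. B (h x) (f x) (g x)) \<in> borel_measurable M"
    if [measurable]: "f \<in> borel_measurable M" "g \<in> borel_measurable M" "h \<in> measurable M \<kappa>" for f g h and M :: "'z measure"
  proof -
    note [measurable] = measurable_compose3[OF v that] measurable_evidence[OF that] measurable_opt_velocity[OF that]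
    show ?thesis
      unfolding B_def by measurable
  qed
  have "fm_loss \<kappa> N j (opt_field N j) + excess_risk \<kappa> N j v = fm_loss \<kappa> N j (opt_field N j) + 0"
    using fm_loss_pythagoras[OF v int] eq by simp
  then have "excess_risk \<kappa> N j v = 0"
    using fin by (subst (asm) ennreal_add_left_cancel) auto
  then have "(\<integral>\<^sup>+c. \<integral>\<^sup>+s. W s * (\<integral>\<^sup>+w. B c s w \<partial>lborel) \<partial>lborel \<partial>\<kappa>) = 0"
    by (simp add: excess_risk_def W_def B_def)
  then have "AE c in \<kappa>. (\<integral>\<^sup>+s. W s * (\<integral>\<^sup>+w. B c s w \<partial>lborel) \<partial>lborel) = 0"
    by (subst (asm) nn_integral_0_iff_AE) measurable
  then show ?thesis
    using AE_space
  proof eventually_elim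
    case (elim c)
    note [measurable] = elim(2)
    have "AE s in lborel. W s * (\<integral>\<^sup>+w. B c s w \<partial>lborel) = 0"
      using elim(1) by (subst (asm) nn_integral_0_iff_AE) measurable
    then show ?case
    proof eventually_elim
      case (elim s)
      show ?case
      proof
        assume s: "0 < s \<and> s < 1"
        then have "W s \<noteq> 0" by (simp add: W_def)
        with elim have "(\<integral>\<^sup>+w. B c s w \<partial>lborel) = 0" by simp
        then have "AE w in lborel. B c s w = 0"
          by (subst (asm) nn_integral_0_iff_AE) measurable
        then show "AE w in lborel. evidence N (j c) s w \<noteq> 0 \<longrightarrow> v s w c = opt_velocity N (j c) s w"
        proof eventually_elim
          case (elim w)
          have "evidence N (j c) s w * (norm (v s w c - opt_velocity N (j c) s w))\<^sup>2 \<le> 0"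
            using elim by (simp add: B_def ennreal_eq_0_iff)
          moreover have "0 \<le> evidence N (j c) s w * (norm (v s w c - opt_velocity N (j c) s w))\<^sup>2"
            using evidence_nonneg[of "j c" s w] nonneg by simp
          ultimately have "evidence N (j c) s w * (norm (v s w c - opt_velocity N (j c) s w))\<^sup>2 = 0"
            by (rule antisym)
          then show ?case by auto
        qed
      qed
    qed
  qed
qed

text \<open>A conditional mean does not change when the weights are multiplied by a constant, here \<open>a c\<close>.  Where
  \<open>a c = 0\<close> the weights vanish and the field is irrelevant.\<close>

lemma opt_field_of_proportional_density:
  fixes k :: "'z \<Rightarrow> real^'n \<Rightarrow> real" and r :: "'c \<Rightarrow> 'z"
  assumes v: "(\<lambda>(s, w, c). opt_velocity N (k (r c)) s w) \<in> borel_measurable (borel \<Otimes>\<^sub>M borel \<Otimes>\<^sub>M \<kappa>)"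
    and k: "\<And>c. c \<in> space \<kappa> \<Longrightarrow> k (r c) \<in> borel_measurable N"
    and int: "AE c in \<kappa>. integrable N (j c)"
    and fac: "AE c in \<kappa>. AE y in N. j c y = a c * k (r c) y"
  shows "fm_loss \<kappa> N j (\<lambda>s w c. opt_velocity N (k (r c)) s w) = fm_loss \<kappa> N j (opt_field N j)"
proof -
  have "AE c in \<kappa>. \<forall>s w. evidence N (j c) s w * (norm (opt_velocity N (k (r c)) s w - opt_velocity N (j c) s w))\<^sup>2 = 0"
    using fac int AE_space
  proof eventually_elim
    case (elim c)
    note [measurable] = borel_measurable_integrable[OF elim(2)] k[OF elim(3)]
    have e: "evidence N (j c) s w = a c * evidence N (k (r c)) s w" for s w
    proof -
      have "evidence N (j c) s w = (\<integral>y. a c * (gauss (noise s w y) * k (r c) y) \<partial>N)"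
        unfolding evidence_def supply point [measurable]
        by (intro integral_cong_AE) (use elim(1) in \<open>auto elim!: eventually_mono\<close>)
      then show ?thesis by (simp add: evidence_def)
    qed
    have m: "noise_moment N (j c) s w = a c *\<^sub>R noise_moment N (k (r c)) s w" for s w
    proof -
      have "noise_moment N (j c) s w = (\<integral>y. a c *\<^sub>R ((gauss (noise s w y) * k (r c) y) *\<^sub>R noise s w y) \<partial>N)"
        unfolding noise_moment_def supply point [measurable]
        by (intro integral_cong_AE) (use elim(1) in \<open>auto elim!: eventually_mono simp: mult_ac\<close>)
      then show ?thesis by (simp only: noise_moment_def integral_scaleR_right)
    qed
    show ?case
      by (cases "a c = 0") (auto simp: e m opt_velocity_def)
  qed
  then have "excess_risk \<kappa> N j (\<lambda>s w c. opt_velocity N (k (r c)) s w) = (\<integral>\<^sup>+c. 0 \<partial>\<kappa>)"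
    unfolding excess_risk_def
  proof (intro nn_integral_cong_AE, eventually_elim)
    case (elim c)
    show ?case by (simp only: elim ennreal_0 nn_integral_const) simp
  qed
  then show ?thesis
    using fm_loss_pythagoras[OF v int] by simp
qed

end
end
end

section \<open>Conditioning on a function of the conditioning variable\<close>

context observation
begin

lemma AE_integrable_of_finite_mass:
  assumes [measurable]: "(\<lambda>(c, y). j c y) \<in> borel_measurable (\<kappa> \<Otimes>\<^sub>M N)" and nonneg: "\<And>c y. 0 \<le> j c y"
    and mass: "(\<integral>\<^sup>+c. \<integral>\<^sup>+y. ennreal (j c y) \<partial>N \<partial>\<kappa>) < \<infinity>"
  shows "AE c in \<kappa>. integrable N (j c)"
proof -
  have "AE c in \<kappa>. (\<integral>\<^sup>+y. ennreal (j c y) \<partial>N) \<noteq> \<infinity>"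
    using mass by (intro nn_integral_PInf_AE) auto
  then show ?thesis
    using AE_space
  proof eventually_elim
    case (elim c)
    note [measurable] = elim(2)
    show ?case
      by (rule integrableI_nonneg) (use elim(1) nonneg in \<open>auto simp: less_top\<close>)
  qed
qed

text \<open>The law of \<open>(r c, y)\<close> is absolutely continuous with respect to the product of the law of \<open>r c\<close> and \<open>N\<close>: if
  almost all sections of a set are null, then so are the sections at \<open>r c\<close> for almost all \<open>c\<close> that carry
  mass.  The density \<open>k\<close> is the Radon-Nikodym derivative.\<close>

lemma pushforward_density_exists:
  fixes \<kappa> :: "'c measure" and j :: "'c \<Rightarrow> real^'n \<Rightarrow> real" and Z :: "'z measure"
  assumes "sigma_finite_measure \<kappa>"
    and j [measurable]: "(\<lambda>(c, y). j c y) \<in> borel_measurable (\<kappa> \<Otimes>\<^sub>M N)" and nonneg: "\<And>c y. 0 \<le> j c y"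
    and mass: "(\<integral>\<^sup>+c. \<integral>\<^sup>+y. ennreal (j c y) \<partial>N \<partial>\<kappa>) < \<infinity>"
    and r [measurable]: "r \<in> measurable \<kappa> Z"
  obtains \<nu> k where "sigma_finite_measure \<nu>" "sets \<nu> = sets Z"
    "(\<lambda>(z, y). k z y) \<in> borel_measurable (\<nu> \<Otimes>\<^sub>M N)" "\<And>z y. 0 \<le> (k z y :: real)"
    "\<And>F. (\<lambda>(z, y). F z y) \<in> borel_measurable (Z \<Otimes>\<^sub>M N) \<Longrightarrow>
      (\<integral>\<^sup>+c. \<integral>\<^sup>+y. ennreal (j c y) * F (r c) y \<partial>N \<partial>\<kappa>) = (\<integral>\<^sup>+z. \<integral>\<^sup>+y. ennreal (k z y) * F z y \<partial>N \<partial>\<nu>)"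
proof -
  interpret \<kappa>: sigma_finite_measure \<kappa> by fact
  interpret \<kappa>N: pair_sigma_finite \<kappa> N ..
  define P where "P = density (\<kappa> \<Otimes>\<^sub>M N) (\<lambda>(c, y). ennreal (j c y))"
  define \<nu> where "\<nu> = distr (density \<kappa> (\<lambda>c. \<integral>\<^sup>+y. ennreal (j c y) \<partial>N)) Z r"
  define M where "M = distr P (Z \<Otimes>\<^sub>M N) (\<lambda>(c, y). (r c, y))"
  have [simp, measurable_cong]: "sets \<nu> = sets Z" by (simp add: \<nu>_def)
  have [simp, measurable_cong]: "sets M = sets (Z \<Otimes>\<^sub>M N)" by (simp add: M_def)
  have [measurable]: "(\<lambda>(c, y). (r c, y)) \<in> measurable P (Z \<Otimes>\<^sub>M N)"
    unfolding P_def by measurable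
  have M_int: "(\<integral>\<^sup>+x. F x \<partial>M) = (\<integral>\<^sup>+c. \<integral>\<^sup>+y. ennreal (j c y) * F (r c, y) \<partial>N \<partial>\<kappa>)"
    if [measurable]: "F \<in> borel_measurable (Z \<Otimes>\<^sub>M N)" for F
  proof -
    have "(\<integral>\<^sup>+x. F x \<partial>M) = (\<integral>\<^sup>+x. (case x of (c, y) \<Rightarrow> ennreal (j c y) * F (r c, y)) \<partial>(\<kappa> \<Otimes>\<^sub>M N))"
      unfolding M_def by (subst nn_integral_distr) (auto simp: P_def nn_integral_density split_beta')
    also have "\<dots> = (\<integral>\<^sup>+c. \<integral>\<^sup>+y. ennreal (j c y) * F (r c, y) \<partial>N \<partial>\<kappa>)"
      by (subst nn_integral_fst[symmetric]) auto
    finally show ?thesis .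
  qed
  have "emeasure \<nu> (space \<nu>) = (\<integral>\<^sup>+c. \<integral>\<^sup>+y. ennreal (j c y) \<partial>N \<partial>\<kappa>)"
    unfolding \<nu>_def by (simp add: emeasure_distr emeasure_density measurable_space[OF r]
        cong: nn_integral_cong_simp)
  then interpret \<nu>: finite_measure \<nu>
    using mass by (intro finite_measureI) auto
  interpret \<nu>N: pair_sigma_finite \<nu> N ..
  have ac: "absolutely_continuous (\<nu> \<Otimes>\<^sub>M N) M"
    unfolding absolutely_continuous_def
  proof
    fix A assume A: "A \<in> null_sets (\<nu> \<Otimes>\<^sub>M N)"
    then have [measurable]: "A \<in> sets (Z \<Otimes>\<^sub>M N)" by auto
    have "AE x in \<nu> \<Otimes>\<^sub>M N. x \<notin> A"
      using A by (rule AE_not_in)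
    then have "AE z in \<nu>. AE y in N. (z, y) \<notin> A"
      by (rule \<nu>N.AE_pair)
    then have "AE c in density \<kappa> (\<lambda>c. \<integral>\<^sup>+y. ennreal (j c y) \<partial>N). AE y in N. (r c, y) \<notin> A"
      unfolding \<nu>_def by (rule AE_distrD[rotated]) simp
    then have "AE c in \<kappa>. 0 < (\<integral>\<^sup>+y. ennreal (j c y) \<partial>N) \<longrightarrow> (AE y in N. (r c, y) \<notin> A)"
      by (subst (asm) AE_density) auto
    then have "AE c in \<kappa>. (\<integral>\<^sup>+y. ennreal (j c y) * indicator A (r c, y) \<partial>N) = 0"
      using AE_space
    proof eventually_elim
      case (elim c)
      note [measurable] = elim(2)
      have "AE y in N. ennreal (j c y) * indicator A (r c, y) = 0"
      proof (cases "0 < (\<integral>\<^sup>+y. ennreal (j c y) \<partial>N)")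
        case True
        then show ?thesis using elim(1) by (auto elim!: eventually_mono)
      next
        case False
        then have "(\<integral>\<^sup>+y. ennreal (j c y) \<partial>N) = 0" by (simp add: zero_less_iff_neq_zero)
        then have "AE y in N. ennreal (j c y) = 0"
          by (subst (asm) nn_integral_0_iff_AE) auto
        then show ?thesis by (auto elim!: eventually_mono)
      qed
      then show ?case by (subst nn_integral_0_iff_AE) auto
    qed
    then have "(\<integral>\<^sup>+c. \<integral>\<^sup>+y. ennreal (j c y) * indicator A (r c, y) \<partial>N \<partial>\<kappa>) = 0"
      by (subst nn_integral_0_iff_AE) auto
    then have "emeasure M A = 0"
      using M_int[of "indicator A"] by simp
    then show "A \<in> null_sets M" by auto
  qed
  define k0 where "k0 = RN_deriv (\<nu> \<Otimes>\<^sub>M N) M"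
  have [measurable]: "k0 \<in> borel_measurable (\<nu> \<Otimes>\<^sub>M N)"
    unfolding k0_def by measurable
  have dens: "density (\<nu> \<Otimes>\<^sub>M N) k0 = M"
    unfolding k0_def using ac by (intro \<nu>N.density_RN_deriv) (auto intro!: sets_pair_measure_cong)
  have "(\<integral>\<^sup>+x. k0 x \<partial>(\<nu> \<Otimes>\<^sub>M N)) = (\<integral>\<^sup>+x. 1 \<partial>M)"
    unfolding dens[symmetric] by (subst nn_integral_density) auto
  also have "\<dots> < \<infinity>"
    using mass by (subst M_int) auto
  finally have "AE x in \<nu> \<Otimes>\<^sub>M N. k0 x \<noteq> \<infinity>"
    by (intro nn_integral_PInf_AE) auto
  then have fin: "AE x in \<nu> \<Otimes>\<^sub>M N. k0 x = ennreal (enn2real (k0 x))"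
    by eventually_elim (simp add: less_top)
  define k where "k z y = enn2real (k0 (z, y))" for z y
  show ?thesis
  proof (rule that[of \<nu> k])
    show "sigma_finite_measure \<nu>" by unfold_locales
    show "(\<lambda>(z, y). k z y) \<in> borel_measurable (\<nu> \<Otimes>\<^sub>M N)"
      unfolding k_def by measurable
    fix F :: "'z \<Rightarrow> real^'n \<Rightarrow> ennreal"
    assume F [measurable]: "(\<lambda>(z, y). F z y) \<in> borel_measurable (Z \<Otimes>\<^sub>M N)"
    have "(\<integral>\<^sup>+c. \<integral>\<^sup>+y. ennreal (j c y) * F (r c) y \<partial>N \<partial>\<kappa>) = (\<integral>\<^sup>+x. (case x of (z, y) \<Rightarrow> F z y) \<partial>M)"
      by (subst M_int) auto
    also have "\<dots> = (\<integral>\<^sup>+x. k0 x * (case x of (z, y) \<Rightarrow> F z y) \<partial>(\<nu> \<Otimes>\<^sub>M N))"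
      unfolding dens[symmetric] by (subst nn_integral_density) auto
    also have "\<dots> = (\<integral>\<^sup>+x. (case x of (z, y) \<Rightarrow> ennreal (k z y) * F z y) \<partial>(\<nu> \<Otimes>\<^sub>M N))"
      using fin by (intro nn_integral_cong_AE) (auto elim!: eventually_mono simp: k_def split_beta')
    also have "\<dots> = (\<integral>\<^sup>+z. \<integral>\<^sup>+y. ennreal (k z y) * F z y \<partial>N \<partial>\<nu>)"
      by (subst nn_integral_fst[symmetric]) (auto simp: k_def)
    finally show "(\<integral>\<^sup>+c. \<integral>\<^sup>+y. ennreal (j c y) * F (r c) y \<partial>N \<partial>\<kappa>) = (\<integral>\<^sup>+z. \<integral>\<^sup>+y. ennreal (k z y) * F z y \<partial>N \<partial>\<nu>)" .
  qed (simp_all add: k_def)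
qed

lemma fm_loss_pushforward:
  assumes push: "\<And>F. (\<lambda>(z, y). F z y) \<in> borel_measurable (Z \<Otimes>\<^sub>M N) \<Longrightarrow>
      (\<integral>\<^sup>+c. \<integral>\<^sup>+y. ennreal (j c y) * F (r c) y \<partial>N \<partial>\<kappa>) = (\<integral>\<^sup>+z. \<integral>\<^sup>+y. ennreal (k z y) * F z y \<partial>N \<partial>\<nu>)"
    and w: "(\<lambda>(s, y, z). w s y z) \<in> borel_measurable (borel \<Otimes>\<^sub>M borel \<Otimes>\<^sub>M Z)"
  shows "fm_loss \<kappa> N j (\<lambda>s y c. w s y (r c)) = fm_loss \<nu> N k w"
  unfolding fm_loss_def
proof (rule push)
  have [measurable]: "snd \<in> borel_measurable (Z \<Otimes>\<^sub>M N)"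
    by (rule measurable_point) measurable
  note [measurable] = measurable_compose3[OF w]
  show "(\<lambda>(z, y). \<integral>\<^sup>+u. ennreal (gauss u) *
      (\<integral>\<^sup>+s. indicator {0<..<1} s * ennreal ((norm (w s (interp s u y) z - (y - u)))\<^sup>2) \<partial>lborel) \<partial>lborel) \<in> borel_measurable (Z \<Otimes>\<^sub>M N)"
    by measurable
qed

end

section \<open>The best field that sees only the coarse variable\<close>

context observation
begin

text \<open>The minimizer is the conditional mean for the pushed-forward density \<open>k\<close>.  If it does as well as the
  conditional mean for \<open>j\<close>, then the two fields agree almost everywhere, so \<open>j c\<close> and \<open>k (r c)\<close> are
  proportional, and \<open>k (r c)\<close> only has to be normalized.\<close>

theorem coarse_minimizer:
  fixes \<kappa> :: "'c measure" and j :: "'c \<Rightarrow> real^'n \<Rightarrow> real" and Z :: "'z measure"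
  assumes \<kappa>: "sigma_finite_measure \<kappa>"
    and j [measurable]: "(\<lambda>(c, y). j c y) \<in> borel_measurable (\<kappa> \<Otimes>\<^sub>M N)" and nonneg: "\<And>c y. 0 \<le> j c y"
    and mass: "(\<integral>\<^sup>+c. \<integral>\<^sup>+y. ennreal (j c y) \<partial>N \<partial>\<kappa>) < \<infinity>"
    and r [measurable]: "r \<in> measurable \<kappa> Z"
  obtains w0 where "(\<lambda>(s, y, z). w0 s y z) \<in> borel_measurable (borel \<Otimes>\<^sub>M borel \<Otimes>\<^sub>M Z)"
    "\<And>w. (\<lambda>(s, y, z). w s y z) \<in> borel_measurable (borel \<Otimes>\<^sub>M borel \<Otimes>\<^sub>M Z) \<Longrightarrow>
      fm_loss \<kappa> N j (\<lambda>s y c. w0 s y (r c)) \<le> fm_loss \<kappa> N j (\<lambda>s y c. w s y (r c))"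
    "fm_loss \<kappa> N j (\<lambda>s y c. w0 s y (r c)) = fm_loss \<kappa> N j (opt_field N j) \<Longrightarrow>
      fm_loss \<kappa> N j (opt_field N j) < \<infinity> \<Longrightarrow>
      \<exists>k. (\<lambda>(z, y). k z y) \<in> borel_measurable (Z \<Otimes>\<^sub>M N) \<and> (\<forall>z y. 0 \<le> k z y) \<and>
        (AE c in \<kappa>. AE y in N. j c y = integral\<^sup>L N (j c) * k (r c) y)"
proof -
  obtain \<nu> k where \<nu>: "sigma_finite_measure \<nu>" and [measurable_cong]: "sets \<nu> = sets Z"
    and k: "(\<lambda>(z, y). k z y) \<in> borel_measurable (\<nu> \<Otimes>\<^sub>M N)" and k0: "\<And>z y. 0 \<le> (k z y :: real)"
    and push: "\<And>F. (\<lambda>(z, y). F z y) \<in> borel_measurable (Z \<Otimes>\<^sub>M N) \<Longrightarrow>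
      (\<integral>\<^sup>+c. \<integral>\<^sup>+y. ennreal (j c y) * F (r c) y \<partial>N \<partial>\<kappa>) = (\<integral>\<^sup>+z. \<integral>\<^sup>+y. ennreal (k z y) * F z y \<partial>N \<partial>\<nu>)"
  proof (rule pushforward_density_exists[OF \<kappa> j nonneg mass r], goal_cases)
    case (1 \<nu> k)
    show ?case by (rule 1(1)[OF 1(2-5)]) (rule 1(6))
  qed
  have "sets (\<nu> \<Otimes>\<^sub>M N) = sets (Z \<Otimes>\<^sub>M N)"
    by (intro sets_pair_measure_cong) (simp_all add: \<open>sets \<nu> = sets Z\<close>)
  then have kZ [measurable]: "(\<lambda>(z, y). k z y) \<in> borel_measurable (Z \<Otimes>\<^sub>M N)"
    using k by (simp cong: measurable_cong_sets)
  have sets3: "borel_measurable (borel \<Otimes>\<^sub>M borel \<Otimes>\<^sub>M \<nu>) = borel_measurable (borel \<Otimes>\<^sub>M borel \<Otimes>\<^sub>M Z)"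
    by (intro measurable_cong_sets sets_pair_measure_cong) (simp_all add: \<open>sets \<nu> = sets Z\<close>)
  have mass_k: "(\<integral>\<^sup>+z. \<integral>\<^sup>+y. ennreal (k z y) \<partial>N \<partial>\<nu>) < \<infinity>"
    using push[of "\<lambda>_ _. 1"] mass by simp
  have int_k: "AE z in \<nu>. integrable N (k z)"
    by (rule AE_integrable_of_finite_mass[OF k k0 mass_k])
  have int_j: "AE c in \<kappa>. integrable N (j c)"
    by (rule AE_integrable_of_finite_mass[OF j nonneg mass])
  have w0: "(\<lambda>(s, y, z). opt_field N k s y z) \<in> borel_measurable (borel \<Otimes>\<^sub>M borel \<Otimes>\<^sub>M Z)"
    using measurable_opt_field[OF kZ] .
  have pushed: "fm_loss \<kappa> N j (\<lambda>s y c. w s y (r c)) = fm_loss \<nu> N k w"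
    if "(\<lambda>(s, y, z). w s y z) \<in> borel_measurable (borel \<Otimes>\<^sub>M borel \<Otimes>\<^sub>M Z)" for w
    by (rule fm_loss_pushforward[OF _ that]) (rule push)
  \<comment> \<open>The values \<open>z\<close> at which \<open>k z\<close> cannot be normalized; they are avoided by almost all \<open>c\<close> that carry mass.\<close>
  define B where "B = {z \<in> space Z. (\<integral>\<^sup>+y. ennreal (k z y) \<partial>N) = 0 \<or> (\<integral>\<^sup>+y. ennreal (k z y) \<partial>N) = \<infinity>}"
  have [measurable]: "B \<in> sets Z"
    unfolding B_def by measurable
  have "AE z in \<nu>. (\<integral>\<^sup>+y. ennreal (k z y) * indicator B z \<partial>N) = 0"
  proof -
    have "AE z in \<nu>. (\<integral>\<^sup>+y. ennreal (k z y) \<partial>N) \<noteq> \<infinity>"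
      using mass_k by (intro nn_integral_PInf_AE) auto
    then show ?thesis
      by eventually_elim (auto simp: B_def indicator_def)
  qed
  then have "(\<integral>\<^sup>+z. \<integral>\<^sup>+y. ennreal (k z y) * indicator B z \<partial>N \<partial>\<nu>) = (\<integral>\<^sup>+z. 0 \<partial>\<nu>)"
    by (rule nn_integral_cong_AE)
  then have "(\<integral>\<^sup>+c. \<integral>\<^sup>+y. ennreal (j c y) * indicator B (r c) \<partial>N \<partial>\<kappa>) = 0"
    by (subst push) auto
  then have avoid: "AE c in \<kappa>. (\<integral>\<^sup>+y. ennreal (j c y) * indicator B (r c) \<partial>N) = 0"
    by (subst (asm) nn_integral_0_iff_AE) auto
  show ?thesis
  proof (rule that[of "opt_field N k"])
    show "(\<lambda>(s, y, z). opt_field N k s y z) \<in> borel_measurable (borel \<Otimes>\<^sub>M borel \<Otimes>\<^sub>M Z)"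
      by (rule w0)
    show "fm_loss \<kappa> N j (\<lambda>s y c. opt_field N k s y (r c)) \<le> fm_loss \<kappa> N j (\<lambda>s y c. w s y (r c))"
      if w: "(\<lambda>(s, y, z). w s y z) \<in> borel_measurable (borel \<Otimes>\<^sub>M borel \<Otimes>\<^sub>M Z)" for w
      unfolding pushed[OF w] pushed[OF w0]
      by (rule opt_field_minimal[OF k k0 _ int_k]) (simp add: sets3 w)
    assume eq: "fm_loss \<kappa> N j (\<lambda>s y c. opt_field N k s y (r c)) = fm_loss \<kappa> N j (opt_field N j)"
      and fin: "fm_loss \<kappa> N j (opt_field N j) < \<infinity>"
    have "(\<lambda>(s, y, c). opt_field N k s y (r c)) \<in> borel_measurable (borel \<Otimes>\<^sub>M borel \<Otimes>\<^sub>M \<kappa>)"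
      unfolding split_beta' by (rule measurable_compose3[OF w0]) measurable
    then have same: "AE c in \<kappa>. AE s in lborel. 0 < s \<and> s < 1 \<longrightarrow>
        (AE w in lborel. evidence N (j c) s w \<noteq> 0 \<longrightarrow> opt_field N k s w (r c) = opt_velocity N (j c) s w)"
      by (rule opt_field_unique[OF j nonneg _ int_j eq fin])
    define k' where "k' z y = k z y / integral\<^sup>L N (k z)" for z y
    have "AE c in \<kappa>. AE y in N. j c y = integral\<^sup>L N (j c) * k' (r c) y"
      using same avoid int_j AE_space
    proof eventually_elim
      case (elim c)
      note [measurable] = elim(4)
      have rc [measurable]: "r c \<in> space Z" using elim(4) by (rule measurable_space[OF r])
      show ?case
      proof (cases "r c \<in> B")
        case True
        then have "(\<integral>\<^sup>+y. ennreal (j c y) \<partial>N) = 0"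
          using elim(2) by simp
        then have "AE y in N. j c y = 0"
          by (subst (asm) nn_integral_0_iff_AE) (use nonneg in \<open>auto simp: ennreal_eq_0_iff antisym\<close>)
        moreover from this have "integral\<^sup>L N (j c) = 0"
          by (rule integral_eq_zero_AE)
        ultimately show ?thesis by simp
      next
        case False
        then have I: "(\<integral>\<^sup>+y. ennreal (k (r c) y) \<partial>N) \<noteq> 0" "(\<integral>\<^sup>+y. ennreal (k (r c) y) \<partial>N) < \<infinity>"
          using rc by (auto simp: B_def less_top)
        have int: "integrable N (k (r c))"
          by (rule integrableI_nonneg) (use I k0 in auto)
        have "ennreal (integral\<^sup>L N (k (r c))) \<noteq> 0"
          using I(1) nn_integral_eq_integral[OF int] k0 by simp
        then have pos: "integral\<^sup>L N (k (r c)) \<noteq> 0" by auto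
        have "AE y in N. integral\<^sup>L N (k (r c)) * j c y = integral\<^sup>L N (j c) * k (r c) y"
        proof (rule densities_proportional_of_opt_velocity_eq)
          show "AE s in lborel. 0 < s \<and> s < 1 \<longrightarrow>
            (AE w in lborel. evidence N (j c) s w \<noteq> 0 \<longrightarrow> opt_velocity N (j c) s w = opt_velocity N (k (r c)) s w)"
            by (rule eventually_mono[OF elim(1)]) (auto elim!: eventually_mono)
        qed (use elim int nonneg k0 in auto)
        then show ?thesis
          by eventually_elim (use pos in \<open>simp add: k'_def field_simps\<close>)
      qed
    qed
    moreover have "(\<lambda>(z, y). k' z y) \<in> borel_measurable (Z \<Otimes>\<^sub>M N)"
      unfolding k'_def by measurable
    moreover have "0 \<le> k' z y" for z y
      using k0 by (simp add: k'_def)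
    ultimately show "\<exists>k. (\<lambda>(z, y). k z y) \<in> borel_measurable (Z \<Otimes>\<^sub>M N) \<and> (\<forall>z y. 0 \<le> k z y) \<and>
        (AE c in \<kappa>. AE y in N. j c y = integral\<^sup>L N (j c) * k (r c) y)"
      by blast
  qed
qed

end

section \<open>Lebesgue measurable data and Borel fields\<close>

lemma observation_lebesgue_on:
  fixes X :: "(real^'n) set"
  assumes X: "X \<in> sets lebesgue"
  shows "observation (lebesgue_on X)"
proof -
  interpret leb: sigma_finite_measure "lebesgue :: (real^'n) measure"
  proof
    obtain A :: "(real^'n) set set" where "countable A" "A \<subseteq> sets lborel" "\<Union>A = UNIV" "\<forall>a\<in>A. emeasure lborel a \<noteq> \<infinity>"
      using lborel.sigma_finite_countable by auto
    then show "\<exists>A. countable A \<and> A \<subseteq> sets lebesgue \<and> \<Union>A = space (lebesgue :: (real^'n) measure) \<and> (\<forall>a\<in>A. emeasure lebesgue a \<noteq> \<infinity>)"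
      by (intro exI[of _ A]) (auto simp: subset_iff)
  qed
  interpret sigma_finite_measure "lebesgue_on X"
    by (rule sigma_finite_measure_restrict_space[OF leb.sigma_finite_measure_axioms X])
  show ?thesis
  proof
    show "(\<lambda>y. y) \<in> borel_measurable (lebesgue_on X)"
      by (intro measurable_restrict_space1 measurable_completion) simp
  next
    fix A assume "A \<in> sets (lebesgue_on X)"
    then have "A \<in> sets lebesgue"
      using X by (simp add: sets_restrict_space_iff)
    then obtain S Z Z' where *: "A = S \<union> Z" "Z \<subseteq> Z'" "Z' \<in> null_sets lborel" "S \<in> sets lborel"
      by (rule sets_completionE)
    have "AE y in lebesgue. y \<notin> Z'"
      using AE_not_in[OF *(3)] by (rule AE_completion)
    then have "AE y in lebesgue_on X. y \<notin> Z'"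
      using X by (subst AE_restrict_space_iff) (auto elim!: eventually_mono)
    then have "AE y in lebesgue_on X. y \<in> A \<longleftrightarrow> y \<in> S"
      using * by (auto elim!: eventually_mono)
    then show "\<exists>B\<in>sets borel. AE y in lebesgue_on X. y \<in> A \<longleftrightarrow> y \<in> B"
      using *(4) by auto
  qed
qed

context observation
begin

text \<open>The sets with this property form a \<open>\<sigma>\<close>-algebra that contains the rectangles.\<close>

lemma borel_version_set:
  assumes "A \<in> sets (N \<Otimes>\<^sub>M N')"
  shows "\<exists>G\<in>sets (borel \<Otimes>\<^sub>M N'). AE x in N. \<forall>y\<in>space N'. (x, y) \<in> A \<longleftrightarrow> (x, y) \<in> G"
proof -
  have "A \<in> sigma_sets (space N \<times> space N') {a \<times> b | a b. a \<in> sets N \<and> b \<in> sets N'}"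
    using assms by (simp add: sets_pair_measure)
  then show ?thesis
  proof induction
    case (Basic E)
    then obtain a b where E: "E = a \<times> b" "a \<in> sets N" "b \<in> sets N'" by auto
    then obtain B where "B \<in> sets borel" "AE x in N. x \<in> a \<longleftrightarrow> x \<in> B"
      using borel_up_to_null by blast
    then show ?case
      using E by (intro bexI[of _ "B \<times> b"]) (auto elim!: eventually_mono)
  next
    case Empty
    show ?case by (intro bexI[of _ "{}"]) auto
  next
    case (Compl E)
    then obtain G where G: "G \<in> sets (borel \<Otimes>\<^sub>M N')" "AE x in N. \<forall>y\<in>space N'. (x, y) \<in> E \<longleftrightarrow> (x, y) \<in> G"
      by blast
    have "AE x in N. \<forall>y\<in>space N'. (x, y) \<in> space N \<times> space N' - E \<longleftrightarrow> (x, y) \<in> space (borel \<Otimes>\<^sub>M N') - G"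
      using G(2) AE_space by eventually_elim (auto simp: space_pair_measure)
    then show ?case
      using G(1) by (intro bexI[of _ "space (borel \<Otimes>\<^sub>M N') - G"]) auto
  next
    case (Union E)
    then have "\<forall>i. \<exists>G. G \<in> sets (borel \<Otimes>\<^sub>M N') \<and> (AE x in N. \<forall>y\<in>space N'. (x, y) \<in> E i \<longleftrightarrow> (x, y) \<in> G)"
      by blast
    from choice[OF this] obtain G where G: "\<And>i. G i \<in> sets (borel \<Otimes>\<^sub>M N')"
      "\<And>i. AE x in N. \<forall>y\<in>space N'. (x, y) \<in> E i \<longleftrightarrow> (x, y) \<in> G i"
      by auto
    have "AE x in N. \<forall>i. \<forall>y\<in>space N'. (x, y) \<in> E i \<longleftrightarrow> (x, y) \<in> G i"
      by (intro AE_all_countable[THEN iffD2] allI G(2))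
    then show ?case
      using G(1) by (intro bexI[of _ "\<Union>i. G i"]) (auto elim!: eventually_mono)
  qed
qed

text \<open>Needed because vector fields are Borel while the densities are only Lebesgue measurable: the optimal
  field of a Borel version of the density is a Borel field.\<close>

lemma borel_version:
  fixes f :: "(real^'n) \<times> 'b \<Rightarrow> ennreal"
  assumes "f \<in> borel_measurable (N \<Otimes>\<^sub>M N')"
  shows "\<exists>g\<in>borel_measurable (borel \<Otimes>\<^sub>M N'). AE x in N. \<forall>y\<in>space N'. f (x, y) = g (x, y)"
  using assms
proof (induction rule: borel_measurable_induct)
  case (cong f g)
  then obtain h where h: "h \<in> borel_measurable (borel \<Otimes>\<^sub>M N')" "AE x in N. \<forall>y\<in>space N'. g (x, y) = h (x, y)"
    by blast
  have "AE x in N. \<forall>y\<in>space N'. f (x, y) = h (x, y)"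
    using h(2) AE_space by eventually_elim (use cong(3) in \<open>auto simp: space_pair_measure\<close>)
  with h(1) show ?case by blast
next
  case (set A)
  then obtain G where "G \<in> sets (borel \<Otimes>\<^sub>M N')" "AE x in N. \<forall>y\<in>space N'. (x, y) \<in> A \<longleftrightarrow> (x, y) \<in> G"
    using borel_version_set by blast
  then show ?case
    by (intro bexI[of _ "indicator G"]) (auto elim!: eventually_mono simp: indicator_def)
next
  case (mult u c)
  then obtain g where "g \<in> borel_measurable (borel \<Otimes>\<^sub>M N')" "AE x in N. \<forall>y\<in>space N'. u (x, y) = g (x, y)"
    by blast
  then show ?case
    by (intro bexI[of _ "\<lambda>x. c * g x"]) (auto elim!: eventually_mono)
next
  case (add u v)
  then obtain g h where "g \<in> borel_measurable (borel \<Otimes>\<^sub>M N')" "AE x in N. \<forall>y\<in>space N'. u (x, y) = g (x, y)"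
    "h \<in> borel_measurable (borel \<Otimes>\<^sub>M N')" "AE x in N. \<forall>y\<in>space N'. v (x, y) = h (x, y)"
    by blast
  moreover from this(2,4) have "AE x in N. \<forall>y\<in>space N'. v (x, y) + u (x, y) = h (x, y) + g (x, y)"
    by eventually_elim auto
  ultimately show ?case
    by (intro bexI[of _ "\<lambda>x. h x + g x"]) auto
next
  case (seq U)
  then have "\<forall>i. \<exists>G. G \<in> borel_measurable (borel \<Otimes>\<^sub>M N') \<and> (AE x in N. \<forall>y\<in>space N'. U i (x, y) = G (x, y))"
    by blast
  from choice[OF this] obtain G where G: "\<And>i. G i \<in> borel_measurable (borel \<Otimes>\<^sub>M N')"
    "\<And>i. AE x in N. \<forall>y\<in>space N'. U i (x, y) = G i (x, y)"
    by auto
  have "AE x in N. \<forall>i. \<forall>y\<in>space N'. U i (x, y) = G i (x, y)"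
    by (intro AE_all_countable[THEN iffD2] allI G(2))
  then have "AE x in N. \<forall>y\<in>space N'. (SUP i. U i) (x, y) = (SUP i. G i (x, y))"
    by eventually_elim (auto simp: image_image)
  moreover have "(\<lambda>x. SUP i. G i x) \<in> borel_measurable (borel \<Otimes>\<^sub>M N')"
    using G(1) by measurable
  ultimately show ?case by (intro bexI[of _ "\<lambda>x. SUP i. G i x"]) auto
qed

end

lemma vector_fields_iff:
  "v \<in> vector_fields \<longleftrightarrow> (\<lambda>(s, y, c). v s y c) \<in> borel_measurable (borel \<Otimes>\<^sub>M borel \<Otimes>\<^sub>M borel)"
  by (simp add: vector_fields_def borel_prod)

text \<open>All that the theorem needs about one of the two losses: \<open>v0\<close> is the optimal field for a Borel version
  of the density, \<open>w0\<close> the optimal field that sees only \<open>r c\<close>.\<close>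

lemma fine_and_coarse_minimizers:
  fixes X :: "(real^'n) set" and j :: "real^'n \<Rightarrow> real^'n \<Rightarrow> real" and r :: "real^'n \<Rightarrow> real^'d"
  assumes X: "X \<in> sets lebesgue"
    and j [measurable]: "(\<lambda>(c, y). j c y) \<in> borel_measurable (lebesgue_on X \<Otimes>\<^sub>M lebesgue_on X)"
    and nonneg: "\<And>c y. 0 \<le> j c y"
    and mass: "(\<integral>\<^sup>+c. \<integral>\<^sup>+y. ennreal (j c y) \<partial>lebesgue_on X \<partial>lebesgue_on X) < \<infinity>"
    and r [measurable]: "r \<in> borel_measurable (lebesgue_on X)"
  defines "L \<equiv> fm_loss (lebesgue_on X) (lebesgue_on X) j"
  obtains v0 :: "real \<Rightarrow> real^'n \<Rightarrow> real^'n \<Rightarrow> real^'n" and w0 :: "real \<Rightarrow> real^'n \<Rightarrow> real^'d \<Rightarrow> real^'n"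
  where "v0 \<in> vector_fields" "w0 \<in> vector_fields"
    "\<And>v. v \<in> vector_fields \<Longrightarrow> L v0 \<le> L v"
    "\<And>w. w \<in> vector_fields \<Longrightarrow> L (\<lambda>s y c. w0 s y (r c)) \<le> L (\<lambda>s y c. w s y (r c))"
    "L v0 \<le> L (\<lambda>s y c. w0 s y (r c))"
    "L (\<lambda>s y c. w0 s y (r c)) = L v0 \<Longrightarrow> L v0 < \<infinity> \<Longrightarrow>
      \<exists>k. (\<lambda>(z, y). k z y) \<in> borel_measurable (borel \<Otimes>\<^sub>M lebesgue_on X) \<and> (\<forall>z y. 0 \<le> k z y) \<and>
        (AE c in lebesgue_on X. AE y in lebesgue_on X. j c y = integral\<^sup>L (lebesgue_on X) (j c) * k (r c) y)"
    "\<And>a k. (\<lambda>(z, y). k z y) \<in> borel_measurable (borel \<Otimes>\<^sub>M lebesgue_on X) \<Longrightarrow>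
      (AE c in lebesgue_on X. AE y in lebesgue_on X. j c y = a c * k (r c) y) \<Longrightarrow>
      L (\<lambda>s y c. w0 s y (r c)) = L v0"
proof -
  interpret observation "lebesgue_on X" by (rule observation_lebesgue_on[OF X])
  let ?N = "lebesgue_on X"
  have sf: "sigma_finite_measure ?N" by unfold_locales
  have int: "AE c in ?N. integrable ?N (j c)"
    by (rule AE_integrable_of_finite_mass[OF j nonneg mass])
  obtain g where g: "g \<in> borel_measurable (borel \<Otimes>\<^sub>M ?N)"
    and jg: "AE c in ?N. \<forall>y\<in>space ?N. (case (c, y) of (c, y) \<Rightarrow> ennreal (j c y)) = g (c, y)"
    using borel_version[of "\<lambda>(c, y). ennreal (j c y)" ?N] by auto
  \<comment> \<open>A Borel version of the density, and the Borel field that is optimal for it.\<close>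
  define j' where "j' c y = enn2real (g (c, y))" for c y
  have j' [measurable]: "(\<lambda>(c, y). j' c y) \<in> borel_measurable (borel \<Otimes>\<^sub>M ?N)"
    using g unfolding j'_def by measurable
  define v0 where "v0 = opt_field ?N j'"
  have v0: "v0 \<in> vector_fields"
    unfolding v0_def vector_fields_iff using measurable_opt_field[OF j'] .
  have pull: "(\<lambda>(s, y, c). w s y (f c)) \<in> borel_measurable (borel \<Otimes>\<^sub>M borel \<Otimes>\<^sub>M ?N)"
    if "w \<in> vector_fields" and [measurable]: "f \<in> borel_measurable ?N"
    for w :: "real \<Rightarrow> real^'n \<Rightarrow> real^'e \<Rightarrow> real^'n" and f
    unfolding split_beta' by (rule measurable_compose3[OF that(1)[unfolded vector_fields_iff]]) measurable
  have "AE c in ?N. AE y in ?N. j c y = 1 * j' c y"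
    using jg
  proof eventually_elim
    case (elim c)
    show ?case
    proof (rule AE_I2)
      fix y assume "y \<in> space ?N"
      then have "g (c, y) = ennreal (j c y)" using elim by simp
      then show "j c y = 1 * j' c y"
        using nonneg by (simp add: j'_def)
    qed
  qed
  then have Lv0: "L v0 = L (opt_field ?N j)"
    unfolding L_def v0_def
    by (intro opt_field_of_proportional_density[OF j nonneg, where r="\<lambda>c. c" and k=j' and a="\<lambda>_. 1"])
      (use pull[OF v0 point] int in \<open>auto simp: v0_def\<close>)
  obtain w0 :: "real \<Rightarrow> real^'n \<Rightarrow> real^'d \<Rightarrow> real^'n" where w0: "w0 \<in> vector_fields"
    and w0_min: "\<And>w. w \<in> vector_fields \<Longrightarrow> L (\<lambda>s y c. w0 s y (r c)) \<le> L (\<lambda>s y c. w s y (r c))"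
    and w0_fac: "L (\<lambda>s y c. w0 s y (r c)) = L (opt_field ?N j) \<Longrightarrow> L (opt_field ?N j) < \<infinity> \<Longrightarrow>
      \<exists>k. (\<lambda>(z, y). k z y) \<in> borel_measurable (borel \<Otimes>\<^sub>M ?N) \<and> (\<forall>z y. 0 \<le> k z y) \<and>
        (AE c in ?N. AE y in ?N. j c y = integral\<^sup>L ?N (j c) * k (r c) y)"
  proof (rule coarse_minimizer[OF sf j nonneg mass r], goal_cases)
    case (1 w0)
    show ?case
      by (rule 1(1)[of w0]) (use 1(2-) in \<open>auto simp: vector_fields_iff L_def\<close>)
  qed
  show ?thesis
  proof (rule that[OF v0 w0])
    show "L v0 \<le> L v" if "v \<in> vector_fields" for v
      unfolding Lv0 unfolding L_def by (rule opt_field_minimal[OF j nonneg pull[OF that point] int])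
    show "L (\<lambda>s y c. w0 s y (r c)) \<le> L (\<lambda>s y c. w s y (r c))" if "w \<in> vector_fields" for w
      by (rule w0_min[OF that])
    show le: "L v0 \<le> L (\<lambda>s y c. w0 s y (r c))"
      unfolding Lv0 unfolding L_def by (rule opt_field_minimal[OF j nonneg pull[OF w0 r] int])
    show "\<exists>k. (\<lambda>(z, y). k z y) \<in> borel_measurable (borel \<Otimes>\<^sub>M ?N) \<and> (\<forall>z y. 0 \<le> k z y) \<and>
        (AE c in ?N. AE y in ?N. j c y = integral\<^sup>L ?N (j c) * k (r c) y)"
      if "L (\<lambda>s y c. w0 s y (r c)) = L v0" "L v0 < \<infinity>"
      using that unfolding Lv0 by (rule w0_fac)
    show "L (\<lambda>s y c. w0 s y (r c)) = L v0"
      if k [measurable]: "(\<lambda>(z, y). k z y) \<in> borel_measurable (borel \<Otimes>\<^sub>M ?N)"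
        and fac: "AE c in ?N. AE y in ?N. j c y = a c * k (r c) y" for a k
    proof (rule antisym[OF _ le])
      have kf: "opt_field ?N k \<in> vector_fields"
        unfolding vector_fields_iff using measurable_opt_field[OF k] .
      have "L (\<lambda>s y c. opt_field ?N k s y (r c)) = L v0"
        unfolding Lv0 unfolding L_def
        by (rule opt_field_of_proportional_density[where k=k and r=r and a=a, OF j nonneg pull[OF kf r] _ int fac]) simp
      then show "L (\<lambda>s y c. w0 s y (r c)) \<le> L v0"
        using w0_min[OF kf] by simp
    qed
  qed
qed

section \<open>The two losses\<close>

lemma sets_std_gaussian [measurable_cong, simp]: "sets std_gaussian = sets borel"
  by (simp add: std_gaussian_def)

lemma nn_integral_std_gaussian:
  assumes "f \<in> borel_measurable borel"
  shows "(\<integral>\<^sup>+u. f u \<partial>std_gaussian) = (\<integral>\<^sup>+u. ennreal (gauss u) * f u \<partial>lborel)"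
  unfolding std_gaussian_def gauss_def[symmetric] using assms by (subst nn_integral_density) auto

lemma prob_space_std_gaussian: "prob_space (std_gaussian :: (real^'n) measure)"
proof
  show "emeasure std_gaussian (space (std_gaussian :: (real^'n) measure)) = 1"
    using nn_integral_std_gaussian[of "\<lambda>_::real^'n. 1"] by (simp add: nn_integral_gauss)
qed

lemma nn_integral_unit_uniform:
  assumes [measurable]: "f \<in> borel_measurable borel"
  shows "(\<integral>\<^sup>+s. f s \<partial>uniform_measure lborel {0<..<1::real}) = (\<integral>\<^sup>+s. indicator {0<..<1} s * f s \<partial>lborel)"
  by (simp add: nn_integral_uniform_measure mult.commute divide_ennreal_def)

text \<open>Tonelli for the data pair, the two noises and the time \<open>s\<close>.  The absolute value changes nothing on \<open>X \<times> X\<close>; it makes the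
  density nonnegative at all points, also at those off \<open>X\<close>.\<close>

lemma nn_integral_sample_law:
  fixes X :: "(real^'n) set"
  assumes X: "X \<in> sets lebesgue"
    and \<rho>0 [measurable]: "\<rho>0 \<in> borel_measurable (lebesgue_on X)"
    and p [measurable]: "(\<lambda>(x, y). p x y) \<in> borel_measurable (lebesgue_on X \<Otimes>\<^sub>M lebesgue_on X)"
    and nonneg: "\<And>x y. x \<in> X \<Longrightarrow> y \<in> X \<Longrightarrow> 0 \<le> \<rho>0 x * p x y"
    and f [measurable]: "(\<lambda>((x, y), (x', y'), s). f x y x' y' s) \<in> borel_measurable
      ((lebesgue_on X \<Otimes>\<^sub>M lebesgue_on X) \<Otimes>\<^sub>M (borel \<Otimes>\<^sub>M borel) \<Otimes>\<^sub>M borel)"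
  shows "(\<integral>\<^sup>+((x, y), (x', y'), s). f x y x' y' s \<partial>sample_law X \<rho>0 p) =
    (\<integral>\<^sup>+x. \<integral>\<^sup>+y. ennreal \<bar>\<rho>0 x * p x y\<bar> * (\<integral>\<^sup>+x'. ennreal (gauss x') * (\<integral>\<^sup>+y'. ennreal (gauss y') *
      (\<integral>\<^sup>+s. indicator {0<..<1} s * f x y x' y' s \<partial>lborel) \<partial>lborel) \<partial>lborel) \<partial>lebesgue_on X \<partial>lebesgue_on X)"
proof -
  let ?L = "lebesgue_on X" and ?U = "uniform_measure lborel {0<..<1::real}"
  let ?G = "std_gaussian :: (real^'n) measure"
  interpret L: observation ?L by (rule observation_lebesgue_on[OF X])
  interpret G: prob_space ?G by (rule prob_space_std_gaussian)
  interpret U: prob_space ?U by (rule prob_space_uniform_measure) auto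
  interpret LL: pair_sigma_finite ?L ?L ..
  interpret GG: pair_sigma_finite ?G ?G ..
  interpret GGU: pair_sigma_finite "?G \<Otimes>\<^sub>M ?G" ?U ..
  have "sets (sample_law X \<rho>0 p) = sets ((?L \<Otimes>\<^sub>M ?L) \<Otimes>\<^sub>M (borel \<Otimes>\<^sub>M borel) \<Otimes>\<^sub>M borel)"
    unfolding sample_law_def joint_law_def by (intro sets_pair_measure_cong) auto
  then have F: "(\<lambda>((x, y), (x', y'), s). f x y x' y' s) \<in> borel_measurable (joint_law X \<rho>0 p \<Otimes>\<^sub>M ((?G \<Otimes>\<^sub>M ?G) \<Otimes>\<^sub>M ?U))"
    unfolding sample_law_def[symmetric] using f by (simp cong: measurable_cong_sets)
  have fm [measurable]: "(\<lambda>z. f (a z) (b z) (a' z) (b' z) (c z)) \<in> borel_measurable M"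
    if [measurable]: "a \<in> measurable M ?L" "b \<in> measurable M ?L" "a' \<in> borel_measurable M" "b' \<in> borel_measurable M"
      "c \<in> borel_measurable M" for a b a' b' c and M :: "'z measure"
  proof -
    have "(\<lambda>z. ((a z, b z), (a' z, b' z), c z)) \<in> measurable M ((?L \<Otimes>\<^sub>M ?L) \<Otimes>\<^sub>M (borel \<Otimes>\<^sub>M borel) \<Otimes>\<^sub>M borel)"
      by measurable
    from measurable_compose[OF this f] show ?thesis by simp
  qed
  have "(\<integral>\<^sup>+((x, y), (x', y'), s). f x y x' y' s \<partial>sample_law X \<rho>0 p) =
      (\<integral>\<^sup>+(x, y). (\<integral>\<^sup>+((x', y'), s). f x y x' y' s \<partial>((?G \<Otimes>\<^sub>M ?G) \<Otimes>\<^sub>M ?U)) \<partial>joint_law X \<rho>0 p)"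
    unfolding sample_law_def
    by (subst GGU.P.nn_integral_fst[OF F, symmetric]) (simp add: split_beta')
  also have "\<dots> = (\<integral>\<^sup>+(x, y). ennreal (\<rho>0 x * p x y) * (\<integral>\<^sup>+((x', y'), s). f x y x' y' s \<partial>((?G \<Otimes>\<^sub>M ?G) \<Otimes>\<^sub>M ?U)) \<partial>(?L \<Otimes>\<^sub>M ?L))"
    unfolding joint_law_def by (subst nn_integral_density) (auto simp: split_beta')
  also have "\<dots> = (\<integral>\<^sup>+x. \<integral>\<^sup>+y. ennreal (\<rho>0 x * p x y) * (\<integral>\<^sup>+((x', y'), s). f x y x' y' s \<partial>((?G \<Otimes>\<^sub>M ?G) \<Otimes>\<^sub>M ?U)) \<partial>?L \<partial>?L)"
    by (subst L.nn_integral_fst[symmetric]) (simp_all add: split_beta')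
  also have "\<dots> = (\<integral>\<^sup>+x. \<integral>\<^sup>+y. ennreal \<bar>\<rho>0 x * p x y\<bar> * (\<integral>\<^sup>+x'. ennreal (gauss x') * (\<integral>\<^sup>+y'. ennreal (gauss y') *
      (\<integral>\<^sup>+s. indicator {0<..<1} s * f x y x' y' s \<partial>lborel) \<partial>lborel) \<partial>lborel) \<partial>?L \<partial>?L)"
  proof (intro nn_integral_cong)
    fix x y assume xy [measurable]: "x \<in> space ?L" "y \<in> space ?L"
    have "(\<integral>\<^sup>+((x', y'), s). f x y x' y' s \<partial>((?G \<Otimes>\<^sub>M ?G) \<Otimes>\<^sub>M ?U)) = (\<integral>\<^sup>+(x', y'). \<integral>\<^sup>+s. f x y x' y' s \<partial>?U \<partial>(?G \<Otimes>\<^sub>M ?G))"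
      by (subst U.nn_integral_fst[symmetric]) (auto simp: split_beta')
    also have "\<dots> = (\<integral>\<^sup>+x'. \<integral>\<^sup>+y'. \<integral>\<^sup>+s. f x y x' y' s \<partial>?U \<partial>?G \<partial>?G)"
      by (subst G.nn_integral_fst[symmetric]) auto
    also have "\<dots> = (\<integral>\<^sup>+x'. ennreal (gauss x') * (\<integral>\<^sup>+y'. ennreal (gauss y') *
      (\<integral>\<^sup>+s. indicator {0<..<1} s * f x y x' y' s \<partial>lborel) \<partial>lborel) \<partial>lborel)"
      by (simp add: nn_integral_std_gaussian nn_integral_unit_uniform)
    finally show "ennreal (\<rho>0 x * p x y) * (\<integral>\<^sup>+((x', y'), s). f x y x' y' s \<partial>((?G \<Otimes>\<^sub>M ?G) \<Otimes>\<^sub>M ?U)) =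
        ennreal \<bar>\<rho>0 x * p x y\<bar> * (\<integral>\<^sup>+x'. ennreal (gauss x') * (\<integral>\<^sup>+y'. ennreal (gauss y') *
      (\<integral>\<^sup>+s. indicator {0<..<1} s * f x y x' y' s \<partial>lborel) \<partial>lborel) \<partial>lborel)"
      using nonneg[of x y] xy by simp
  qed
  finally show ?thesis .
qed

context
  fixes X :: "(real^'n) set" and \<rho>0 :: "real^'n \<Rightarrow> real" and p :: "real^'n \<Rightarrow> real^'n \<Rightarrow> real"
  assumes X: "X \<in> sets lebesgue"
    and \<rho>0 [measurable]: "\<rho>0 \<in> borel_measurable (lebesgue_on X)"
    and p [measurable]: "(\<lambda>(x, y). p x y) \<in> borel_measurable (lebesgue_on X \<Otimes>\<^sub>M lebesgue_on X)"
    and nonneg: "\<And>x y. x \<in> X \<Longrightarrow> y \<in> X \<Longrightarrow> 0 \<le> \<rho>0 x * p x y"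
begin

lemma loss0_eq_fm_loss:
  assumes v: "(\<lambda>(s, w, c). v s w c) \<in> borel_measurable (borel \<Otimes>\<^sub>M borel \<Otimes>\<^sub>M lebesgue_on X)"
  shows "loss0 X \<rho>0 p v = fm_loss (lebesgue_on X) (lebesgue_on X) (\<lambda>x y. \<bar>\<rho>0 x * p x y\<bar>) v"
proof -
  let ?L = "lebesgue_on X"
  interpret L: observation ?L by (rule observation_lebesgue_on[OF X])
  let ?S = "(?L \<Otimes>\<^sub>M ?L) \<Otimes>\<^sub>M ((borel :: (real^'n) measure) \<Otimes>\<^sub>M (borel :: (real^'n) measure)) \<Otimes>\<^sub>M (borel :: real measure)"
  have [measurable]: "(\<lambda>z. snd (fst z)) \<in> borel_measurable ?S"
    by (rule L.measurable_point) measurable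
  note [measurable] = measurable_compose3[OF v]
  have "loss0 X \<rho>0 p v = (\<integral>\<^sup>+x. \<integral>\<^sup>+y. ennreal \<bar>\<rho>0 x * p x y\<bar> * (\<integral>\<^sup>+x'. ennreal (gauss (x'::real^'n)) * (\<integral>\<^sup>+y'. ennreal (gauss y') *
      (\<integral>\<^sup>+s. indicator {0<..<1} s * ennreal ((norm (v s (interp s y' y) x - (y - y')))\<^sup>2) \<partial>lborel) \<partial>lborel) \<partial>lborel) \<partial>?L \<partial>?L)"
    unfolding loss0_def by (rule nn_integral_sample_law[OF X \<rho>0 p nonneg]) (unfold split_beta', measurable)
  also have "\<dots> = fm_loss ?L ?L (\<lambda>x y. \<bar>\<rho>0 x * p x y\<bar>) v"
    unfolding fm_loss_def by (simp add: nn_integral_multc nn_integral_gauss)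
  finally show ?thesis .
qed

text \<open>The reverse-time loss has the same form with the roles of the two points exchanged.\<close>

lemma loss1_eq_fm_loss:
  assumes v: "(\<lambda>(s, w, c). v s w c) \<in> borel_measurable (borel \<Otimes>\<^sub>M borel \<Otimes>\<^sub>M lebesgue_on X)"
  shows "loss1 X \<rho>0 p v = fm_loss (lebesgue_on X) (lebesgue_on X) (\<lambda>y x. \<bar>\<rho>0 x * p x y\<bar>) v"
proof -
  let ?L = "lebesgue_on X"
  interpret L: observation ?L by (rule observation_lebesgue_on[OF X])
  interpret LL: pair_sigma_finite ?L ?L ..
  let ?S = "(?L \<Otimes>\<^sub>M ?L) \<Otimes>\<^sub>M ((borel :: (real^'n) measure) \<Otimes>\<^sub>M (borel :: (real^'n) measure)) \<Otimes>\<^sub>M (borel :: real measure)"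
  note [measurable] = measurable_compose3[OF v]
  have [measurable]: "(\<lambda>z. fst (fst z)) \<in> borel_measurable ?S"
    by (rule L.measurable_point) measurable
  have "loss1 X \<rho>0 p v = (\<integral>\<^sup>+x. \<integral>\<^sup>+y. ennreal \<bar>\<rho>0 x * p x y\<bar> * (\<integral>\<^sup>+x'. ennreal (gauss x') * (\<integral>\<^sup>+y'. ennreal (gauss (y'::real^'n)) *
      (\<integral>\<^sup>+s. indicator {0<..<1} s * ennreal ((norm (v s (interp s x' x) y - (x - x')))\<^sup>2) \<partial>lborel) \<partial>lborel) \<partial>lborel) \<partial>?L \<partial>?L)"
    unfolding loss1_def by (rule nn_integral_sample_law[OF X \<rho>0 p nonneg]) (unfold split_beta', measurable)
  also have "\<dots> = (\<integral>\<^sup>+x. \<integral>\<^sup>+y. ennreal \<bar>\<rho>0 x * p x y\<bar> * (\<integral>\<^sup>+x'. ennreal (gauss x') *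
      (\<integral>\<^sup>+s. indicator {0<..<1} s * ennreal ((norm (v s (interp s x' x) y - (x - x')))\<^sup>2) \<partial>lborel) \<partial>lborel) \<partial>?L \<partial>?L)"
    by (simp add: nn_integral_multc nn_integral_gauss)
  also have "\<dots> = fm_loss ?L ?L (\<lambda>y x. \<bar>\<rho>0 x * p x y\<bar>) v"
    unfolding fm_loss_def
  proof (rule LL.Fubini'[symmetric])
    have [measurable]: "fst \<in> borel_measurable (?L \<Otimes>\<^sub>M ?L)"
      by (rule L.measurable_point) measurable
    show "(\<lambda>(x, y). ennreal \<bar>\<rho>0 x * p x y\<bar> * (\<integral>\<^sup>+u. ennreal (gauss u) *
      (\<integral>\<^sup>+s. indicator {0<..<1} s * ennreal ((norm (v s (interp s u x) y - (x - u)))\<^sup>2) \<partial>lborel) \<partial>lborel)) \<in> borel_measurable (?L \<Otimes>\<^sub>M ?L)"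
      by measurable
  qed
  finally show ?thesis .
qed

end

text \<open>A Lebesgue measurable set is a countable union of compact sets up to a null set, and the continuous
  image of such a union is Borel.  The image of the whole set need not be.\<close>

lemma continuous_image_conull_borel:
  fixes X :: "'a::euclidean_space set" and r :: "'a \<Rightarrow> 'b::euclidean_space"
  assumes X: "X \<in> sets lebesgue" and r: "continuous_on X r"
  obtains X0 where "X0 \<subseteq> X" "AE x in lebesgue_on X. x \<in> X0" "r ` X0 \<in> sets borel"
proof -
  obtain C T where CT: "fsigma C" "T \<in> null_sets lebesgue" "C \<union> T = X" "disjnt C T"
    using lebesgue_set_almost_fsigma[OF X] .
  then obtain F :: "nat \<Rightarrow> 'a set" where F: "\<And>n. compact (F n)" "C = (\<Union>n. F n)"
    by (auto simp: fsigma_Union_compact image_subset_iff)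
  show ?thesis
  proof (rule that[of C])
    show "C \<subseteq> X" using CT by auto
    have "AE x in lebesgue. x \<notin> T"
      using CT(2) by (rule AE_not_in)
    then show "AE x in lebesgue_on X. x \<in> C"
      using X CT(3) by (subst AE_restrict_space_iff) (auto elim!: eventually_mono)
    have "compact (r ` F n)" for n
      using F CT by (intro compact_continuous_image continuous_on_subset[OF r]) auto
    then have "closed (r ` F n)" for n
      by (rule compact_imp_closed)
    then show "r ` C \<in> sets borel"
      by (auto simp: F(2) image_UN)
  qed
qed

text \<open>A function given on a possibly non-Borel set extends measurably from any Borel subset of it, by zero.\<close>

lemma borel_measurable_extend_fst:
  fixes f :: "'a::topological_space \<Rightarrow> 'b \<Rightarrow> real"
  assumes f: "(\<lambda>(z, y). f z y) \<in> borel_measurable (restrict_space borel S \<Otimes>\<^sub>M M)"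
    and S0: "S0 \<in> sets borel" "S0 \<subseteq> S"
  shows "(\<lambda>(z, y). indicator S0 z * f z y) \<in> borel_measurable (borel \<Otimes>\<^sub>M M)"
proof -
  let ?R = "restrict_space (borel \<Otimes>\<^sub>M M) (S0 \<times> space M)"
  have fst: "fst \<in> measurable ?R (restrict_space borel S)"
    using S0(2) by (intro measurable_restrict_space2 measurable_restrict_space1) (auto simp: space_restrict_space space_pair_measure)
  have snd: "snd \<in> measurable ?R M"
    by (intro measurable_restrict_space1) measurable
  have "(\<lambda>(z, y). f z y) \<in> borel_measurable ?R"
    using measurable_compose[OF measurable_Pair[OF fst snd] f] by (simp add: split_beta')
  then have "(\<lambda>x. indicator (S0 \<times> space M) x *\<^sub>R (case x of (z, y) \<Rightarrow> f z y)) \<in> borel_measurable (borel \<Otimes>\<^sub>M M)"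
    using S0(1) by (subst (asm) borel_measurable_restrict_space_iff) auto
  then show ?thesis
    by (rule measurable_cong[THEN iffD1, rotated]) (auto simp: space_pair_measure indicator_def)
qed

section \<open>Lumpability and decomposability as factorizations\<close>

locale transition_data =
  fixes X :: "(real^'n) set" and \<rho>0 :: "real^'n \<Rightarrow> real" and p :: "real^'n \<Rightarrow> real^'n \<Rightarrow> real"
    and r :: "real^'n \<Rightarrow> real^'d"
  assumes X: "X \<in> sets lebesgue" and dens: "prob_density_on X \<rho>0" and trans: "transition_density_on X p"
    and cont: "continuous_on X r"
begin

abbreviation "L \<equiv> lebesgue_on X"
abbreviation "j0 \<equiv> \<lambda>x y. \<bar>\<rho>0 x * p x y\<bar>"
abbreviation "j1 \<equiv> \<lambda>y x. \<bar>\<rho>0 x * p x y\<bar>"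

sublocale observation L
  by (rule observation_lebesgue_on[OF X])

sublocale LL: pair_sigma_finite L L ..

lemma \<rho>0_measurable [measurable]: "\<rho>0 \<in> borel_measurable L"
  and \<rho>0_nonneg: "x \<in> X \<Longrightarrow> 0 \<le> \<rho>0 x"
  and \<rho>0_mass: "(\<integral>\<^sup>+x. ennreal (\<rho>0 x) \<partial>L) = 1"
  using dens by (auto simp: prob_density_on_def)

lemma p_measurable [measurable]: "(\<lambda>(x, y). p x y) \<in> borel_measurable (L \<Otimes>\<^sub>M L)"
  and p_nonneg: "x \<in> X \<Longrightarrow> y \<in> X \<Longrightarrow> 0 \<le> p x y"
  and p_mass: "x \<in> X \<Longrightarrow> (\<integral>\<^sup>+y. ennreal (p x y) \<partial>L) = 1"
  using trans by (auto simp: transition_density_on_def)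

lemma r_measurable [measurable]: "r \<in> borel_measurable L"
  by (rule continuous_imp_measurable_on_sets_lebesgue[OF cont X])

lemma r_measurable_range [measurable]: "r \<in> measurable L (restrict_space borel (r ` X))"
  by (intro measurable_restrict_space2 r_measurable) auto

lemma abs_joint [simp]: "x \<in> X \<Longrightarrow> y \<in> X \<Longrightarrow> \<bar>\<rho>0 x * p x y\<bar> = \<rho>0 x * p x y"
  using \<rho>0_nonneg p_nonneg by simp

lemma joint_nonneg: "x \<in> X \<Longrightarrow> y \<in> X \<Longrightarrow> 0 \<le> \<rho>0 x * p x y"
  using \<rho>0_nonneg p_nonneg by simp

lemma joint_measurable [measurable]:
  "(\<lambda>(x, y). j0 x y) \<in> borel_measurable (L \<Otimes>\<^sub>M L)" "(\<lambda>(y, x). j1 y x) \<in> borel_measurable (L \<Otimes>\<^sub>M L)"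
  by measurable

lemma nn_integral_joint: "x \<in> X \<Longrightarrow> (\<integral>\<^sup>+y. ennreal (j0 x y) \<partial>L) = ennreal (\<rho>0 x)"
proof -
  assume x: "x \<in> X"
  then have [measurable]: "x \<in> space L" by simp
  have "(\<integral>\<^sup>+y. ennreal (j0 x y) \<partial>L) = (\<integral>\<^sup>+y. ennreal (\<rho>0 x) * ennreal (p x y) \<partial>L)"
    using x by (intro nn_integral_cong) (simp add: ennreal_mult \<rho>0_nonneg p_nonneg)
  also have "\<dots> = ennreal (\<rho>0 x)"
    using p_mass[OF x] by (subst nn_integral_cmult) auto
  finally show ?thesis .
qed

lemma integral_joint: "x \<in> X \<Longrightarrow> integral\<^sup>L L (j0 x) = \<rho>0 x"
proof -
  assume x: "x \<in> X"
  then have [measurable]: "x \<in> space L" by simp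
  show ?thesis
    using nn_integral_joint[OF x] \<rho>0_nonneg[OF x] by (subst integral_eq_nn_integral) auto
qed

lemma joint_mass:
  "(\<integral>\<^sup>+x. \<integral>\<^sup>+y. ennreal (j0 x y) \<partial>L \<partial>L) < \<infinity>" "(\<integral>\<^sup>+y. \<integral>\<^sup>+x. ennreal (j1 y x) \<partial>L \<partial>L) < \<infinity>"
proof -
  have "(\<integral>\<^sup>+x. \<integral>\<^sup>+y. ennreal (j0 x y) \<partial>L \<partial>L) = (\<integral>\<^sup>+x. ennreal (\<rho>0 x) \<partial>L)"
    by (intro nn_integral_cong nn_integral_joint) simp
  then show *: "(\<integral>\<^sup>+x. \<integral>\<^sup>+y. ennreal (j0 x y) \<partial>L \<partial>L) < \<infinity>"
    by (simp add: \<rho>0_mass)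
  have "(\<integral>\<^sup>+y. \<integral>\<^sup>+x. ennreal (j1 y x) \<partial>L \<partial>L) = (\<integral>\<^sup>+x. \<integral>\<^sup>+y. ennreal (j0 x y) \<partial>L \<partial>L)"
    by (rule LL.Fubini') measurable
  with * show "(\<integral>\<^sup>+y. \<integral>\<^sup>+x. ennreal (j1 y x) \<partial>L \<partial>L) < \<infinity>" by simp
qed

lemma sets_initial_law [simp, measurable_cong]: "sets (initial_law X \<rho>0) = sets L"
  by (simp add: initial_law_def)

lemma AE_initial_law_pair:
  assumes "Measurable.pred (L \<Otimes>\<^sub>M L) (\<lambda>(x, y). P x y)"
  shows "(AE (x, y) in initial_law X \<rho>0 \<Otimes>\<^sub>M L. P x y) \<longleftrightarrow> (AE x in L. 0 < \<rho>0 x \<longrightarrow> (AE y in L. P x y))"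
proof -
  interpret I: prob_space "initial_law X \<rho>0"
  proof
    show "emeasure (initial_law X \<rho>0) (space (initial_law X \<rho>0)) = 1"
      using \<rho>0_mass by (simp add: initial_law_def emeasure_density cong: nn_integral_cong_simp)
  qed
  interpret IL: pair_sigma_finite "initial_law X \<rho>0" L ..
  have "sets (initial_law X \<rho>0 \<Otimes>\<^sub>M L) = sets (L \<Otimes>\<^sub>M L)"
    by (intro sets_pair_measure_cong) auto
  then have "Measurable.pred (initial_law X \<rho>0 \<Otimes>\<^sub>M L) (\<lambda>(x, y). P x y)"
    using assms by (simp cong: measurable_cong_sets)
  then have "{z \<in> space (initial_law X \<rho>0 \<Otimes>\<^sub>M L). P (fst z) (snd z)} \<in> sets (initial_law X \<rho>0 \<Otimes>\<^sub>M L)"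
    by (simp add: split_beta' pred_def)
  from IL.AE_pair_iff[OF this]
  have "(AE (x, y) in initial_law X \<rho>0 \<Otimes>\<^sub>M L. P x y) \<longleftrightarrow> (AE x in initial_law X \<rho>0. AE y in L. P x y)"
    by (simp add: split_beta')
  also have "\<dots> \<longleftrightarrow> (AE x in L. 0 < \<rho>0 x \<longrightarrow> (AE y in L. P x y))"
    unfolding initial_law_def by (subst AE_density) auto
  finally show ?thesis .
qed

text \<open>The factors in the definitions of lumpability and decomposability are functions on \<open>r ` X\<close>, which may fail to be
  Borel.  Cut off to \<open>S0\<close> they become functions on the whole space without a change at almost all \<open>r x\<close>.\<close>

lemma conull_core:
  obtains S0 where "S0 \<in> sets borel" "S0 \<subseteq> r ` X" "AE x in L. r x \<in> S0"
proof -
  obtain X0 where X0: "X0 \<subseteq> X" "AE x in L. x \<in> X0" "r ` X0 \<in> sets borel"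
    using continuous_image_conull_borel[OF X cont] .
  show ?thesis
    by (rule that[of "r ` X0"]) (use X0 in \<open>auto elim!: eventually_mono\<close>)
qed

lemma lumpable_imp_factorization:
  assumes "lumpable X \<rho>0 p r"
  obtains a k where "(\<lambda>(z, y). k z y) \<in> borel_measurable (borel \<Otimes>\<^sub>M L)"
    "AE x in L. AE y in L. j0 x y = a x * k (r x) y"
proof -
  obtain pL where pL [measurable]: "(\<lambda>(z, y). pL z y) \<in> borel_measurable (restrict_space borel (r ` X) \<Otimes>\<^sub>M L)"
    and eq: "AE (x, y) in initial_law X \<rho>0 \<Otimes>\<^sub>M L. p x y = pL (r x) y"
    using assms unfolding lumpable_def by blast
  obtain S0 where S0: "S0 \<in> sets borel" "S0 \<subseteq> r ` X" "AE x in L. r x \<in> S0"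
    by (rule conull_core)
  have "AE x in L. 0 < \<rho>0 x \<longrightarrow> (AE y in L. p x y = pL (r x) y)"
    using eq by (subst (asm) AE_initial_law_pair) measurable
  then have "AE x in L. AE y in L. j0 x y = \<rho>0 x * (indicator S0 (r x) * pL (r x) y)"
    using S0(3) AE_space
  proof eventually_elim
    case (elim x)
    then have x: "x \<in> X" and in_S0: "r x \<in> S0" by simp_all
    show ?case
    proof (cases "\<rho>0 x = 0")
      case False
      then have "AE y in L. p x y = pL (r x) y"
        using elim(1) \<rho>0_nonneg[OF x] by simp
      then show ?thesis
        using AE_space
      proof eventually_elim
        case (elim y)
        have "j0 x y = \<rho>0 x * p x y"
          using elim(2) x by simp
        then show ?case
          using elim(1) in_S0 by simp
      qed
    qed simp
  qed
  then show ?thesis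
    by (rule that[OF borel_measurable_extend_fst[OF pL S0(1,2)]])
qed

text \<open>The factor \<open>integral\<^sup>L L (j0 x)\<close> is \<open>\<rho>0 x\<close>, which cancels where it is positive.\<close>

lemma factorization_imp_lumpable:
  assumes k [measurable]: "(\<lambda>(z, y). k z y) \<in> borel_measurable (borel \<Otimes>\<^sub>M L)" and k0: "\<And>z y. 0 \<le> k z y"
    and fac: "AE x in L. AE y in L. j0 x y = integral\<^sup>L L (j0 x) * k (r x) y"
  shows "lumpable X \<rho>0 p r"
  unfolding lumpable_def
proof (intro exI conjI ballI)
  have [measurable]: "(\<lambda>z. z) \<in> measurable (restrict_space borel (r ` X)) borel"
    by (intro measurable_restrict_space1) simp
  have fst [measurable]: "fst \<in> measurable (restrict_space borel (r ` X) \<Otimes>\<^sub>M L) borel"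
    by (intro measurable_compose[OF measurable_fst]) simp
  show "(\<lambda>(z, y). k z y) \<in> borel_measurable (restrict_space borel (r ` X) \<Otimes>\<^sub>M L)"
    by measurable
  have "AE x in L. 0 < \<rho>0 x \<longrightarrow> (AE y in L. p x y = k (r x) y)"
    using fac AE_space
  proof eventually_elim
    case (elim x)
    then have x: "x \<in> X" by simp
    show ?case
    proof
      assume pos: "0 < \<rho>0 x"
      show "AE y in L. p x y = k (r x) y"
        using elim(1) AE_space by eventually_elim (use pos x in \<open>simp add: integral_joint\<close>)
    qed
  qed
  then show "AE (x, y) in initial_law X \<rho>0 \<Otimes>\<^sub>M L. p x y = k (r x) y"
    by (subst AE_initial_law_pair) measurable
qed (rule k0)

text \<open>For fixed \<open>y\<close> the local density is a factor \<open>a y\<close>, and what remains depends on \<open>y\<close> through \<open>r y\<close>.  As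
  \<open>k\<close> may be any measurable function, \<open>\<rho>0 x\<close> is absorbed in it.\<close>

lemma decomposable_imp_factorization:
  assumes "decomposable X \<rho>0 p r"
  obtains a k where "(\<lambda>(z, x). k z x) \<in> borel_measurable (borel \<Otimes>\<^sub>M L)"
    "AE y in L. AE x in L. j1 y x = a y * k (r y) x"
proof -
  obtain pD plocal where pD [measurable]: "(\<lambda>(x, z). pD x z) \<in> borel_measurable (L \<Otimes>\<^sub>M restrict_space borel (r ` X))"
    and pl [measurable]: "(\<lambda>(z, y). plocal z y) \<in> borel_measurable (restrict_space borel (r ` X) \<Otimes>\<^sub>M L)"
    and eq: "AE (x, y) in initial_law X \<rho>0 \<Otimes>\<^sub>M L. p x y = pD x (r y) * plocal (r y) y"
    using assms unfolding decomposable_def by blast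
  obtain S0 where S0: "S0 \<in> sets borel" "S0 \<subseteq> r ` X" "AE x in L. r x \<in> S0"
    by (rule conull_core)
  have "AE x in L. 0 < \<rho>0 x \<longrightarrow> (AE y in L. p x y = pD x (r y) * plocal (r y) y)"
    using eq by (subst (asm) AE_initial_law_pair) measurable
  then have "AE x in L. AE y in L. j1 y x = plocal (r y) y * (\<rho>0 x * pD x (r y))"
    using AE_space
  proof eventually_elim
    case (elim x)
    then have x: "x \<in> X" by simp
    show ?case
    proof (cases "\<rho>0 x = 0")
      case False
      then have "AE y in L. p x y = pD x (r y) * plocal (r y) y"
        using elim(1) \<rho>0_nonneg[OF x] by simp
      then show ?thesis
        using AE_space
      proof eventually_elim
        case (elim y)
        have "j1 y x = \<rho>0 x * p x y"
          using elim(2) x by simp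
        then show ?case
          using elim(1) by simp
      qed
    qed simp
  qed
  then have "AE y in L. AE x in L. j1 y x = plocal (r y) y * (\<rho>0 x * pD x (r y))"
    by (subst (asm) LL.AE_commute) measurable
  then have "AE y in L. AE x in L. j1 y x = plocal (r y) y * (indicator S0 (r y) * (\<rho>0 x * pD x (r y)))"
    using S0(3) by eventually_elim (auto elim!: eventually_mono)
  moreover have "(\<lambda>(z, x). indicator S0 z * (\<rho>0 x * pD x z)) \<in> borel_measurable (borel \<Otimes>\<^sub>M L)"
    by (rule borel_measurable_extend_fst[OF _ S0(1,2)]) measurable
  ultimately show ?thesis
    by (rule that[rotated])
qed

text \<open>The factor \<open>integral\<^sup>L L (j1 y)\<close> is the density of the arrival point \<open>y\<close>, which becomes the local density;
  dividing by \<open>\<rho>0 x\<close> turns \<open>k\<close> into a transition density to the value \<open>r y\<close>.\<close>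

lemma factorization_imp_decomposable:
  assumes k [measurable]: "(\<lambda>(z, x). k z x) \<in> borel_measurable (borel \<Otimes>\<^sub>M L)" and k0: "\<And>z x. 0 \<le> k z x"
    and fac: "AE y in L. AE x in L. j1 y x = integral\<^sup>L L (j1 y) * k (r y) x"
  shows "decomposable X \<rho>0 p r"
  unfolding decomposable_def
proof (intro exI conjI ballI)
  have [measurable]: "snd \<in> measurable (L \<Otimes>\<^sub>M restrict_space borel (r ` X)) borel"
    by (intro measurable_compose[OF measurable_snd] measurable_restrict_space1) simp
  show "(\<lambda>(x, z). k z x / \<rho>0 x) \<in> borel_measurable (L \<Otimes>\<^sub>M restrict_space borel (r ` X))"
    by measurable
  show "(\<lambda>(z, y). integral\<^sup>L L (j1 y)) \<in> borel_measurable (restrict_space borel (r ` X) \<Otimes>\<^sub>M L)"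
    by measurable
  show "0 \<le> k z x / \<rho>0 x" if "x \<in> X" for x z
    using that k0 \<rho>0_nonneg by simp
  show "0 \<le> integral\<^sup>L L (j1 y)" for y
    by simp
  have "AE x in L. AE y in L. j1 y x = integral\<^sup>L L (j1 y) * k (r y) x"
    using fac by (subst LL.AE_commute) measurable
  then have "AE x in L. 0 < \<rho>0 x \<longrightarrow> (AE y in L. p x y = k (r y) x / \<rho>0 x * integral\<^sup>L L (j1 y))"
    using AE_space
  proof eventually_elim
    case (elim x)
    then have x: "x \<in> X" by simp
    show ?case
    proof
      assume pos: "0 < \<rho>0 x"
      show "AE y in L. p x y = k (r y) x / \<rho>0 x * integral\<^sup>L L (j1 y)"
        using elim(1) AE_space
      proof eventually_elim
        case (elim y)
        then have "\<rho>0 x * p x y = k (r y) x * integral\<^sup>L L (j1 y)"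
          using x by (simp add: mult.commute)
        then show ?case
          using pos by (simp add: eq_divide_eq mult.commute)
      qed
    qed
  qed
  then show "AE (x, y) in initial_law X \<rho>0 \<Otimes>\<^sub>M L. p x y = k (r y) x / \<rho>0 x * integral\<^sup>L L (j1 y)"
    by (subst AE_initial_law_pair) measurable
qed

lemma vector_field_measurable:
  fixes v :: "real \<Rightarrow> real^'n \<Rightarrow> real^'e \<Rightarrow> real^'n"
  assumes "v \<in> vector_fields" and [measurable]: "f \<in> borel_measurable L"
  shows "(\<lambda>(s, y, c). v s y (f c)) \<in> borel_measurable (borel \<Otimes>\<^sub>M borel \<Otimes>\<^sub>M L)"
  unfolding split_beta' by (rule measurable_compose3[OF assms(1)[unfolded vector_fields_iff]]) measurable

lemma losses:
  assumes "v \<in> vector_fields"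
  shows "loss0 X \<rho>0 p v = fm_loss L L j0 v" "loss1 X \<rho>0 p v = fm_loss L L j1 v"
  by (rule loss0_eq_fm_loss[OF X \<rho>0_measurable p_measurable _ vector_field_measurable[OF assms point]], fact joint_nonneg)
    (rule loss1_eq_fm_loss[OF X \<rho>0_measurable p_measurable _ vector_field_measurable[OF assms point]], fact joint_nonneg)

lemma coarse_losses:
  assumes "w \<in> vector_fields"
  shows "loss0 X \<rho>0 p (\<lambda>s y x. w s y (r x)) = fm_loss L L j0 (\<lambda>s y x. w s y (r x))"
    "loss1 X \<rho>0 p (\<lambda>s x y. w s x (r y)) = fm_loss L L j1 (\<lambda>s x y. w s x (r y))"
  by (rule loss0_eq_fm_loss[OF X \<rho>0_measurable p_measurable _ vector_field_measurable[OF assms r_measurable]], fact joint_nonneg)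
    (rule loss1_eq_fm_loss[OF X \<rho>0_measurable p_measurable _ vector_field_measurable[OF assms r_measurable]], fact joint_nonneg)

end

lemma ennreal_sum_eq_iff:
  fixes a b c d :: ennreal
  assumes "a \<le> c" "b \<le> d" "a + b < \<infinity>"
  shows "c + d = a + b \<longleftrightarrow> c = a \<and> d = b"
proof
  assume eq: "c + d = a + b"
  have fin: "a < \<infinity>" "b < \<infinity>"
    using assms(3) by (auto simp: less_top)
  have "c + b \<le> a + b"
    using add_left_mono[OF assms(2), of c] eq by simp
  then have "c \<le> a"
    using fin by (auto simp: add.commute[of _ b] ennreal_add_left_cancel_le)
  moreover have "a + d \<le> a + b"
    using add_right_mono[OF assms(1), of d] eq by simp
  then have "d \<le> b"
    using fin by (auto simp: ennreal_add_left_cancel_le)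
  ultimately show "c = a \<and> d = b" using assms by auto
qed simp

theorem theorem4p1:
  fixes X :: "(real^'n) set"
    and \<rho>0 :: "real^'n \<Rightarrow> real"
    and p :: "real^'n \<Rightarrow> real^'n \<Rightarrow> real"
    and r :: "real^'n \<Rightarrow> real^'d"
  assumes "X \<in> sets lebesgue"
    and "prob_density_on X \<rho>0"
    and "transition_density_on X p"
    and "reaction_coordinate X r"
  shows "(\<exists>w\<in>vector_fields \<times> vector_fields. loss_FMRC X \<rho>0 p r w = min_loss_FMRC X \<rho>0 p r) \<and>
         (\<exists>v\<in>vector_fields \<times> vector_fields. loss X \<rho>0 p v = min_loss X \<rho>0 p) \<and>
         min_loss_FMRC X \<rho>0 p r \<ge> min_loss X \<rho>0 p \<and>
         (min_loss X \<rho>0 p < \<infinity> \<longrightarrow>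
            (min_loss_FMRC X \<rho>0 p r = min_loss X \<rho>0 p \<longleftrightarrow> lumpable X \<rho>0 p r \<and> decomposable X \<rho>0 p r))"
proof -
  have "continuous_on X r"
    using assms(4) unfolding reaction_coordinate_def by (meson has_derivative_continuous_on)
  then interpret transition_data X \<rho>0 p r
    using assms by unfold_locales auto
  define F0 :: "(real \<Rightarrow> real^'n \<Rightarrow> real^'n \<Rightarrow> real^'n) \<Rightarrow> ennreal" where "F0 = fm_loss L L j0"
  define F1 :: "(real \<Rightarrow> real^'n \<Rightarrow> real^'n \<Rightarrow> real^'n) \<Rightarrow> ennreal" where "F1 = fm_loss L L j1"
  let ?r = "\<lambda>w s y c. w s y (r c)"
  obtain v0 w0 where m0: "v0 \<in> vector_fields" "w0 \<in> vector_fields"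
    "\<And>v. v \<in> vector_fields \<Longrightarrow> F0 v0 \<le> F0 v" "\<And>w. w \<in> vector_fields \<Longrightarrow> F0 (?r w0) \<le> F0 (?r w)" "F0 v0 \<le> F0 (?r w0)"
    and f0: "F0 (?r w0) = F0 v0 \<Longrightarrow> F0 v0 < \<infinity> \<Longrightarrow>
      \<exists>k. (\<lambda>(z, y). k z y) \<in> borel_measurable (borel \<Otimes>\<^sub>M L) \<and> (\<forall>z y. 0 \<le> k z y) \<and>
        (AE x in L. AE y in L. j0 x y = integral\<^sup>L L (j0 x) * k (r x) y)"
    and b0: "\<And>a k. (\<lambda>(z, y). k z y) \<in> borel_measurable (borel \<Otimes>\<^sub>M L) \<Longrightarrow>
      (AE x in L. AE y in L. j0 x y = a x * k (r x) y) \<Longrightarrow> F0 (?r w0) = F0 v0"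
    unfolding F0_def
  proof (rule fine_and_coarse_minimizers[OF X joint_measurable(1) abs_ge_zero joint_mass(1) r_measurable], goal_cases)
    case (1 v0 w0)
    show ?case
      by (rule 1(1)[of v0 w0]) (fact 1)+
  qed
  obtain v1 w1 where m1: "v1 \<in> vector_fields" "w1 \<in> vector_fields"
    "\<And>v. v \<in> vector_fields \<Longrightarrow> F1 v1 \<le> F1 v" "\<And>w. w \<in> vector_fields \<Longrightarrow> F1 (?r w1) \<le> F1 (?r w)" "F1 v1 \<le> F1 (?r w1)"
    and f1: "F1 (?r w1) = F1 v1 \<Longrightarrow> F1 v1 < \<infinity> \<Longrightarrow>
      \<exists>k. (\<lambda>(z, x). k z x) \<in> borel_measurable (borel \<Otimes>\<^sub>M L) \<and> (\<forall>z x. 0 \<le> k z x) \<and>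
        (AE y in L. AE x in L. j1 y x = integral\<^sup>L L (j1 y) * k (r y) x)"
    and b1: "\<And>a k. (\<lambda>(z, x). k z x) \<in> borel_measurable (borel \<Otimes>\<^sub>M L) \<Longrightarrow>
      (AE y in L. AE x in L. j1 y x = a y * k (r y) x) \<Longrightarrow> F1 (?r w1) = F1 v1"
    unfolding F1_def
  proof (rule fine_and_coarse_minimizers[OF X joint_measurable(2) abs_ge_zero joint_mass(2) r_measurable], goal_cases)
    case (1 v0 w0)
    show ?case
      by (rule 1(1)[of v0 w0]) (fact 1)+
  qed
  have fine: "loss X \<rho>0 p (v, v') = F0 v + F1 v'" if "v \<in> vector_fields" "v' \<in> vector_fields" for v v'
    using losses(1)[OF that(1)] losses(2)[OF that(2)] by (simp add: loss_def F0_def F1_def)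
  have coarse: "loss_FMRC X \<rho>0 p r (w, w') = F0 (?r w) + F1 (?r w')" if "w \<in> vector_fields" "w' \<in> vector_fields" for w w'
    using coarse_losses(1)[OF that(1)] coarse_losses(2)[OF that(2)] by (simp add: loss_FMRC_def F0_def F1_def)
  \<comment> \<open>The two fields can be chosen independently, so the infimum of the sum is the sum of the minima.\<close>
  have min_fine: "min_loss X \<rho>0 p = F0 v0 + F1 v1"
    unfolding min_loss_def
  proof (rule antisym)
    show "(INF v\<in>vector_fields \<times> vector_fields. loss X \<rho>0 p v) \<le> F0 v0 + F1 v1"
      using m0 m1 by (intro INF_lower2[of "(v0, v1)"]) (auto simp: fine)
    show "F0 v0 + F1 v1 \<le> (INF v\<in>vector_fields \<times> vector_fields. loss X \<rho>0 p v)"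
      using m0(3) m1(3) by (intro INF_greatest) (auto simp: fine intro!: add_mono)
  qed
  have min_coarse: "min_loss_FMRC X \<rho>0 p r = F0 (?r w0) + F1 (?r w1)"
    unfolding min_loss_FMRC_def
  proof (rule antisym)
    show "(INF w\<in>vector_fields \<times> vector_fields. loss_FMRC X \<rho>0 p r w) \<le> F0 (?r w0) + F1 (?r w1)"
      using m0 m1 by (intro INF_lower2[of "(w0, w1)"]) (auto simp: coarse)
    show "F0 (?r w0) + F1 (?r w1) \<le> (INF w\<in>vector_fields \<times> vector_fields. loss_FMRC X \<rho>0 p r w)"
      using m0(4) m1(4) by (intro INF_greatest) (auto simp: coarse intro!: add_mono)
  qed
  show ?thesis
  proof (intro conjI impI)
    show "\<exists>w\<in>vector_fields \<times> vector_fields. loss_FMRC X \<rho>0 p r w = min_loss_FMRC X \<rho>0 p r"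
      using m0(2) m1(2) by (intro bexI[of _ "(w0, w1)"]) (auto simp: min_coarse coarse)
    show "\<exists>v\<in>vector_fields \<times> vector_fields. loss X \<rho>0 p v = min_loss X \<rho>0 p"
      using m0(1) m1(1) by (intro bexI[of _ "(v0, v1)"]) (auto simp: min_fine fine)
    show "min_loss X \<rho>0 p \<le> min_loss_FMRC X \<rho>0 p r"
      unfolding min_fine min_coarse using m0(5) m1(5) by (rule add_mono)
    assume fin: "min_loss X \<rho>0 p < \<infinity>"
    then have fin0: "F0 v0 < \<infinity>" and fin1: "F1 v1 < \<infinity>"
      by (auto simp: min_fine less_top)
    have "min_loss_FMRC X \<rho>0 p r = min_loss X \<rho>0 p \<longleftrightarrow> F0 (?r w0) = F0 v0 \<and> F1 (?r w1) = F1 v1"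
      using ennreal_sum_eq_iff[OF m0(5) m1(5)] fin unfolding min_fine min_coarse by blast
    also have "F0 (?r w0) = F0 v0 \<longleftrightarrow> lumpable X \<rho>0 p r"
    proof
      assume "F0 (?r w0) = F0 v0"
      then show "lumpable X \<rho>0 p r"
        using f0[OF _ fin0] factorization_imp_lumpable by blast
    next
      assume "lumpable X \<rho>0 p r"
      then show "F0 (?r w0) = F0 v0"
        by (rule lumpable_imp_factorization) (rule b0)
    qed
    also have "F1 (?r w1) = F1 v1 \<longleftrightarrow> decomposable X \<rho>0 p r"
    proof
      assume "F1 (?r w1) = F1 v1"
      then show "decomposable X \<rho>0 p r"
        using f1[OF _ fin1] factorization_imp_decomposable by blast
    next
      assume "decomposable X \<rho>0 p r"
      then show "F1 (?r w1) = F1 v1"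
        by (rule decomposable_imp_factorization) (rule b1)
    qed
    finally show "min_loss_FMRC X \<rho>0 p r = min_loss X \<rho>0 p \<longleftrightarrow> lumpable X \<rho>0 p r \<and> decomposable X \<rho>0 p r" .
  qed
qed

end
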